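(* Let $\alpha_1,p_1,\alpha_2,p_2>0$ with $\alpha_1\alpha_2>1+|\alpha_1-\alpha_2|$, and let $X\sim BG(\alpha_1,p_1,\alpha_2,p_2)$. Let $G_n=I_2(f_n)$ with $f_n\in\mathcal{H}^{\odot2}$, $n\ge1$. Put $$\alpha_{12}=\frac{\alpha_1\alpha_2}{\alpha_1\alpha_2-(1+|\alpha_1-\alpha_2|)},\qquad \alpha_{13}=\frac1{\alpha_1}-\frac1{\alpha_2}.$$ Then for every $n\ge 1$ $$\begin{aligned}d_3(G_n,X)\le{}&\frac13\alpha_{12}\Big\{\frac1{120}\kappa_6(G_n)-\frac1{12}\alpha_{13}\kappa_5(G_n)+\Big(\frac16\alpha_{13}^2-\frac1{3\alpha_1\alpha_2}\Big)\kappa_4(G_n)+\frac{1}{\alpha_1\alpha_2}\alpha_{13}\kappa_3(G_n)+\frac14\kappa_3^2(G_n)\\&\quad-\alpha_{13}\kappa_2(G_n)\kappa_3(G_n)+\frac1{\alpha_1^2\alpha_2^2}\kappa_2(G_n)+\alpha_{13}^2\kappa_2^2(G_n)\Big\}^{1/2}\\&+\frac12\alpha_{12}\left|\frac{p_1+p_2}{\alpha_1\alpha_2}-\kappa_2(G_n)\right|+\alpha_{12}\left|\frac{p_1}{\alpha_1}-\frac{p_2}{\alpha_2}\right|.\end{aligned}$$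
   Context: Bilateral gamma: $Ga(\alpha,p)$ ($\alpha,p>0$) has density $\frac{\alpha^p}{\Gamma(p)}e^{-\alpha x}x^{p-1}$, $x>0$. If $X_1\sim Ga(\alpha_1,p_1)$ and $X_2\sim Ga(\alpha_2,p_2)$ are independent, the law of $X_1-X_2$ is denoted $BG(\alpha_1,p_1,\alpha_2,p_2)$. Metric: $d_3(Y,Z)=\sup_{h\in\mathcal{W}_3}|\mathbb{E}h(Y)-\mathbb{E}h(Z)|$, where $\mathcal{W}_3$ is the set of three times differentiable $h:\mathbb{R}\to\mathbb{R}$ with $\|h^{(k)}\|\le1$ for $k=0,1,2,3$ (supremum norm). Wiener chaos: $\mathcal{H}$ is a real separable Hilbert space, $W=\{W(h):h\in\mathcal{H}\}$ an isonormal Gaussian process over $\mathcal{H}$, $\mathcal{H}^{\odot2}$ the symmetric second tensor power of $\mathcal{H}$, and $I_2:\mathcal{H}^{\odot 2}\to L^2(\Omega)$ the double Wiener–Itô integral, i.e. the continuous linear map onto the second Wiener chaos with $I_2(h\otimes h)=W(h)^2-1$ for $\|h\|_{\mathcal{H}}=1$; $\mathbb{E}[I_2(f)I_2(g)]=2\langle f,g\rangle_{\mathcal{H}^{\otimes2}}$. $\kappa_m(G)=(-i)^m\frac{d^m}{dt^m}\log\mathbb{E}(e^{itG})\big|_{t=0}$ is the $m$th cumulant of $G$, and $\kappa_m^2(G)=(\kappa_m(G))^2$. *)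

theory Defs
  imports "HOL-Probability.Probability"
begin

subsection \<open>Bilateral gamma laws\<close>

definition gamma_law :: "real \<Rightarrow> real \<Rightarrow> real measure" where
  "gamma_law \<alpha> p = density lborel
     (\<lambda>x. ennreal (if x > 0 then \<alpha> powr p / Gamma p * exp (- \<alpha> * x) * x powr (p - 1) else 0))"

text \<open>The product measure is the joint law of an independent pair.\<close>

definition bilateral_gamma :: "real \<Rightarrow> real \<Rightarrow> real \<Rightarrow> real \<Rightarrow> real measure" where
  "bilateral_gamma \<alpha>1 p1 \<alpha>2 p2 =
     distr (gamma_law \<alpha>1 p1 \<Otimes>\<^sub>M gamma_law \<alpha>2 p2) borel (\<lambda>(x, y). x - y)"


subsection \<open>The smooth metric of order three\<close>

definition W3 :: "(real \<Rightarrow> real) set" where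
  "W3 = {h. (\<forall>k<3. \<forall>x. (deriv ^^ k) h differentiable (at x)) \<and>
            (\<forall>k\<le>3. \<forall>x. \<bar>(deriv ^^ k) h x\<bar> \<le> 1)}"

text \<open>The variables may live on different probability spaces. The set of which the supremum
  is taken is nonempty and, for probability measures, bounded by 2.\<close>

definition d3 :: "'a measure \<Rightarrow> ('a \<Rightarrow> real) \<Rightarrow> 'b measure \<Rightarrow> ('b \<Rightarrow> real) \<Rightarrow> real" where
  "d3 M Y N Z = (SUP h\<in>W3. \<bar>(\<integral>\<omega>. h (Y \<omega>) \<partial>M) - (\<integral>\<omega>. h (Z \<omega>) \<partial>N)\<bar>)"


subsection \<open>Cumulants\<close>

text \<open>The characteristic function equals 1 at 0, so near 0 the principal branch is the
  continuous logarithm vanishing at 0. The number under \<open>Re\<close> is real whenever the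
  \<open>m\<close>-th moment exists; \<open>Re\<close> only adjusts the type.\<close>

definition cumulant :: "'a measure \<Rightarrow> ('a \<Rightarrow> real) \<Rightarrow> nat \<Rightarrow> real" where
  "cumulant M Y m =
     Re ((- \<i>) ^ m *
         ((\<lambda>g t. vector_derivative g (at t)) ^^ m) (\<lambda>t. Ln (char (distr M borel Y) t)) 0)"


subsection \<open>Isonormal Gaussian processes\<close>

text \<open>Degenerate laws are Gaussian, with variance 0.\<close>

definition centred_gaussian :: "'a measure \<Rightarrow> ('a \<Rightarrow> real) \<Rightarrow> bool" where
  "centred_gaussian M Y \<longleftrightarrow> Y \<in> borel_measurable M \<and>
     ((AE \<omega> in M. Y \<omega> = 0) \<or> (\<exists>\<sigma>>0. distributed M lborel Y (normal_density 0 \<sigma>)))"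

text \<open>Joint Gaussianity of the family: every finite linear combination is Gaussian.\<close>

definition isonormal_gaussian_process ::
    "'a measure \<Rightarrow> ('h::{real_inner, polish_space} \<Rightarrow> 'a \<Rightarrow> real) \<Rightarrow> bool" where
  "isonormal_gaussian_process M W \<longleftrightarrow>
     prob_space M \<and>
     (\<forall>A c. finite A \<longrightarrow> centred_gaussian M (\<lambda>\<omega>. \<Sum>h\<in>A. c h * W h \<omega>)) \<and>
     (\<forall>g h. (\<integral>\<omega>. W g \<omega> * W h \<omega> \<partial>M) = g \<bullet> h)"


subsection \<open>Hilbert tensor square and the double Wiener-Ito integral\<close>

text \<open>The Hilbert tensor square of \<open>'h\<close> is given up to unique isometric isomorphism: a Hilbert
  space \<open>'t\<close> with a bilinear map whose inner products factorise and whose range is total.\<close>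

definition hilbert_tensor_square ::
    "('h::{real_inner, polish_space} \<Rightarrow> 'h \<Rightarrow> 't::{real_inner, complete_space}) \<Rightarrow> bool" where
  "hilbert_tensor_square tensor \<longleftrightarrow>
     bilinear tensor \<and>
     (\<forall>a b c d. tensor a b \<bullet> tensor c d = (a \<bullet> c) * (b \<bullet> d)) \<and>
     closure (span {tensor a b |a b. True}) = UNIV"

definition sym_tensors ::
    "('h::{real_inner, polish_space} \<Rightarrow> 'h \<Rightarrow> 't::{real_inner, complete_space}) \<Rightarrow> 't set" where
  "sym_tensors tensor = closure (span {tensor a b + tensor b a |a b. True})"

text \<open>\<open>I2\<close> selects representatives of elements of \<open>L\<^sup>2\<close>, so identities hold almost everywhere.
  Since the \<open>h \<otimes> h\<close> with \<open>h\<close> of norm 1 span a dense subspace of the symmetric tensors, the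
  conditions determine \<open>I2\<close> there up to null sets; the isometry (up to the factor 2) and
  the range being the second chaos are consequences.\<close>

definition double_wiener_integral ::
    "'a measure \<Rightarrow> ('h::{real_inner, polish_space} \<Rightarrow> 'a \<Rightarrow> real) \<Rightarrow>
     ('h \<Rightarrow> 'h \<Rightarrow> 't::{real_inner, complete_space}) \<Rightarrow> ('t \<Rightarrow> 'a \<Rightarrow> real) \<Rightarrow> bool" where
  "double_wiener_integral M W tensor I2 \<longleftrightarrow>
     (\<forall>f\<in>sym_tensors tensor.
        I2 f \<in> borel_measurable M \<and> integrable M (\<lambda>\<omega>. (I2 f \<omega>)\<^sup>2)) \<and>
     (\<forall>f\<in>sym_tensors tensor. \<forall>g\<in>sym_tensors tensor. \<forall>a b.
        AE \<omega> in M. I2 (a *\<^sub>R f + b *\<^sub>R g) \<omega> = a * I2 f \<omega> + b * I2 g \<omega>) \<and>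
     (\<forall>f\<in>sym_tensors tensor.
        ((\<lambda>g. \<integral>\<omega>. (I2 g \<omega> - I2 f \<omega>)\<^sup>2 \<partial>M) \<longlongrightarrow> 0) (at f within sym_tensors tensor)) \<and>
     (\<forall>h. norm h = 1 \<longrightarrow> (AE \<omega> in M. I2 (tensor h h) \<omega> = (W h \<omega>)\<^sup>2 - 1))"

end

theory Submission
  imports Defs "HOL-Complex_Analysis.Complex_Analysis"
begin

text \<open>
  Both laws are compared along the Ornstein-Uhlenbeck type dynamics
  \<open>dY = -Y dt + dJ\<close> that leaves the bilateral gamma law \<open>X\<close> invariant; here \<open>J\<close> is a compound
  Poisson process with exponentially distributed jumps of both signs. Its Euler steps shrink
  the \<open>k\<close>-th derivative of a test function by the factor \<open>(1 - \<epsilon>)^k\<close>, and summing the geometric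
  series yields the weights \<open>1, 1/2, 1/3\<close>.
  Smoothing by the two exponential laws turns the generator, applied to \<open>h\<close>, into the second-order
  Stein operator of \<open>X\<close>, applied to a function \<open>f\<close> whose derivatives of orders \<open>0, 1, 2\<close> are bounded
  like those of \<open>h\<close> of orders \<open>1, 2, 3\<close>.
  For \<open>G = \<Sum> \<lambda>\<^sub>j (Z\<^sub>j\<^sup>2 - 1)\<close> with independent standard normal \<open>Z\<^sub>j\<close>, two Gaussian integrations by parts
  and the Cauchy-Schwarz inequality bound the expectation of the Stein operator at \<open>G\<close> by power
  sums of the \<open>\<lambda>\<^sub>j\<close>, that is, by cumulants.
  A general element of the second chaos is an \<open>L\<^sup>2\<close> limit of such \<open>G\<close>. The logarithms of the
  characteristic functions are holomorphic and uniformly bounded near 0, so by Montel's theorem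
  the cumulants converge along a subsequence.
  The bound obtained has the constant 1 in place of \<open>\<alpha>\<^sub>1\<^sub>2 \<ge> 1\<close>.
\<close>

text \<open>The Stein equation of \<open>X\<close> is not solved. Its solution would be a time
  integral along the semigroup of the dynamics; a telescoping sum of Euler steps takes the place of
  that integral. Since the total jump rate \<open>p1 + p2\<close> is finite, a step is an explicit
  average, and its error of order \<open>\<epsilon>^2\<close>, damped geometrically, sums to order
  \<epsilon>. The second obstacle is that cumulants are derivatives at 0 of the logarithm of a
  characteristic function, whereas approximation in mean square controls this function at real
  points only. A complex disc whose radius depends only on a bound for
  \<open>\<Sum> \<lambda>\<^sub>j^2\<close> bridges the gap; this sum is the squared norm of the
  approximating tensor and stays bounded. The expression under the root is the second moment of the
  random factor that multiplies the second derivative of the Stein function after the integrations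
  by parts, rewritten by
  \<open>\<kappa>\<^sub>m = 2^(m-1) (m-1)! \<Sum> \<lambda>\<^sub>j^m\<close>.\<close>

section \<open>Comparison along an Euler scheme\<close>

text \<open>Quadratic remainders survive integration against a finite measure, so this criterion
  serves to differentiate averages of test functions under the integral sign.\<close>

lemma has_real_derivative_quadratic_bound:
  fixes F :: "real \<Rightarrow> real"
  assumes "\<And>y. \<bar>F y - F x - (y - x) * D\<bar> \<le> K * (y - x)\<^sup>2"
  shows "(F has_real_derivative D) (at x)"
proof -
  have "((\<lambda>y. \<bar>(F y - F x) / (y - x) - D\<bar>) \<longlongrightarrow> 0) (at x)"
  proof (rule tendsto_sandwich[where f="\<lambda>_. 0" and h="\<lambda>y. K * \<bar>y - x\<bar>"])
    show "\<forall>\<^sub>F y in at x. \<bar>(F y - F x) / (y - x) - D\<bar> \<le> K * \<bar>y - x\<bar>"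
    proof (rule eventually_at_filter[THEN iffD2, OF always_eventually], intro allI impI)
      fix y assume "y \<noteq> x"
      then have "\<bar>(F y - F x) / (y - x) - D\<bar> = \<bar>F y - F x - (y - x) * D\<bar> / \<bar>y - x\<bar>"
        by (simp add: field_simps flip: abs_divide)
      also have "\<dots> \<le> (K * (y - x)\<^sup>2) / \<bar>y - x\<bar>"
        by (intro divide_right_mono assms) auto
      also have "\<dots> = K * \<bar>y - x\<bar>"
        using \<open>y \<noteq> x\<close> by (simp add: field_simps power2_eq_square flip: abs_mult)
      finally show "\<bar>(F y - F x) / (y - x) - D\<bar> \<le> K * \<bar>y - x\<bar>" .
    qed
    have "((\<lambda>y. K * \<bar>y - x\<bar>) \<longlongrightarrow> K * \<bar>x - x\<bar>) (at x)"
      by (intro tendsto_intros)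
    then show "((\<lambda>y. K * \<bar>y - x\<bar>) \<longlongrightarrow> 0) (at x)" by simp
  qed auto
  then show ?thesis
    unfolding has_field_derivative_iff by (simp add: tendsto_rabs_zero_iff LIM_zero_iff)
qed

lemma real_derivative_lipschitz_bound:
  fixes w :: "real \<Rightarrow> real"
  assumes "\<And>x. (w has_real_derivative w1 x) (at x)" and "\<And>x. \<bar>w1 x\<bar> \<le> A"
  shows "\<bar>w x - w y\<bar> \<le> A * \<bar>x - y\<bar>"
proof -
  have "norm (w x - w y) \<le> A * norm (x - y)"
    by (rule field_differentiable_bound[where S=UNIV and f'=w1])
       (use assms in \<open>auto\<close>)
  then show ?thesis by simp
qed

text \<open>The mean value theorem gives the constant \<open>B\<close> instead of the sharp
  \<open>B / 2\<close> and asks only for a Lipschitz derivative. The loss is harmless: the remainder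
  enters only quantities that vanish in the limit.\<close>

lemma taylor1_lipschitz_bound:
  fixes w :: "real \<Rightarrow> real"
  assumes w: "\<And>x. (w has_real_derivative w1 x) (at x)"
    and lip: "\<And>x y. \<bar>w1 x - w1 y\<bar> \<le> B * \<bar>x - y\<bar>"
  shows "\<bar>w y - w x - (y - x) * w1 x\<bar> \<le> B * (y - x)\<^sup>2"
proof (cases "x = y")
  case False
  obtain z where z: "\<bar>z - x\<bar> \<le> \<bar>y - x\<bar>" "w y - w x = (y - x) * w1 z"
  proof (cases "x < y")
    case True
    from MVT2[OF True w] obtain z where "x < z" "z < y" "w y - w x = (y - x) * w1 z" by blast
    then show ?thesis by (intro that) auto
  next
    case F: False
    with False have "y < x" by simp
    from MVT2[OF this w] obtain z where "y < z" "z < x" "w x - w y = (x - y) * w1 z" by blast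
    then show ?thesis by (intro that[of z]) (auto simp: algebra_simps)
  qed
  have B: "0 \<le> B" using lip[of 0 1] by auto
  have "\<bar>w y - w x - (y - x) * w1 x\<bar> = \<bar>y - x\<bar> * \<bar>w1 z - w1 x\<bar>"
    by (simp add: z(2) algebra_simps flip: abs_mult)
  also have "\<dots> \<le> \<bar>y - x\<bar> * (B * \<bar>y - x\<bar>)"
    using lip[of z x] mult_left_mono[OF z(1) B] by (intro mult_left_mono) auto
  also have "\<dots> = B * (y - x)\<^sup>2" by (simp add: power2_eq_square)
  finally show ?thesis .
qed simp

lemma lipschitz_continuous:
  fixes w :: "real \<Rightarrow> real"
  assumes "\<And>x y. \<bar>w x - w y\<bar> \<le> B * \<bar>x - y\<bar>"
  shows "continuous_on UNIV w"
proof (rule lipschitz_on_continuous_on[of B])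
  have "0 \<le> B" using assms[of 0 1] by auto
  then show "B-lipschitz_on UNIV w"
    using assms by (auto simp: lipschitz_on_def dist_real_def)
qed

lemma abs_integral_le_const:
  fixes w :: "'a \<Rightarrow> real"
  assumes "finite_measure \<nu>" "w \<in> borel_measurable \<nu>" "\<And>x. \<bar>w x\<bar> \<le> K"
  shows "integrable \<nu> w" and "\<bar>\<integral>x. w x \<partial>\<nu>\<bar> \<le> K * measure \<nu> (space \<nu>)"
proof -
  interpret finite_measure \<nu> by fact
  show 1: "integrable \<nu> w"
    by (rule integrable_const_bound[of _ K]) (use assms in auto)
  have "\<bar>\<integral>x. w x \<partial>\<nu>\<bar> \<le> (\<integral>x. \<bar>w x\<bar> \<partial>\<nu>)" by (rule integral_abs_bound)
  also have "\<dots> \<le> (\<integral>x. K \<partial>\<nu>)"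
    by (rule integral_mono) (use 1 assms in auto)
  finally show "\<bar>\<integral>x. w x \<partial>\<nu>\<bar> \<le> K * measure \<nu> (space \<nu>)" by (simp add: mult.commute)
qed

section \<open>Averages over a finite jump measure\<close>

definition shift_mean :: "real measure \<Rightarrow> (real \<Rightarrow> real) \<Rightarrow> real \<Rightarrow> real" where
  "shift_mean \<nu> w x = (\<integral>u. w (x + u) \<partial>\<nu>)"

context
  fixes \<nu> :: "real measure"
  assumes fin: "finite_measure \<nu>" and sets_nu[measurable_cong]: "sets \<nu> = sets borel"
begin

lemma shift_mean_integrable:
  fixes w :: "real \<Rightarrow> real"
  assumes "continuous_on UNIV w" "\<And>x. \<bar>w x\<bar> \<le> K"
  shows "integrable \<nu> (\<lambda>u. w (x + u))"
proof -
  have [measurable]: "w \<in> borel_measurable borel"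
    using assms(1) by (rule borel_measurable_continuous_onI)
  show ?thesis by (rule abs_integral_le_const(1)[OF fin, of _ K]) (use assms(2) in auto)
qed

lemma shift_mean_bound:
  assumes "continuous_on UNIV w" "\<And>x. \<bar>w x\<bar> \<le> K"
  shows "\<bar>shift_mean \<nu> w x\<bar> \<le> K * measure \<nu> (space \<nu>)"
proof -
  have [measurable]: "w \<in> borel_measurable borel"
    using assms(1) by (rule borel_measurable_continuous_onI)
  show ?thesis unfolding shift_mean_def
    by (rule abs_integral_le_const(2)[OF fin]) (use assms(2) in auto)
qed

lemma shift_mean_lipschitz:
  assumes "\<And>x. \<bar>w x\<bar> \<le> K" "\<And>x y. \<bar>w x - w y\<bar> \<le> B * \<bar>x - y\<bar>"
  shows "\<bar>shift_mean \<nu> w x - shift_mean \<nu> w y\<bar> \<le> B * measure \<nu> (space \<nu>) * \<bar>x - y\<bar>"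
proof -
  have c: "continuous_on UNIV w" using assms(2) by (rule lipschitz_continuous)
  have [measurable]: "w \<in> borel_measurable borel"
    using c by (rule borel_measurable_continuous_onI)
  have "shift_mean \<nu> w x - shift_mean \<nu> w y = (\<integral>u. w (x + u) - w (y + u) \<partial>\<nu>)"
    unfolding shift_mean_def
    by (subst Bochner_Integration.integral_diff) (auto intro!: shift_mean_integrable[OF c assms(1)])
  also have "\<bar>\<dots>\<bar> \<le> (B * \<bar>x - y\<bar>) * measure \<nu> (space \<nu>)"
    by (rule abs_integral_le_const(2)[OF fin]) (use assms(2)[of "x + u" "y + u" for u] in auto)
  finally show ?thesis by (simp add: mult_ac)
qed

text \<open>The Taylor remainder is uniform in the base point, hence integrates to a quadratic
  remainder times the total mass.\<close>

lemma shift_mean_deriv: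
  assumes w: "\<And>x. (w has_real_derivative w1 x) (at x)" "\<And>x. \<bar>w x\<bar> \<le> K" "\<And>x. \<bar>w1 x\<bar> \<le> A"
    and lip: "\<And>x y. \<bar>w1 x - w1 y\<bar> \<le> B * \<bar>x - y\<bar>"
  shows "(shift_mean \<nu> w has_real_derivative shift_mean \<nu> w1 x) (at x)"
proof (rule has_real_derivative_quadratic_bound)
  fix y
  have c: "continuous_on UNIV w"
    using w(1) by (auto intro: continuous_at_imp_continuous_on DERIV_isCont)
  have c1: "continuous_on UNIV w1" using lip by (rule lipschitz_continuous)
  have [measurable]: "w \<in> borel_measurable borel" "w1 \<in> borel_measurable borel"
    using c c1 by (auto intro: borel_measurable_continuous_onI)
  note i = shift_mean_integrable[OF c w(2)] shift_mean_integrable[OF c1 w(3)]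
  have "shift_mean \<nu> w y - shift_mean \<nu> w x - (y - x) * shift_mean \<nu> w1 x
      = (\<integral>u. w (y + u) - w (x + u) - (y - x) * w1 (x + u) \<partial>\<nu>)"
    unfolding shift_mean_def
    using i by (simp add: Bochner_Integration.integral_diff)
  also have "\<bar>\<dots>\<bar> \<le> (B * (y - x)\<^sup>2) * measure \<nu> (space \<nu>)"
    by (rule abs_integral_le_const(2)[OF fin])
       (use taylor1_lipschitz_bound[OF w(1) lip, of "y + u" "x + u" for u] in auto)
  finally show "\<bar>shift_mean \<nu> w y - shift_mean \<nu> w x - (y - x) * shift_mean \<nu> w1 x\<bar>
      \<le> (B * measure \<nu> (space \<nu>)) * (y - x)\<^sup>2" by (simp add: mult_ac)
qed

end

text \<open>The third derivative is represented by the Lipschitz constant \<open>c\<close> of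
  \<open>h2\<close>: Lipschitz bounds pass through averages and dilations without differentiating a
  third time. The bound on \<open>h\<close> itself stays 1, as it serves to secure
  integrability.\<close>

definition smooth3 ::
  "(real \<Rightarrow> real) \<Rightarrow> (real \<Rightarrow> real) \<Rightarrow> (real \<Rightarrow> real) \<Rightarrow> real \<Rightarrow> real \<Rightarrow> real \<Rightarrow> bool" where
  "smooth3 h h1 h2 a b c \<longleftrightarrow>
     (\<forall>x. (h has_real_derivative h1 x) (at x)) \<and> (\<forall>x. (h1 has_real_derivative h2 x) (at x)) \<and>
     (\<forall>x. \<bar>h x\<bar> \<le> 1) \<and> (\<forall>x. \<bar>h1 x\<bar> \<le> a) \<and> (\<forall>x. \<bar>h2 x\<bar> \<le> b) \<and>
     (\<forall>x y. \<bar>h2 x - h2 y\<bar> \<le> c * \<bar>x - y\<bar>)"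

lemma smooth3D:
  assumes "smooth3 h h1 h2 a b c"
  shows "(h has_real_derivative h1 x) (at x)" "(h1 has_real_derivative h2 x) (at x)"
    "\<bar>h x\<bar> \<le> 1" "\<bar>h1 x\<bar> \<le> a" "\<bar>h2 x\<bar> \<le> b" "\<bar>h2 x - h2 y\<bar> \<le> c * \<bar>x - y\<bar>"
    "\<bar>h x - h y\<bar> \<le> a * \<bar>x - y\<bar>" "\<bar>h1 x - h1 y\<bar> \<le> b * \<bar>x - y\<bar>"
    "continuous_on UNIV h" "continuous_on UNIV h1" "continuous_on UNIV h2"
    "0 \<le> a" "0 \<le> b" "0 \<le> c"
proof -
  note d = assms[unfolded smooth3_def]
  show "(h has_real_derivative h1 x) (at x)" "(h1 has_real_derivative h2 x) (at x)"
    "\<bar>h x\<bar> \<le> 1" "\<bar>h1 x\<bar> \<le> a" "\<bar>h2 x\<bar> \<le> b" "\<bar>h2 x - h2 y\<bar> \<le> c * \<bar>x - y\<bar>"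
    using d by auto
  show l: "\<bar>h x - h y\<bar> \<le> a * \<bar>x - y\<bar>" for x y
    by (rule real_derivative_lipschitz_bound[where ?w1.0=h1]) (use d in auto)
  show l1: "\<bar>h1 x - h1 y\<bar> \<le> b * \<bar>x - y\<bar>" for x y
    by (rule real_derivative_lipschitz_bound[where ?w1.0=h2]) (use d in auto)
  show "continuous_on UNIV h" "continuous_on UNIV h1" "continuous_on UNIV h2"
    using lipschitz_continuous[of h a] lipschitz_continuous[of h1 b] lipschitz_continuous[of h2 c] l l1 d
    by auto
  have "\<bar>h2 0 - h2 1\<bar> \<le> c * \<bar>0 - 1\<bar>" using d by blast
  then show "0 \<le> a" "0 \<le> b" "0 \<le> c"
    using l[of 0 1] l1[of 0 1] by simp_all
qed

text \<open>The generator of \<open>dY = -Y dt + dJ\<close>, where \<nu> is the Levy measure of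
  \<open>J\<close>: the first two terms are the integral of \<open>h (x + u) - h x\<close> over the
  jumps \<open>u\<close>. The derivative is a separate argument, so that its known bounds attach to
  it directly.\<close>

definition jump_gen :: "real measure \<Rightarrow> (real \<Rightarrow> real) \<Rightarrow> (real \<Rightarrow> real) \<Rightarrow> real \<Rightarrow> real" where
  "jump_gen \<nu> h h1 x = shift_mean \<nu> h x - measure \<nu> (space \<nu>) * h x - x * h1 x"

text \<open>A step of length \<epsilon>: the state decays to \<open>(1 - \<epsilon>) * x\<close> and
  then jumps with probability \<epsilon> times the total mass of \<nu>. Once this number is at most
  1, the step is an average and contracts the supremum norm.\<close>

definition euler_step :: "real measure \<Rightarrow> real \<Rightarrow> (real \<Rightarrow> real) \<Rightarrow> real \<Rightarrow> real" where
  "euler_step \<nu> \<epsilon> h x = (1 - \<epsilon> * measure \<nu> (space \<nu>)) * h ((1 - \<epsilon>) * x)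
     + \<epsilon> * shift_mean \<nu> h ((1 - \<epsilon>) * x)"

context
  fixes \<nu> :: "real measure"
  assumes fin: "finite_measure \<nu>" and sets_nu[measurable_cong]: "sets \<nu> = sets borel"
begin

text \<open>Each derivative brings out one factor \<open>1 - \<epsilon>\<close> from the dilation,
  and averaging preserves supremum and Lipschitz bounds. The Lipschitz bound of the second
  derivative picks up the third factor.\<close>

lemma smooth3_euler_step:
  assumes h: "smooth3 h h1 h2 a b c" and e: "0 < \<epsilon>" "\<epsilon> < 1" "\<epsilon> * measure \<nu> (space \<nu>) \<le> 1"
  shows "smooth3 (euler_step \<nu> \<epsilon> h) (\<lambda>x. (1 - \<epsilon>) * euler_step \<nu> \<epsilon> h1 x)
    (\<lambda>x. (1 - \<epsilon>)\<^sup>2 * euler_step \<nu> \<epsilon> h2 x) ((1 - \<epsilon>) * a) ((1 - \<epsilon>)^2 * b) ((1 - \<epsilon>)^3 * c)"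
proof -
  define m where "m = measure \<nu> (space \<nu>)"
  define q where "q = 1 - \<epsilon>"
  have q: "0 < q" "q < 1" using e by (auto simp: q_def)
  have em: "0 \<le> 1 - \<epsilon> * m" using e by (simp add: m_def)
  note d = smooth3D[OF h]
  have D: "(euler_step \<nu> \<epsilon> w has_real_derivative q * euler_step \<nu> \<epsilon> w1 x) (at x)"
    if "\<And>x. (w has_real_derivative w1 x) (at x)" "\<And>x. \<bar>w x\<bar> \<le> K" "\<And>x. \<bar>w1 x\<bar> \<le> A"
      "\<And>x y. \<bar>w1 x - w1 y\<bar> \<le> B * \<bar>x - y\<bar>" for w w1 x K A B
  proof -
    note s = shift_mean_deriv[OF fin sets_nu that]
    have "((\<lambda>x. (1 - \<epsilon> * m) * w (q * x) + \<epsilon> * shift_mean \<nu> w (q * x)) has_real_derivative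
      (1 - \<epsilon> * m) * (w1 (q * x) * q) + \<epsilon> * (shift_mean \<nu> w1 (q * x) * q)) (at x)"
      by (intro DERIV_add DERIV_cmult DERIV_chain2[OF that(1)] DERIV_chain2[OF s]
          DERIV_cmult_Id)
    then show ?thesis
      unfolding euler_step_def[abs_def] m_def[symmetric] q_def[symmetric]
      by (simp add: algebra_simps)
  qed
  have bd: "\<bar>euler_step \<nu> \<epsilon> w x\<bar> \<le> K"
    if "continuous_on UNIV w" "\<And>x. \<bar>w x\<bar> \<le> K" for w K x
  proof -
    have "\<bar>euler_step \<nu> \<epsilon> w x\<bar> \<le> \<bar>(1 - \<epsilon> * m) * w (q * x)\<bar> + \<bar>\<epsilon> * shift_mean \<nu> w (q * x)\<bar>"
      unfolding euler_step_def m_def q_def by (rule abs_triangle_ineq)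
    also have "\<dots> \<le> (1 - \<epsilon> * m) * K + \<epsilon> * (K * m)"
      unfolding abs_mult
      using em e that(2)[of "q * x"] shift_mean_bound[OF fin sets_nu that, of "q*x"]
      by (intro add_mono mult_mono) (auto simp: m_def)
    finally show ?thesis by (simp add: algebra_simps)
  qed
  have lip: "\<bar>euler_step \<nu> \<epsilon> w x - euler_step \<nu> \<epsilon> w y\<bar> \<le> B * q * \<bar>x - y\<bar>"
    if "\<And>x. \<bar>w x\<bar> \<le> K" "\<And>x y. \<bar>w x - w y\<bar> \<le> B * \<bar>x - y\<bar>" for w K B x y
  proof -
    have "\<bar>euler_step \<nu> \<epsilon> w x - euler_step \<nu> \<epsilon> w y\<bar>
      = \<bar>(1 - \<epsilon> * m) * (w (q * x) - w (q * y)) + \<epsilon> * (shift_mean \<nu> w (q * x) - shift_mean \<nu> w (q * y))\<bar>"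
      unfolding euler_step_def m_def q_def by (simp add: algebra_simps)
    also have "\<dots> \<le> \<bar>(1 - \<epsilon> * m) * (w (q * x) - w (q * y))\<bar> + \<bar>\<epsilon> * (shift_mean \<nu> w (q * x) - shift_mean \<nu> w (q * y))\<bar>"
      by (rule abs_triangle_ineq)
    also have "\<dots> \<le> (1 - \<epsilon> * m) * (B * \<bar>q * x - q * y\<bar>) + \<epsilon> * (B * m * \<bar>q * x - q * y\<bar>)"
      unfolding abs_mult
      using em e that(2)[of "q * x" "q * y"] shift_mean_lipschitz[OF fin sets_nu that, of "q*x" "q*y"]
      by (intro add_mono mult_mono) (auto simp: m_def)
    also have "\<dots> = B * \<bar>q * x - q * y\<bar>" by (simp add: algebra_simps)
    also have "\<dots> = B * q * \<bar>x - y\<bar>" using q by (simp add: abs_mult flip: right_diff_distrib)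
    finally show ?thesis .
  qed
  have D2: "((\<lambda>x. q * euler_step \<nu> \<epsilon> h1 x) has_real_derivative q\<^sup>2 * euler_step \<nu> \<epsilon> h2 x) (at x)" for x
    using DERIV_cmult[OF D[of h1 h2 a b c], of q] d by (simp add: power2_eq_square mult_ac)
  have L3: "\<bar>q\<^sup>2 * euler_step \<nu> \<epsilon> h2 x - q\<^sup>2 * euler_step \<nu> \<epsilon> h2 y\<bar> \<le> q ^ 3 * c * \<bar>x - y\<bar>" for x y
  proof -
    have "\<bar>q\<^sup>2 * euler_step \<nu> \<epsilon> h2 x - q\<^sup>2 * euler_step \<nu> \<epsilon> h2 y\<bar> = q\<^sup>2 * \<bar>euler_step \<nu> \<epsilon> h2 x - euler_step \<nu> \<epsilon> h2 y\<bar>"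
      using q by (simp add: abs_mult flip: right_diff_distrib)
    also have "\<dots> \<le> q\<^sup>2 * (c * q * \<bar>x - y\<bar>)"
      using lip[of h2 b c] d by (intro mult_left_mono) auto
    finally show ?thesis by (simp add: power2_eq_square power3_eq_cube mult_ac)
  qed
  show ?thesis
    unfolding smooth3_def q_def[symmetric]
    using D[of h h1 1 a b] D2 L3 bd[of h 1] bd[of h1 a] bd[of h2 b] d q
    by (auto simp: abs_mult intro!: mult_left_mono)
qed

text \<open>The decay leaves a Taylor remainder of at most \<open>b (\<epsilon> x)^2\<close>. Each
  of the two jump terms is evaluated at \<open>(1 - \<epsilon>) * x\<close> in place of
  \<open>x\<close>, which costs \<open>a \<epsilon> |x|\<close> per unit of jump mass, times the
  step length.\<close>

lemma euler_step_error:
  assumes h: "smooth3 h h1 h2 a b c" and e: "0 < \<epsilon>" "\<epsilon> < 1"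
  shows "\<bar>euler_step \<nu> \<epsilon> h x - h x - \<epsilon> * jump_gen \<nu> h h1 x\<bar>
    \<le> \<epsilon>\<^sup>2 * (b * x\<^sup>2 + 2 * a * measure \<nu> (space \<nu>) * \<bar>x\<bar>)"
proof -
  define m where "m = measure \<nu> (space \<nu>)"
  define q where "q = 1 - \<epsilon>"
  note d = smooth3D[OF h]
  have m: "0 \<le> m" by (simp add: m_def)
  have eq: "euler_step \<nu> \<epsilon> h x - h x - \<epsilon> * jump_gen \<nu> h h1 x
    = (h (q * x) - h x - (q * x - x) * h1 x) - \<epsilon> * m * (h (q * x) - h x)
      + \<epsilon> * (shift_mean \<nu> h (q * x) - shift_mean \<nu> h x)"
    unfolding euler_step_def jump_gen_def m_def q_def by (simp add: algebra_simps)
  have 1: "\<bar>h (q * x) - h x - (q * x - x) * h1 x\<bar> \<le> b * (q * x - x)\<^sup>2"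
    by (rule taylor1_lipschitz_bound) (use d in auto)
  have qx: "\<bar>q * x - x\<bar> = \<epsilon> * \<bar>x\<bar>" using e by (simp add: q_def abs_mult algebra_simps)
  have 2: "\<bar>\<epsilon> * m * (h (q * x) - h x)\<bar> \<le> \<epsilon> * m * (a * (\<epsilon> * \<bar>x\<bar>))"
    using d(7)[of "q*x" x] e m unfolding qx abs_mult by (intro mult_mono) auto
  have 3: "\<bar>\<epsilon> * (shift_mean \<nu> h (q * x) - shift_mean \<nu> h x)\<bar> \<le> \<epsilon> * (a * m * (\<epsilon> * \<bar>x\<bar>))"
    using shift_mean_lipschitz[OF fin sets_nu d(3) d(7), of "q*x" x] e unfolding qx abs_mult m_def
    by (intro mult_mono) auto
  have sq: "(q * x - x)\<^sup>2 = \<epsilon>\<^sup>2 * x\<^sup>2"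
    by (simp add: q_def algebra_simps power2_eq_square)
  show ?thesis
    using 1 2 3 unfolding eq sq m_def[symmetric]
    by (simp add: algebra_simps power2_eq_square)
qed

end

text \<open>The iterates \<open>H k\<close> of \<open>h\<close> telescope from \<open>h\<close> to a
  limit that no longer distinguishes the two laws. Each difference is, up to an error of order
  \<open>\<epsilon>^2\<close>, \<epsilon> times a generator gap, to which \<open>gen\<close> applies
  with the shrunken derivative bounds; the sum over \<open>k\<close> of
  \<open>\<epsilon> (1 - \<epsilon>)^(j k)\<close> tends to \<open>1 / j\<close>.\<close>

lemma ornstein_uhlenbeck_comparison:
  fixes \<mu> \<mu>' \<nu> :: "real measure"
  assumes nu: "finite_measure \<nu>" "sets \<nu> = sets borel"
    and mu: "prob_space \<mu>" "sets \<mu> = sets borel" "integrable \<mu> (\<lambda>x. x\<^sup>2)"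
    and mu': "prob_space \<mu>'" "sets \<mu>' = sets borel" "integrable \<mu>' (\<lambda>x. x\<^sup>2)"
    and gen: "\<And>h h1 h2 a b c. smooth3 h h1 h2 a b c \<Longrightarrow>
      \<bar>(\<integral>x. jump_gen \<nu> h h1 x \<partial>\<mu>) - (\<integral>x. jump_gen \<nu> h h1 x \<partial>\<mu>')\<bar> \<le> b1 * a + b2 * b + b3 * c"
    and h: "smooth3 h h1 h2 1 1 1"
  shows "\<bar>(\<integral>x. h x \<partial>\<mu>) - (\<integral>x. h x \<partial>\<mu>')\<bar> \<le> b1 + b2 / 2 + b3 / 3"
proof -
  define m where "m = measure \<nu> (space \<nu>)"
  have m: "0 \<le> m" by (simp add: m_def)
  interpret m1: prob_space \<mu> by fact
  interpret m2: prob_space \<mu>' by fact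
  note [measurable_cong] = mu(2) mu'(2)
  have id: "(\<lambda>x. x) \<in> borel_measurable \<mu>" "(\<lambda>x. x) \<in> borel_measurable \<mu>'"
    using mu(2) mu'(2) by (simp_all add: measurable_ident_sets)
  have int1: "integrable \<mu> (\<lambda>x. \<bar>x\<bar>)" "integrable \<mu>' (\<lambda>x. \<bar>x\<bar>)"
    by (rule integrable_abs, rule m1.square_integrable_imp_integrable[OF id(1) mu(3)])
       (rule integrable_abs, rule m2.square_integrable_imp_integrable[OF id(2) mu'(3)])
  define A where "A = (\<integral>x. \<bar>x\<bar> \<partial>\<mu>) + (\<integral>x. \<bar>x\<bar> \<partial>\<mu>')"
  define C where "C = (\<integral>x. x\<^sup>2 + 2 * m * \<bar>x\<bar> \<partial>\<mu>) + (\<integral>x. x\<^sup>2 + 2 * m * \<bar>x\<bar> \<partial>\<mu>')"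
  define dif where "dif w = (\<integral>x. w x \<partial>\<mu>) - (\<integral>x. w x \<partial>\<mu>')" for w :: "real \<Rightarrow> real"
  have C: "0 \<le> C" unfolding C_def using m by (intro add_nonneg_nonneg Bochner_Integration.integral_nonneg) auto
  have main: "\<bar>dif h\<bar> \<le> b1 + b2 * (\<epsilon> / (1 - (1 - \<epsilon>)\<^sup>2)) + b3 * (\<epsilon> / (1 - (1 - \<epsilon>)^3)) + \<epsilon> * C"
    if e: "0 < \<epsilon>" "\<epsilon> < 1" "\<epsilon> * m \<le> 1" for \<epsilon>
  proof -
    define q where "q = 1 - \<epsilon>"
    have q: "0 < q" "q < 1" using e by (auto simp: q_def)
    define H where "H k = (euler_step \<nu> \<epsilon> ^^ k) h" for k
    have "\<exists>w1 w2. smooth3 (H k) w1 w2 (q ^ k) ((q\<^sup>2) ^ k) ((q^3) ^ k)" for k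
    proof (induction k)
      case 0
      show ?case using h by (auto simp: H_def)
    next
      case (Suc k)
      then obtain w1 w2 where "smooth3 (H k) w1 w2 (q ^ k) ((q\<^sup>2) ^ k) ((q^3) ^ k)" by blast
      from smooth3_euler_step[OF nu this e(1,2)] e(3) show ?case
        by (auto simp: H_def q_def m_def)
    qed
    then obtain w1 w2 where sm: "\<And>k. smooth3 (H k) (w1 k) (w2 k) (q ^ k) ((q\<^sup>2) ^ k) ((q^3) ^ k)"
      by metis
    let ?b = "\<lambda>k. \<epsilon> * b1 * q ^ k + \<epsilon> * b2 * (q\<^sup>2) ^ k + \<epsilon> * b3 * (q^3) ^ k + \<epsilon>\<^sup>2 * C * q ^ k"
    let ?B = "\<epsilon> * b1 * (1 / (1 - q)) + \<epsilon> * b2 * (1 / (1 - q\<^sup>2)) + \<epsilon> * b3 * (1 / (1 - q^3))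
        + \<epsilon>\<^sup>2 * C * (1 / (1 - q))"
    have step: "\<bar>dif (H k) - dif (H (Suc k))\<bar> \<le> ?b k" for k
    proof -
      note d = smooth3D[OF sm[of k]] and d' = smooth3D[OF sm[of "Suc k"]]
      define err where "err x = H (Suc k) x - H k x - \<epsilon> * jump_gen \<nu> (H k) (w1 k) x" for x
      \<comment> \<open>Both error terms get the weaker factor \<open>q ^ k\<close>, so that the
        errors form a single geometric series.\<close>
      have qq: "(q\<^sup>2) ^ k \<le> q ^ k"
        using q by (intro power_mono) (auto simp: power2_eq_square mult_left_le)
      have err: "\<bar>err x\<bar> \<le> \<epsilon>\<^sup>2 * q ^ k * (x\<^sup>2 + 2 * m * \<bar>x\<bar>)" for x
      proof -
        have "\<bar>err x\<bar> \<le> \<epsilon>\<^sup>2 * ((q\<^sup>2) ^ k * x\<^sup>2 + 2 * q ^ k * m * \<bar>x\<bar>)"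
          using euler_step_error[OF nu sm e(1,2), of k x] by (simp add: err_def H_def m_def)
        also have "\<dots> \<le> \<epsilon>\<^sup>2 * (q ^ k * x\<^sup>2 + 2 * q ^ k * m * \<bar>x\<bar>)"
          using qq by (intro mult_left_mono add_right_mono mult_right_mono) auto
        finally show ?thesis by (simp add: algebra_simps)
      qed
      have sh: "continuous_on UNIV (shift_mean \<nu> (H k))"
        by (rule lipschitz_continuous, rule shift_mean_lipschitz[OF nu d(3) d(7)])
      have cg: "continuous_on UNIV (jump_gen \<nu> (H k) (w1 k))"
        unfolding jump_gen_def[abs_def] by (intro continuous_intros sh d)
      have [measurable]: "H k \<in> borel_measurable borel" "H (Suc k) \<in> borel_measurable borel"
        "jump_gen \<nu> (H k) (w1 k) \<in> borel_measurable borel"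
        using d d' cg by (auto intro: borel_measurable_continuous_onI)
      have [measurable]: "err \<in> borel_measurable borel" unfolding err_def[abs_def] by measurable
      have *: "(\<integral>x. H k x \<partial>\<rho>) - (\<integral>x. H (Suc k) x \<partial>\<rho>)
            = - \<epsilon> * (\<integral>x. jump_gen \<nu> (H k) (w1 k) x \<partial>\<rho>) - (\<integral>x. err x \<partial>\<rho>)"
          "\<bar>\<integral>x. err x \<partial>\<rho>\<bar> \<le> \<epsilon>\<^sup>2 * q ^ k * (\<integral>x. x\<^sup>2 + 2 * m * \<bar>x\<bar> \<partial>\<rho>)"
        if rho: "prob_space \<rho>" "sets \<rho> = sets borel" "integrable \<rho> (\<lambda>x. x\<^sup>2)" "integrable \<rho> (\<lambda>x. \<bar>x\<bar>)"
        for \<rho> :: "real measure"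
      proof -
        interpret r: prob_space \<rho> by fact
        note [measurable_cong] = rho(2)
        have iH: "integrable \<rho> (H k)" "integrable \<rho> (H (Suc k))"
          using d(3) d'(3) by (auto intro!: abs_integral_le_const(1)[OF r.finite_measure_axioms, of _ 1])
        have ie: "integrable \<rho> err"
        proof (rule Bochner_Integration.integrable_bound)
          show "integrable \<rho> (\<lambda>x. \<epsilon>\<^sup>2 * q ^ k * (x\<^sup>2 + 2 * m * \<bar>x\<bar>))" using rho by auto
          show "AE x in \<rho>. norm (err x) \<le> norm (\<epsilon>\<^sup>2 * q ^ k * (x\<^sup>2 + 2 * m * \<bar>x\<bar>))"
          proof (rule AE_I2)
            fix x
            have "0 \<le> \<epsilon>\<^sup>2 * q ^ k * (x\<^sup>2 + 2 * m * \<bar>x\<bar>)" using q m by auto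
            with err[of x] show "norm (err x) \<le> norm (\<epsilon>\<^sup>2 * q ^ k * (x\<^sup>2 + 2 * m * \<bar>x\<bar>))"
              unfolding real_norm_def by linarith
          qed
        qed measurable
        have "(\<integral>x. err x \<partial>\<rho>) = (\<integral>x. H (Suc k) x - H k x - \<epsilon> * jump_gen \<nu> (H k) (w1 k) x \<partial>\<rho>)"
          by (simp add: err_def)
        \<comment> \<open>The generator contains the unbounded term \<open>x * w1 k x\<close>; its
          integrability is read off from the identity defining \<open>err\<close>.\<close>
        have ij: "integrable \<rho> (jump_gen \<nu> (H k) (w1 k))"
        proof -
          have "integrable \<rho> (\<lambda>x. (H (Suc k) x - H k x - err x) / \<epsilon>)"
            using iH ie by auto
          then show ?thesis using e by (simp add: err_def)
        qed
        show "(\<integral>x. H k x \<partial>\<rho>) - (\<integral>x. H (Suc k) x \<partial>\<rho>)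
            = - \<epsilon> * (\<integral>x. jump_gen \<nu> (H k) (w1 k) x \<partial>\<rho>) - (\<integral>x. err x \<partial>\<rho>)"
          unfolding err_def using iH ij by simp
        have "\<bar>\<integral>x. err x \<partial>\<rho>\<bar> \<le> (\<integral>x. \<bar>err x\<bar> \<partial>\<rho>)" by (rule integral_abs_bound)
        also have "\<dots> \<le> (\<integral>x. \<epsilon>\<^sup>2 * q ^ k * (x\<^sup>2 + 2 * m * \<bar>x\<bar>) \<partial>\<rho>)"
          using err ie rho by (intro integral_mono) auto
        finally show "\<bar>\<integral>x. err x \<partial>\<rho>\<bar> \<le> \<epsilon>\<^sup>2 * q ^ k * (\<integral>x. x\<^sup>2 + 2 * m * \<bar>x\<bar> \<partial>\<rho>)" by simp
      qed
      note s1 = *[OF mu int1(1)] and s2 = *[OF mu' int1(2)]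
      have "dif (H k) - dif (H (Suc k)) = - \<epsilon> * dif (jump_gen \<nu> (H k) (w1 k))
          - ((\<integral>x. err x \<partial>\<mu>) - (\<integral>x. err x \<partial>\<mu>'))"
        unfolding dif_def using s1(1) s2(1) by (simp add: algebra_simps)
      also have "\<bar>\<dots>\<bar> \<le> \<epsilon> * \<bar>dif (jump_gen \<nu> (H k) (w1 k))\<bar>
          + (\<bar>\<integral>x. err x \<partial>\<mu>\<bar> + \<bar>\<integral>x. err x \<partial>\<mu>'\<bar>)"
      proof -
        have "\<bar>- \<epsilon> * D - (E1 - E2)\<bar> \<le> \<epsilon> * \<bar>D\<bar> + (\<bar>E1\<bar> + \<bar>E2\<bar>)" for D E1 E2 :: real
          using abs_triangle_ineq4[of "- \<epsilon> * D" "E1 - E2"] abs_triangle_ineq4[of E1 E2] e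
          by (simp add: abs_mult)
        then show ?thesis .
      qed
      also have "\<dots> \<le> \<epsilon> * (b1 * q ^ k + b2 * (q\<^sup>2) ^ k + b3 * (q^3) ^ k) + \<epsilon>\<^sup>2 * q ^ k * C"
      proof (rule add_mono)
        show "\<epsilon> * \<bar>dif (jump_gen \<nu> (H k) (w1 k))\<bar>
            \<le> \<epsilon> * (b1 * q ^ k + b2 * (q\<^sup>2) ^ k + b3 * (q^3) ^ k)"
          using gen[OF sm[of k]] e unfolding dif_def by (intro mult_left_mono) auto
        show "\<bar>\<integral>x. err x \<partial>\<mu>\<bar> + \<bar>\<integral>x. err x \<partial>\<mu>'\<bar> \<le> \<epsilon>\<^sup>2 * q ^ k * C"
          using add_mono[OF s1(2) s2(2)] unfolding C_def by (simp only: distrib_left)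
      qed
      finally show ?thesis by (simp add: algebra_simps)
    qed
    have partial: "\<bar>dif h - dif (H n)\<bar> \<le> (\<Sum>k<n. ?b k)" for n
    proof (induction n)
      case 0 show ?case by (simp add: H_def)
    next
      case (Suc n)
      then show ?case using step[of n] by simp
    qed
    \<comment> \<open>\<open>H n\<close> has Lipschitz constant \<open>q ^ n\<close>, so under
      either law its mean differs from \<open>H n 0\<close> by at most \<open>q ^ n\<close> times a
      first absolute moment.\<close>
    have tail: "(\<lambda>n. dif (H n)) \<longlonglongrightarrow> 0"
    proof (rule Lim_null_comparison)
      have "\<bar>dif (H n)\<bar> \<le> q ^ n * A" for n
      proof -
        note d = smooth3D[OF sm[of n]]
        have [measurable]: "H n \<in> borel_measurable borel"
          using d by (auto intro: borel_measurable_continuous_onI)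
        have *: "\<bar>(\<integral>x. H n x \<partial>\<rho>) - H n 0\<bar> \<le> q ^ n * (\<integral>x. \<bar>x\<bar> \<partial>\<rho>)"
          if rho: "prob_space \<rho>" "sets \<rho> = sets borel" "integrable \<rho> (\<lambda>x. \<bar>x\<bar>)" for \<rho> :: "real measure"
        proof -
          interpret r: prob_space \<rho> by fact
          note [measurable_cong] = rho(2)
          have i: "integrable \<rho> (H n)"
            using d(3) by (auto intro!: abs_integral_le_const(1)[OF r.finite_measure_axioms, of _ 1])
          have "(\<integral>x. H n x \<partial>\<rho>) - H n 0 = (\<integral>x. H n x - H n 0 \<partial>\<rho>)"
            using i by (simp add: r.prob_space)
          also have "\<bar>\<dots>\<bar> \<le> (\<integral>x. \<bar>H n x - H n 0\<bar> \<partial>\<rho>)" by (rule integral_abs_bound)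
          also have "\<dots> \<le> (\<integral>x. q ^ n * \<bar>x\<bar> \<partial>\<rho>)"
            using d(7)[of _ 0] i rho by (intro integral_mono) auto
          finally show ?thesis by simp
        qed
        show ?thesis
          using *[OF mu(1,2) int1(1)] *[OF mu'(1,2) int1(2)] unfolding dif_def A_def
          by (simp add: algebra_simps)
      qed
      then show "\<forall>\<^sub>F n in sequentially. norm (dif (H n)) \<le> q ^ n * A" by simp
      show "(\<lambda>n. q ^ n * A) \<longlonglongrightarrow> 0"
        using q by (intro tendsto_mult_left_zero LIMSEQ_power_zero) auto
    qed
    have q23: "q\<^sup>2 < 1" "q ^ 3 < 1" using q by (auto simp: power_less_one_iff)
    have sums: "?b sums ?B"
      using q q23 by (intro sums_add sums_mult geometric_sums) auto
    have "\<bar>dif h - 0\<bar> \<le> ?B"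
    proof (rule LIMSEQ_le)
      show "(\<lambda>n. \<bar>dif h - dif (H n)\<bar>) \<longlonglongrightarrow> \<bar>dif h - 0\<bar>"
        by (intro tendsto_intros tail)
      show "(\<lambda>n. \<Sum>k<n. ?b k) \<longlonglongrightarrow> ?B"
        using sums by (simp add: sums_def)
    qed (use partial in auto)
    \<comment> \<open>As \<open>1 - q = \<epsilon>\<close>, the error series sums to
      \<open>\<epsilon>^2 C / \<epsilon> = \<epsilon> C\<close>.\<close>
    then show ?thesis using e by (simp add: q_def power2_eq_square mult_ac)
  qed
  show ?thesis
  proof (rule tendsto_le[of "at_right 0"])
    have *: "((\<lambda>\<epsilon>. b1 + b2 * (1 / (2 - \<epsilon>)) + b3 * (1 / (3 - 3 * \<epsilon> + \<epsilon>\<^sup>2)) + \<epsilon> * C)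
        \<longlongrightarrow> b1 + b2 * (1 / (2 - 0)) + b3 * (1 / (3 - 3 * 0 + 0\<^sup>2)) + 0 * C) (at_right (0::real))"
      by (intro tendsto_intros) auto
    show "((\<lambda>\<epsilon>. b1 + b2 * (1 / (2 - \<epsilon>)) + b3 * (1 / (3 - 3 * \<epsilon> + \<epsilon>\<^sup>2)) + \<epsilon> * C)
        \<longlongrightarrow> b1 + b2 / 2 + b3 / 3) (at_right (0::real))"
      using * by simp
    \<comment> \<open>The bound \<open>1 / (m + 1)\<close> keeps \<open>\<epsilon> * m\<close> below
      1 and makes sense for zero jump mass too.\<close>
    have "\<forall>\<^sub>F \<epsilon> in at_right 0. \<epsilon> \<in> {0<..<min 1 (1 / (m + 1))}"
      using m by (intro eventually_at_right_real) auto
    then show "\<forall>\<^sub>F \<epsilon> in at_right 0. \<bar>(\<integral>x. h x \<partial>\<mu>) - (\<integral>x. h x \<partial>\<mu>')\<bar>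
        \<le> b1 + b2 * (1 / (2 - \<epsilon>)) + b3 * (1 / (3 - 3 * \<epsilon> + \<epsilon>\<^sup>2)) + \<epsilon> * C"
    proof eventually_elim
      case (elim \<epsilon>)
      then have e: "0 < \<epsilon>" "\<epsilon> < 1" "\<epsilon> < 1 / (m + 1)" by auto
      have "\<epsilon> * (m + 1) < 1" using e(3) m by (simp add: field_simps)
      then have em: "\<epsilon> * m \<le> 1" using e by (simp add: algebra_simps)
      have "1 - (1 - \<epsilon>)\<^sup>2 = \<epsilon> * (2 - \<epsilon>)" "1 - (1 - \<epsilon>)^3 = \<epsilon> * (3 - 3 * \<epsilon> + \<epsilon>\<^sup>2)"
        by (auto simp: power2_eq_square power3_eq_cube algebra_simps)
      with main[OF e(1,2) em] e show ?case by (simp add: dif_def)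
    qed
  qed auto
qed

section \<open>The bilateral gamma law\<close>

lemma FTC_half_line:
  fixes F f :: "real \<Rightarrow> real"
  assumes "\<And>x. 0 < x \<Longrightarrow> (F has_real_derivative f x) (at x)" "\<And>x. 0 < x \<Longrightarrow> isCont f x"
    and int: "integrable lborel (\<lambda>x. indicator {0<..} x * f x)"
    and A: "(F \<longlongrightarrow> A) (at_right 0)" and B: "(F \<longlongrightarrow> B) at_top"
  shows "(\<integral>x. indicator {0<..} x * f x \<partial>lborel) = B - A"
proof -
  have "(LBINT x=ereal 0..\<infinity>. f x) = B - A"
  proof (rule interval_integral_FTC_integrable[where F=F])
    show "set_integrable lborel (einterval (ereal 0) \<infinity>) f"
      using int by (simp add: set_integrable_def)
    show "((F \<circ> real_of_ereal) \<longlongrightarrow> A) (at_right (ereal 0))"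
      using A by (simp only: ereal_tendsto_simps)
    show "((F \<circ> real_of_ereal) \<longlongrightarrow> B) (at_left \<infinity>)"
      using B by (simp only: ereal_tendsto_simps)
  qed (use assms in \<open>auto simp: has_real_derivative_iff_has_vector_derivative\<close>)
  then show ?thesis
    by (simp add: interval_lebesgue_integral_def set_lebesgue_integral_def)
qed

lemma integrable_gamma_kernel:
  assumes "0 < s" "0 < \<alpha>"
  shows "integrable lborel (\<lambda>x::real. indicator {0<..} x * (x powr (s - 1) * exp (- \<alpha> * x)))"
proof -
  have 1: "integrable lborel (\<lambda>t::real. indicator {0..} t * t powr (s - 1) / exp t)"
  proof (rule integrableI_nonneg)
    show "(\<integral>\<^sup>+ t. ennreal (indicator {0..} t * t powr (s - 1) / exp t) \<partial>lborel) < \<infinity>"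
      using Gamma_conv_nn_integral_real[OF assms(1)] by (metis ennreal_less_top infinity_ennreal_def)
  qed auto
  have "integrable lborel (\<lambda>x. indicator {0..} (0 + \<alpha> * x) * (0 + \<alpha> * x) powr (s - 1) / exp (0 + \<alpha> * x))"
    using lborel_integrable_real_affine[OF 1, of \<alpha> 0] assms by simp
  then have "integrable lborel (\<lambda>x. (1 / \<alpha> powr (s - 1)) *
      (indicator {0..} (0 + \<alpha> * x) * (0 + \<alpha> * x) powr (s - 1) / exp (0 + \<alpha> * x)))"
    by (rule integrable_mult_right)
  \<comment> \<open>The closed and the open half-line give the same function, since
    \<open>0 powr _ = 0\<close>.\<close>
  also have "(\<lambda>x. (1 / \<alpha> powr (s - 1)) *
      (indicator {0..} (0 + \<alpha> * x) * (0 + \<alpha> * x) powr (s - 1) / exp (0 + \<alpha> * x)))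
    = (\<lambda>x. indicator {0<..} x * (x powr (s - 1) * exp (- \<alpha> * x)))"
    using assms by (auto simp: fun_eq_iff indicator_def powr_mult exp_minus field_simps zero_le_mult_iff)
  finally show ?thesis .
qed

lemma integrable_bounded_mult:
  fixes k w :: "'a \<Rightarrow> real"
  assumes "integrable M k" "w \<in> borel_measurable M" "\<And>x. \<bar>w x\<bar> \<le> K"
  shows "integrable M (\<lambda>x. k x * w x)"
proof (rule Bochner_Integration.integrable_bound)
  show "integrable M (\<lambda>x. K * k x)" using assms by simp
  have "\<bar>k x\<bar> * \<bar>w x\<bar> \<le> \<bar>k x\<bar> * \<bar>K\<bar>" for x
    using assms(3)[of x] by (intro mult_left_mono) auto
  then show "AE x in M. norm (k x * w x) \<le> norm (K * k x)"
    by (auto simp: abs_mult mult.commute)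
qed (use assms in auto)

definition gamma_kernel :: "real \<Rightarrow> real \<Rightarrow> real \<Rightarrow> real" where
  "gamma_kernel \<alpha> p x = \<alpha> powr p / Gamma p * (indicator {0<..} x * (x powr (p - 1) * exp (- \<alpha> * x)))"

lemma gamma_kernel_measurable[measurable]: "gamma_kernel \<alpha> p \<in> borel_measurable borel"
  unfolding gamma_kernel_def[abs_def] by measurable

context
  fixes \<alpha> p :: real
  assumes pos: "0 < \<alpha>" "0 < p"
begin

lemma gamma_kernel_nonneg: "0 \<le> gamma_kernel \<alpha> p x"
  unfolding gamma_kernel_def using pos Gamma_real_pos[of p] by simp

lemma gamma_law_eq: "gamma_law \<alpha> p = density lborel (gamma_kernel \<alpha> p)"
  unfolding gamma_law_def
  by (intro density_cong) (auto simp: gamma_kernel_def indicator_def mult_ac)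

lemma integrable_gamma_kernel_moment: "integrable lborel (\<lambda>x. gamma_kernel \<alpha> p x * x ^ k)"
proof -
  have "integrable lborel (\<lambda>x::real. \<alpha> powr p / Gamma p *
      (indicator {0<..} x * (x powr ((p + k) - 1) * exp (- \<alpha> * x))))"
    using pos by (intro integrable_mult_right integrable_gamma_kernel) auto
  also have "(\<lambda>x::real. \<alpha> powr p / Gamma p * (indicator {0<..} x * (x powr ((p + k) - 1) * exp (- \<alpha> * x))))
    = (\<lambda>x. gamma_kernel \<alpha> p x * x ^ k)"
  proof (rule ext)
    fix x :: real
    have "x powr ((p + k) - 1) = x powr (p - 1) * x ^ k" if "0 < x"
      using that by (simp add: powr_add powr_realpow powr_diff)
    then show "\<alpha> powr p / Gamma p * (indicator {0<..} x * (x powr ((p + k) - 1) * exp (- \<alpha> * x)))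
        = gamma_kernel \<alpha> p x * x ^ k"
      by (auto simp: gamma_kernel_def indicator_def)
  qed
  finally show ?thesis .
qed

lemma sets_gamma_law[simp, measurable_cong]: "sets (gamma_law \<alpha> p) = sets borel"
  by (simp add: gamma_law_def)

lemma integrable_gamma_law_iff:
  assumes [measurable]: "w \<in> borel_measurable borel"
  shows "integrable (gamma_law \<alpha> p) w \<longleftrightarrow> integrable lborel (\<lambda>x. gamma_kernel \<alpha> p x * (w x :: real))"
  unfolding gamma_law_eq by (subst integrable_density) (auto simp: gamma_kernel_nonneg)

lemma integral_gamma_law:
  assumes [measurable]: "w \<in> borel_measurable borel"
  shows "integral\<^sup>L (gamma_law \<alpha> p) w = (\<integral>x. gamma_kernel \<alpha> p x * (w x :: real) \<partial>lborel)"
  unfolding gamma_law_eq by (subst integral_density) (auto simp: gamma_kernel_nonneg)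

lemma integrable_gamma_law_moment: "integrable (gamma_law \<alpha> p) (\<lambda>x. x ^ k)"
  by (simp add: integrable_gamma_law_iff integrable_gamma_kernel_moment)

lemma finite_measure_gamma_law: "finite_measure (gamma_law \<alpha> p)"
proof
  have "emeasure (gamma_law \<alpha> p) (space (gamma_law \<alpha> p)) = (\<integral>\<^sup>+ x. gamma_kernel \<alpha> p x \<partial>lborel)"
    unfolding gamma_law_eq by (simp add: emeasure_density)
  also have "\<dots> < \<infinity>"
    using integrable_gamma_kernel_moment[of 0] gamma_kernel_nonneg
    by (simp add: integrable_iff_bounded)
  finally show "emeasure (gamma_law \<alpha> p) (space (gamma_law \<alpha> p)) \<noteq> \<infinity>" by simp
qed

text \<open>The difference of the two sides integrates a multiple of the derivative of
  \<open>x powr p * exp (- \<alpha> * x) * w x\<close>, whose boundary values vanish: at 0 because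
  \<open>p > 0\<close>, at infinity because \<open>w\<close> is bounded. The combination
  \<open>w - w1 / \<alpha>\<close> is the one that exponential smoothing inverts.\<close>

lemma gamma_law_stein:
  assumes w: "\<And>x. (w has_real_derivative w1 x) (at x)" "\<And>x. \<bar>w x\<bar> \<le> K" "\<And>x. \<bar>w1 x\<bar> \<le> A"
    and cont: "continuous_on UNIV w1"
  shows "(\<integral>x. x * (w x - w1 x / \<alpha>) \<partial>gamma_law \<alpha> p) = p / \<alpha> * (\<integral>x. w x \<partial>gamma_law \<alpha> p)"
proof -
  have cw: "continuous_on UNIV w"
    using w(1) by (auto intro: continuous_at_imp_continuous_on DERIV_isCont)
  have [measurable]: "w \<in> borel_measurable borel" "w1 \<in> borel_measurable borel"
    using cw cont by (auto intro: borel_measurable_continuous_onI)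
  have iw: "isCont w x" "isCont w1 x" for x
    using cw cont by (auto simp: continuous_on_eq_continuous_at)
  define c where "c = \<alpha> powr p / Gamma p"
  define F where "F x = c / \<alpha> * (x powr p * exp (- \<alpha> * x) * w x)" for x
  define f where "f x = c * (x powr (p - 1) * exp (- \<alpha> * x)) *
      (p / \<alpha> * w x - x * (w x - w1 x / \<alpha>))" for x
  have i0: "integrable lborel (\<lambda>x. gamma_kernel \<alpha> p x * w x)"
    using integrable_gamma_kernel_moment[of 0] w
    by (intro integrable_bounded_mult[of _ _ _ K]) auto
  have i1: "integrable lborel (\<lambda>x. gamma_kernel \<alpha> p x * x ^ 1 * (w x - w1 x / \<alpha>))"
  proof (rule integrable_bounded_mult[OF integrable_gamma_kernel_moment])
    show "\<bar>w x - w1 x / \<alpha>\<bar> \<le> K + A / \<alpha>" for x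
      using w(2)[of x] divide_right_mono[OF w(3)[of x], of \<alpha>] pos abs_triangle_ineq4[of "w x" "w1 x / \<alpha>"]
      by (simp add: abs_divide)
  qed auto
  have eq: "(\<lambda>x. indicator {0<..} x * f x) =
      (\<lambda>x. p / \<alpha> * (gamma_kernel \<alpha> p x * w x) - gamma_kernel \<alpha> p x * x ^ 1 * (w x - w1 x / \<alpha>))"
  proof (rule ext)
    fix x
    have "indicator {0<..} x * f x = gamma_kernel \<alpha> p x * (p / \<alpha> * w x - x * (w x - w1 x / \<alpha>))"
      by (simp add: f_def gamma_kernel_def c_def)
    also have "\<dots> = p / \<alpha> * (gamma_kernel \<alpha> p x * w x) - gamma_kernel \<alpha> p x * x ^ 1 * (w x - w1 x / \<alpha>)"
      unfolding right_diff_distrib[of "gamma_kernel \<alpha> p x"] by simp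
    finally show "indicator {0<..} x * f x =
        p / \<alpha> * (gamma_kernel \<alpha> p x * w x) - gamma_kernel \<alpha> p x * x ^ 1 * (w x - w1 x / \<alpha>)" .
  qed
  have "(\<integral>x. indicator {0<..} x * f x \<partial>lborel) = 0 - 0"
  proof (rule FTC_half_line[where F=F])
    fix x :: real assume x: "0 < x"
    have "x powr p = x * x powr (p - 1)" using x by (simp add: powr_diff)
    have "(F has_real_derivative c / \<alpha> * ((p * x powr (p - 1)) * exp (- \<alpha> * x) * w x
        + x powr p * (exp (- \<alpha> * x) * (- \<alpha>)) * w x + x powr p * exp (- \<alpha> * x) * w1 x)) (at x)"
      unfolding F_def using x pos by (auto intro!: derivative_eq_intros w(1) simp: field_simps)
    also have "c / \<alpha> * ((p * x powr (p - 1)) * exp (- \<alpha> * x) * w x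
        + x powr p * (exp (- \<alpha> * x) * (- \<alpha>)) * w x + x powr p * exp (- \<alpha> * x) * w1 x) = f x"
      unfolding f_def \<open>x powr p = _\<close> using pos by (simp add: field_simps)
    finally show "(F has_real_derivative f x) (at x)" .
    show "isCont f x" unfolding f_def using x
      by (intro continuous_intros iw) (use pos in auto)
  next
    show "integrable lborel (\<lambda>x. indicator {0<..} x * f x)"
      unfolding eq by (intro Bochner_Integration.integrable_diff integrable_mult_right i0 i1)
    let ?F = "\<lambda>x. \<bar>c / \<alpha>\<bar> * (x powr p * exp (- \<alpha> * x) * K)"
    have Fb: "norm (F x) \<le> ?F x" for x
      unfolding F_def real_norm_def abs_mult using w(2)[of x]
      by (intro mult_left_mono) (auto intro!: mult_left_mono)
    have "(?F \<longlongrightarrow> \<bar>c / \<alpha>\<bar> * (0 * exp (- \<alpha> * 0) * K)) (at_right 0)"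
      using pos by (intro tendsto_intros) (auto intro!: tendsto_eq_intros simp: eventually_at_filter)
    then show "(F \<longlongrightarrow> 0) (at_right 0)"
      by (intro Lim_null_comparison[OF always_eventually, of F ?F]) (use Fb in simp_all)
    have "((\<lambda>x::real. x powr p * exp (- \<alpha> * x)) \<longlongrightarrow> 0) at_top"
      using pos by real_asymp
    then have "(?F \<longlongrightarrow> \<bar>c / \<alpha>\<bar> * (0 * K)) at_top"
      by (intro tendsto_intros)
    then show "(F \<longlongrightarrow> 0) at_top"
      by (intro Lim_null_comparison[OF always_eventually, of F ?F]) (use Fb in simp_all)
  qed
  then have "p / \<alpha> * (\<integral>x. gamma_kernel \<alpha> p x * w x \<partial>lborel)
      = (\<integral>x. gamma_kernel \<alpha> p x * x ^ 1 * (w x - w1 x / \<alpha>) \<partial>lborel)"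
    unfolding eq using i0 i1 by simp
  then show ?thesis by (simp add: integral_gamma_law mult_ac)
qed

end

text \<open>The integrand has the primitive \<open>- exp (- u * \<alpha>) * w (x + u)\<close>. So
  averaging over an exponential jump undoes the passage from \<open>w\<close> to
  \<open>w - w1 / \<alpha>\<close>; this turns the integral operator of the dynamics into a
  differential operator.\<close>

lemma exponential_shift_mean:
  assumes pos: "0 < \<alpha>"
    and w: "\<And>x. (w has_real_derivative w1 x) (at x)" "\<And>x. \<bar>w x\<bar> \<le> K" "\<And>x. \<bar>w1 x\<bar> \<le> A"
    and cont: "continuous_on UNIV w1"
  shows "(\<integral>u. exponential_density \<alpha> u * (w (x + u) - w1 (x + u) / \<alpha>) \<partial>lborel) = w x"
proof -
  have cw: "continuous_on UNIV w"
    using w(1) by (auto intro: continuous_at_imp_continuous_on DERIV_isCont)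
  have [measurable]: "w \<in> borel_measurable borel" "w1 \<in> borel_measurable borel"
    using cw cont by (auto intro: borel_measurable_continuous_onI)
  have iw: "isCont w x" "isCont w1 x" for x
    using cw cont by (auto simp: continuous_on_eq_continuous_at)
  define F where "F u = - (exp (- u * \<alpha>) * w (x + u))" for u
  define f where "f u = \<alpha> * exp (- u * \<alpha>) * (w (x + u) - w1 (x + u) / \<alpha>)" for u
  have i: "integrable lborel (\<lambda>u::real. indicator {0<..} u * (u powr (1 - 1) * exp (- \<alpha> * u)))"
    using pos by (intro integrable_gamma_kernel) auto
  have b: "\<bar>\<alpha> * (w y - w1 y / \<alpha>)\<bar> \<le> \<alpha> * (K + A / \<alpha>)" for y
    using w(2)[of y] divide_right_mono[OF w(3)[of y], of \<alpha>] pos abs_triangle_ineq4[of "w y" "w1 y / \<alpha>"]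
    by (simp add: abs_divide abs_mult)
  have "integrable lborel (\<lambda>u::real. indicator {0<..} u * (u powr (1 - 1) * exp (- \<alpha> * u))
      * (\<alpha> * (w (x + u) - w1 (x + u) / \<alpha>)))"
    by (rule integrable_bounded_mult[OF i _ b]) simp
  also have "(\<lambda>u::real. indicator {0<..} u * (u powr (1 - 1) * exp (- \<alpha> * u))
      * (\<alpha> * (w (x + u) - w1 (x + u) / \<alpha>))) = (\<lambda>u. indicator {0<..} u * f u)"
    by (auto simp: fun_eq_iff f_def indicator_def mult_ac)
  finally have int: "integrable lborel (\<lambda>u. indicator {0<..} u * f u)" .
  have d: "(F has_real_derivative f u) (at u)" for u
  proof -
    have "((\<lambda>u. w (x + u)) has_real_derivative w1 (x + u)) (at u)"
      using w(1)[of "x + u"] by (simp add: DERIV_shift add.commute)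
    then show ?thesis unfolding F_def f_def using pos
      by (auto intro!: derivative_eq_intros simp: field_simps)
  qed
  have "(\<integral>u. indicator {0<..} u * f u \<partial>lborel) = 0 - F 0"
  proof (rule FTC_half_line[OF d _ int])
    show "isCont f u" for u unfolding f_def
      by (intro continuous_intros isCont_o2[OF _ iw(1)] isCont_o2[OF _ iw(2)]) (use pos in auto)
    show "(F \<longlongrightarrow> F 0) (at_right 0)"
      using DERIV_isCont[OF d[of 0]] by (auto simp: isCont_def intro: filterlim_mono at_le)
    show "(F \<longlongrightarrow> 0) at_top"
    proof (rule Lim_null_comparison)
      show "\<forall>\<^sub>F u in at_top. norm (F u) \<le> exp (- u * \<alpha>) * K"
        unfolding F_def using w(2) by (auto simp: abs_mult intro!: always_eventually)
      have "((\<lambda>u. exp (- u * \<alpha>)) \<longlongrightarrow> 0) at_top" using pos by real_asymp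
      then show "((\<lambda>u. exp (- u * \<alpha>) * K) \<longlongrightarrow> 0) at_top" by (rule tendsto_mult_left_zero)
    qed
  qed
  moreover have "(\<integral>u. exponential_density \<alpha> u * (w (x + u) - w1 (x + u) / \<alpha>) \<partial>lborel)
      = (\<integral>u. indicator {0<..} u * f u \<partial>lborel)"
  proof (rule integral_cong_AE)
    \<comment> \<open>At \<open>u = 0\<close> the exponential density has the value \<alpha>, but
      the open indicator vanishes.\<close>
    have "AE u in lborel. u \<noteq> (0::real)" by (rule AE_lborel_singleton)
    then show "AE u in lborel. exponential_density \<alpha> u * (w (x + u) - w1 (x + u) / \<alpha>)
        = indicator {0<..} u * f u"
      by eventually_elim (auto simp: exponential_density_def f_def indicator_def)
    show "(\<lambda>u. indicator {0<..} u * f u) \<in> borel_measurable lborel" using int by simp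
  qed (measurable)
  ultimately show ?thesis by (simp add: F_def)
qed

section \<open>Two-sided exponential jumps and their generator\<close>

context
  fixes \<alpha>1 p1 \<alpha>2 p2 :: real
  assumes pos: "0 < \<alpha>1" "0 < p1" "0 < \<alpha>2" "0 < p2"
begin

definition up_jump :: "real measure" where
  "up_jump = density lborel (exponential_density \<alpha>1)"

definition down_jump :: "real measure" where
  "down_jump = density lborel (\<lambda>u. exponential_density \<alpha>2 (- u))"

text \<open>\<open>X\<close> has the Levy density \<open>k(x) / |x|\<close> with
  \<open>k(x) = p1 exp (- \<alpha>1 x)\<close> for \<open>x > 0\<close> and
  \<open>k(x) = p2 exp (- \<alpha>2 |x|)\<close> for \<open>x < 0\<close>. The driver of the
  dynamics with stationary law \<open>X\<close> has as Levy density minus the derivative of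
  \<open>k\<close> in \<open>|x|\<close>: exponential densities with the masses \<open>p1\<close>
  and \<open>p2\<close>.\<close>

definition bg_jumps :: "real measure" where
  "bg_jumps = density lborel (\<lambda>u. p1 * exponential_density \<alpha>1 u + p2 * exponential_density \<alpha>2 (- u))"

lemma sets_jumps:
  "sets up_jump = sets borel" "sets down_jump = sets borel" "sets bg_jumps = sets borel"
  by (simp_all add: up_jump_def down_jump_def bg_jumps_def)

lemma integrable_exponential_density:
  "integrable lborel (exponential_density \<alpha>1)" "integrable lborel (exponential_density \<alpha>2)"
  "integrable lborel (\<lambda>u. exponential_density \<alpha>2 (- u))"
proof -
  have *: "integrable lborel (exponential_density \<alpha>)" if "0 < \<alpha>" for \<alpha>
  proof -
    interpret prob_space "density lborel (exponential_density \<alpha>)"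
      using that by (rule prob_space_exponential_density)
    have "integrable (density lborel (exponential_density \<alpha>)) (\<lambda>_. 1::real)" by simp
    then show ?thesis using that
      by (subst (asm) integrable_density) (auto simp: exponential_density_nonneg)
  qed
  show "integrable lborel (exponential_density \<alpha>1)" "integrable lborel (exponential_density \<alpha>2)"
    using * pos by auto
  show "integrable lborel (\<lambda>u. exponential_density \<alpha>2 (- u))"
    using lborel_integrable_real_affine[OF *[OF pos(3)], of "-1" 0] by simp
qed

lemma prob_space_up_jump: "prob_space up_jump"
  unfolding up_jump_def using pos(1) by (rule prob_space_exponential_density)

lemma prob_space_down_jump: "prob_space down_jump"
proof
  have "emeasure down_jump (space down_jump) = (\<integral>\<^sup>+u. exponential_density \<alpha>2 (- u) \<partial>lborel)"
    by (simp add: down_jump_def emeasure_density)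
  also have "\<dots> = (\<integral>\<^sup>+u. exponential_density \<alpha>2 u \<partial>lborel)"
    using nn_integral_real_affine[of "\<lambda>u. ennreal (exponential_density \<alpha>2 u)" "-1" 0] by simp
  also have "\<dots> = 1"
    using prob_space.emeasure_space_1[OF prob_space_exponential_density[OF pos(3)]]
    by (simp add: emeasure_density)
  finally show "emeasure down_jump (space down_jump) = 1" .
qed

lemma finite_measure_bg_jumps: "finite_measure bg_jumps"
proof
  have "emeasure bg_jumps (space bg_jumps)
      = (\<integral>\<^sup>+u. (p1 * exponential_density \<alpha>1 u + p2 * exponential_density \<alpha>2 (- u)) \<partial>lborel)"
    by (simp add: bg_jumps_def emeasure_density)
  also have "\<dots> = ennreal (\<integral>u. (p1 * exponential_density \<alpha>1 u + p2 * exponential_density \<alpha>2 (- u)) \<partial>lborel)"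
    using pos by (intro nn_integral_eq_integral) (auto simp: integrable_exponential_density exponential_density_nonneg)
  finally show "emeasure bg_jumps (space bg_jumps) \<noteq> \<infinity>" by simp
qed

lemmas up_jump_measure = prob_space.finite_measure[OF prob_space_up_jump] sets_jumps(1)
lemmas down_jump_measure = prob_space.finite_measure[OF prob_space_down_jump] sets_jumps(2)

lemma integral_jumps:
  assumes [measurable]: "w \<in> borel_measurable borel"
  shows "(\<integral>u. w u \<partial>up_jump) = (\<integral>u. exponential_density \<alpha>1 u * (w u :: real) \<partial>lborel)"
    "(\<integral>u. w u \<partial>down_jump) = (\<integral>u. exponential_density \<alpha>2 (- u) * w u \<partial>lborel)"
    "(\<integral>u. w u \<partial>bg_jumps) = (\<integral>u. (p1 * exponential_density \<alpha>1 u + p2 * exponential_density \<alpha>2 (- u)) * w u \<partial>lborel)"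
  unfolding up_jump_def down_jump_def bg_jumps_def using pos
  by (subst integral_density; auto simp: exponential_density_nonneg)+

lemma shift_mean_bg_jumps:
  assumes c: "continuous_on UNIV w" and b: "\<And>x. \<bar>w x\<bar> \<le> K"
  shows "shift_mean bg_jumps w x = p1 * shift_mean up_jump w x + p2 * shift_mean down_jump w x"
proof -
  have [measurable]: "w \<in> borel_measurable borel"
    using c by (rule borel_measurable_continuous_onI)
  have i: "integrable lborel (\<lambda>u. exponential_density \<alpha>1 u * w (x + u))"
      "integrable lborel (\<lambda>u. exponential_density \<alpha>2 (- u) * w (x + u))"
    using b by (intro integrable_bounded_mult[of _ _ _ K] integrable_exponential_density; simp)+
  have "shift_mean bg_jumps w x = (\<integral>u. p1 * (exponential_density \<alpha>1 u * w (x + u))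
      + p2 * (exponential_density \<alpha>2 (- u) * w (x + u)) \<partial>lborel)"
    unfolding shift_mean_def by (subst integral_jumps) (auto simp: algebra_simps)
  also have "\<dots> = p1 * shift_mean up_jump w x + p2 * shift_mean down_jump w x"
    unfolding shift_mean_def using i by (simp add: integral_jumps)
  finally show ?thesis .
qed

lemma measure_bg_jumps: "measure bg_jumps (space bg_jumps) = p1 + p2"
  using shift_mean_bg_jumps[of "\<lambda>_. 1" 1 0] prob_space.prob_space[OF prob_space_up_jump]
    prob_space.prob_space[OF prob_space_down_jump]
  by (simp add: shift_mean_def)

lemma shift_mean_up_jump:
  assumes w: "\<And>x. (w has_real_derivative w1 x) (at x)" "\<And>x. \<bar>w x\<bar> \<le> K" "\<And>x. \<bar>w1 x\<bar> \<le> A"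
    and cont: "continuous_on UNIV w1"
  shows "shift_mean up_jump w x = w x + shift_mean up_jump w1 x / \<alpha>1"
proof -
  have cw: "continuous_on UNIV w"
    using w(1) by (auto intro: continuous_at_imp_continuous_on DERIV_isCont)
  have [measurable]: "w \<in> borel_measurable borel" "w1 \<in> borel_measurable borel"
    using cw cont by (auto intro: borel_measurable_continuous_onI)
  have "w x = (\<integral>u. w (x + u) - w1 (x + u) / \<alpha>1 \<partial>up_jump)"
    using exponential_shift_mean[OF pos(1) w cont, of x] by (simp add: integral_jumps)
  also have "\<dots> = shift_mean up_jump w x - shift_mean up_jump w1 x / \<alpha>1"
    unfolding shift_mean_def
    using shift_mean_integrable[OF up_jump_measure cw w(2)] shift_mean_integrable[OF up_jump_measure cont w(3)] by simp
  finally show ?thesis by simp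
qed

text \<open>The reflection \<open>y \<mapsto> w (- y)\<close> reduces this to upward jumps of rate
  \<alpha>2; its derivative brings the minus sign.\<close>

lemma shift_mean_down_jump:
  assumes w: "\<And>x. (w has_real_derivative w1 x) (at x)" "\<And>x. \<bar>w x\<bar> \<le> K" "\<And>x. \<bar>w1 x\<bar> \<le> A"
    and cont: "continuous_on UNIV w1"
  shows "shift_mean down_jump w x = w x - shift_mean down_jump w1 x / \<alpha>2"
proof -
  have cw: "continuous_on UNIV w"
    using w(1) by (auto intro: continuous_at_imp_continuous_on DERIV_isCont)
  have [measurable]: "w \<in> borel_measurable borel" "w1 \<in> borel_measurable borel"
    using cw cont by (auto intro: borel_measurable_continuous_onI)
  have "w x = (\<integral>u. exponential_density \<alpha>2 u * (w (x - u) + w1 (x - u) / \<alpha>2) \<partial>lborel)"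
  proof -
    have d: "((\<lambda>y. w (- y)) has_real_derivative - w1 (- y)) (at y)" for y
      by (rule DERIV_cong[OF DERIV_chain2[OF w(1)]]) (auto intro!: derivative_eq_intros)
    have c: "continuous_on UNIV (\<lambda>y. - w1 (- y))"
      by (intro continuous_intros continuous_on_compose2[OF cont]) auto
    show ?thesis
      using exponential_shift_mean[OF pos(3) d _ _ c, of K A "- x"] w by simp
  qed
  also have "\<dots> = (\<integral>u. exponential_density \<alpha>2 (- u) * (w (x + u) + w1 (x + u) / \<alpha>2) \<partial>lborel)"
    by (subst lborel_integral_real_affine[of "-1" _ 0]) auto
  also have "\<dots> = (\<integral>u. w (x + u) + w1 (x + u) / \<alpha>2 \<partial>down_jump)"
    by (simp add: integral_jumps)
  also have "\<dots> = shift_mean down_jump w x + shift_mean down_jump w1 x / \<alpha>2"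
    unfolding shift_mean_def
    using shift_mean_integrable[OF down_jump_measure cw w(2)] shift_mean_integrable[OF down_jump_measure cont w(3)] by simp
  finally show ?thesis by simp
qed

text \<open>The term \<open>(p1 + p2) * h x\<close> cancels, so the generator depends on
  \<open>h\<close> through its derivative alone. This is why the Stein function starts one order
  lower, with \<open>f\<close> bounded like \<open>h1\<close>.\<close>

lemma jump_gen_bg:
  assumes h: "smooth3 h h1 h2 a b c"
  shows "jump_gen bg_jumps h h1 x = p1 / \<alpha>1 * shift_mean up_jump h1 x
    - p2 / \<alpha>2 * shift_mean down_jump h1 x - x * h1 x"
proof -
  note d = smooth3D[OF h]
  show ?thesis
    unfolding jump_gen_def shift_mean_bg_jumps[OF d(9) d(3)] measure_bg_jumps
      shift_mean_up_jump[OF d(1) d(3) d(4) d(10)] shift_mean_down_jump[OF d(1) d(3) d(4) d(10)]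
    by (simp add: algebra_simps)
qed

text \<open>\<open>f\<close> is \<open>h1\<close> averaged over one upward and one downward jump, so
  that \<open>h1 = (1 - D / \<alpha>1) (1 + D / \<alpha>2) f\<close> with \<open>D\<close> the
  derivative. Undoing one average at a time expresses every term of the generator by
  \<open>f\<close>, \<open>f1\<close>, \<open>f2\<close>, and averages over probability measures
  keep the bounds.\<close>

lemma jump_gen_stein:
  assumes h: "smooth3 h h1 h2 a b c"
  obtains f f1 f2 where "\<And>x. (f has_real_derivative f1 x) (at x)"
    "\<And>x. (f1 has_real_derivative f2 x) (at x)" "continuous_on UNIV f2"
    "\<And>x. \<bar>f x\<bar> \<le> a" "\<And>x. \<bar>f1 x\<bar> \<le> b" "\<And>x. \<bar>f2 x\<bar> \<le> c"
    "\<And>x. jump_gen bg_jumps h h1 x = - x * f x + (1 / \<alpha>1 - 1 / \<alpha>2) * x * f1 x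
      + x * f2 x / (\<alpha>1 * \<alpha>2) + (p1 / \<alpha>1 - p2 / \<alpha>2) * f x + (p1 + p2) / (\<alpha>1 * \<alpha>2) * f1 x"
proof -
  note d = smooth3D[OF h]
  note mass = prob_space.prob_space[OF prob_space_up_jump] prob_space.prob_space[OF prob_space_down_jump]
  define w where "w = shift_mean down_jump h1"
  define w1 where "w1 = shift_mean down_jump h2"
  define f where "f = shift_mean up_jump w"
  define f1 where "f1 = shift_mean up_jump w1"
  \<comment> \<open>Because \<open>f1 = \<alpha>1 * (f - w)\<close> is a difference of
    differentiable functions, it has this derivative even though \<open>h2\<close> is only
    Lipschitz.\<close>
  define f2 where "f2 x = \<alpha>1 * (f1 x - w1 x)" for x
  have wb: "\<bar>w x\<bar> \<le> a" "\<bar>w1 x\<bar> \<le> b" for x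
    using shift_mean_bound[OF down_jump_measure d(10) d(4), of x] shift_mean_bound[OF down_jump_measure d(11) d(5), of x]
    by (simp_all add: w_def w1_def mass)
  have wl: "\<bar>w x - w y\<bar> \<le> b * \<bar>x - y\<bar>" "\<bar>w1 x - w1 y\<bar> \<le> c * \<bar>x - y\<bar>" for x y
    using shift_mean_lipschitz[OF down_jump_measure d(4) d(8), of x y] shift_mean_lipschitz[OF down_jump_measure d(5) d(6), of x y]
    by (simp_all add: w_def w1_def mass)
  have wd: "(w has_real_derivative w1 x) (at x)" for x
    unfolding w_def w1_def by (rule shift_mean_deriv[OF down_jump_measure d(2) d(4) d(5) d(6)])
  have wc: "continuous_on UNIV w" "continuous_on UNIV w1"
    using lipschitz_continuous[of w b] lipschitz_continuous[of w1 c] wl by auto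
  have fb: "\<bar>f x\<bar> \<le> a" "\<bar>f1 x\<bar> \<le> b" for x
    using shift_mean_bound[OF up_jump_measure wc(1) wb(1), of x] shift_mean_bound[OF up_jump_measure wc(2) wb(2), of x]
    by (simp_all add: f_def f1_def mass)
  have fl: "\<bar>f1 x - f1 y\<bar> \<le> c * \<bar>x - y\<bar>" for x y
    using shift_mean_lipschitz[OF up_jump_measure wb(2) wl(2), of x y] by (simp add: f1_def mass)
  have fd: "(f has_real_derivative f1 x) (at x)" for x
    unfolding f_def f1_def by (rule shift_mean_deriv[OF up_jump_measure wd wb wl(2)])
  have fw: "f x = w x + f1 x / \<alpha>1" for x
    unfolding f_def f1_def by (rule shift_mean_up_jump[OF wd wb wc(2)])
  have f1_eq: "f1 = (\<lambda>x. \<alpha>1 * (f x - w x))" using fw pos by (auto simp: field_simps)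
  have f1d: "(f1 has_real_derivative f2 x) (at x)" for x
    unfolding f2_def by (subst f1_eq) (intro DERIV_cmult DERIV_diff fd wd)
  have f2c: "continuous_on UNIV f2"
    unfolding f2_def[abs_def] using lipschitz_continuous[of f1 c, OF fl] wc(2) by (intro continuous_intros)
  \<comment> \<open>The formula for \<open>f2\<close> would give a bound in terms of
    \<open>b\<close>; the bound \<open>c\<close> comes from the difference quotients of the
    \<open>c\<close>-Lipschitz function \<open>f1\<close>.\<close>
  have f2b: "\<bar>f2 x\<bar> \<le> c" for x
  proof -
    have "c-lipschitz_on UNIV f1" using fl d by (auto simp: lipschitz_on_def dist_real_def)
    have "((\<lambda>y. \<bar>(f1 y - f1 x) / (y - x)\<bar>) \<longlongrightarrow> \<bar>f2 x\<bar>) (at x)"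
      using f1d[of x] unfolding has_field_derivative_iff by (rule tendsto_rabs)
    then show ?thesis
    proof (rule tendsto_upperbound)
      show "\<forall>\<^sub>F y in at x. \<bar>(f1 y - f1 x) / (y - x)\<bar> \<le> c"
        unfolding eventually_at_filter
        using fl by (intro always_eventually) (auto simp: abs_divide divide_le_eq)
    qed auto
  qed
  have h1_eq: "w x = h1 x - w1 x / \<alpha>2" for x
    unfolding w_def w1_def by (rule shift_mean_down_jump[OF d(2) d(4) d(5) d(11)])
  have up_h1: "shift_mean up_jump h1 x = f x + f1 x / \<alpha>2" for x
  proof -
    have "h1 = (\<lambda>y. w y + w1 y / \<alpha>2)" using h1_eq by auto
    then have "shift_mean up_jump h1 x = (\<integral>u. w (x + u) + w1 (x + u) / \<alpha>2 \<partial>up_jump)"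
      by (simp add: shift_mean_def)
    also have "\<dots> = f x + f1 x / \<alpha>2"
      unfolding f_def f1_def shift_mean_def
      using shift_mean_integrable[OF up_jump_measure wc(1) wb(1)] shift_mean_integrable[OF up_jump_measure wc(2) wb(2)] by simp
    finally show ?thesis .
  qed
  have "jump_gen bg_jumps h h1 x = - x * f x + (1 / \<alpha>1 - 1 / \<alpha>2) * x * f1 x
      + x * f2 x / (\<alpha>1 * \<alpha>2) + (p1 / \<alpha>1 - p2 / \<alpha>2) * f x + (p1 + p2) / (\<alpha>1 * \<alpha>2) * f1 x" for x
  proof -
    have w: "w x = f x - f1 x / \<alpha>1" using fw[of x] by simp
    have w1: "w1 x = f1 x - f2 x / \<alpha>1" using pos by (simp add: f2_def)
    have h1: "h1 x = f x - f1 x / \<alpha>1 + (f1 x - f2 x / \<alpha>1) / \<alpha>2"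
      using h1_eq[of x] unfolding w w1 by simp
    show ?thesis
      unfolding jump_gen_bg[OF h] up_h1 w_def[symmetric] w h1 using pos by (simp add: field_simps)
  qed
  with fd f1d f2c fb f2b show thesis by (rule that)
qed

interpretation g1: finite_measure "gamma_law \<alpha>1 p1"
  using pos by (intro finite_measure_gamma_law)
interpretation g2: finite_measure "gamma_law \<alpha>2 p2"
  using pos by (intro finite_measure_gamma_law)
interpretation gp: pair_sigma_finite "gamma_law \<alpha>1 p1" "gamma_law \<alpha>2 p2" ..

lemma sets_gamma_pair[measurable_cong]:
  "sets (gamma_law \<alpha>1 p1 \<Otimes>\<^sub>M gamma_law \<alpha>2 p2) = sets (borel \<Otimes>\<^sub>M borel)"
  using pos by (intro sets_pair_measure_cong) auto

lemma integrable_pair_mult: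
  assumes "integrable (gamma_law \<alpha>1 p1) u" "integrable (gamma_law \<alpha>2 p2) v"
  shows "integrable (gamma_law \<alpha>1 p1 \<Otimes>\<^sub>M gamma_law \<alpha>2 p2) (\<lambda>(x, y). u x * v y :: real)"
proof -
  have [measurable]: "u \<in> borel_measurable (gamma_law \<alpha>1 p1)" "v \<in> borel_measurable (gamma_law \<alpha>2 p2)"
    using assms by auto
  show ?thesis
    by (rule gp.Fubini_integrable) (use assms in \<open>auto simp: abs_mult\<close>)
qed

lemma integrable_bilateral_gamma_square:
  "integrable (bilateral_gamma \<alpha>1 p1 \<alpha>2 p2) (\<lambda>x. x\<^sup>2)"
proof -
  have i: "integrable (gamma_law \<alpha>1 p1) (\<lambda>x. x ^ k)" "integrable (gamma_law \<alpha>2 p2) (\<lambda>x. x ^ k)" for k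
    using pos by (auto intro: integrable_gamma_law_moment)
  \<comment> \<open>The powers 0 and 1 are written out so that every term is a product of
    one-variable moments.\<close>
  have "integrable (gamma_law \<alpha>1 p1 \<Otimes>\<^sub>M gamma_law \<alpha>2 p2)
     (\<lambda>z. (case z of (x, y) \<Rightarrow> x ^ 2 * y ^ 0) - 2 * (case z of (x, y) \<Rightarrow> x ^ 1 * y ^ 1) + (case z of (x, y) \<Rightarrow> x ^ 0 * y ^ 2))"
    by (intro Bochner_Integration.integrable_add Bochner_Integration.integrable_diff integrable_mult_right
        integrable_pair_mult i)
  also have "(\<lambda>z. (case z of (x, y) \<Rightarrow> x ^ 2 * y ^ 0) - 2 * (case z of (x, y) \<Rightarrow> x ^ 1 * y ^ 1) + (case z of (x, y) \<Rightarrow> x ^ 0 * y ^ 2))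
     = (\<lambda>z::real\<times>real. (case z of (x, y) \<Rightarrow> x - y)\<^sup>2)"
    by (auto simp: fun_eq_iff power2_eq_square algebra_simps)
  finally show ?thesis
    unfolding bilateral_gamma_def by (subst integrable_distr_eq) measurable
qed

text \<open>At \<open>x - y\<close> the generator is \<open>B - A\<close>. For fixed
  \<open>y\<close>, the gamma Stein identity in \<open>x\<close> for the function
  \<open>u (x - y)\<close> makes the mean of \<open>A\<close> vanish, because
  \<open>u - u1 / \<alpha>1 = h1\<close>. Dually, \<open>B\<close> has mean zero in \<open>y\<close>
  for fixed \<open>x\<close>: the derivative of \<open>v (x - y)\<close> in \<open>y\<close> changes
  sign, which fits \<open>v + v1 / \<alpha>2 = h1\<close>.\<close>

lemma bilateral_gamma_stationary:
  assumes h: "smooth3 h h1 h2 a b c"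
  shows "(\<integral>x. jump_gen bg_jumps h h1 x \<partial>bilateral_gamma \<alpha>1 p1 \<alpha>2 p2) = 0"
proof -
  note d = smooth3D[OF h]
  note mass = prob_space.prob_space[OF prob_space_up_jump] prob_space.prob_space[OF prob_space_down_jump]
  define u where "u = shift_mean up_jump h1"
  define u1 where "u1 = shift_mean up_jump h2"
  define v where "v = shift_mean down_jump h1"
  define v1 where "v1 = shift_mean down_jump h2"
  have ub: "\<bar>u x\<bar> \<le> a" "\<bar>u1 x\<bar> \<le> b" and vb: "\<bar>v x\<bar> \<le> a" "\<bar>v1 x\<bar> \<le> b" for x
    using shift_mean_bound[OF up_jump_measure d(10) d(4), of x] shift_mean_bound[OF up_jump_measure d(11) d(5), of x]
      shift_mean_bound[OF down_jump_measure d(10) d(4), of x] shift_mean_bound[OF down_jump_measure d(11) d(5), of x]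
    by (simp_all add: u_def u1_def v_def v1_def mass)
  have ud: "(u has_real_derivative u1 x) (at x)" and vd: "(v has_real_derivative v1 x) (at x)" for x
    unfolding u_def u1_def v_def v1_def
    by (rule shift_mean_deriv[OF up_jump_measure d(2) d(4) d(5) d(6)], rule shift_mean_deriv[OF down_jump_measure d(2) d(4) d(5) d(6)])
  have c: "continuous_on UNIV u" "continuous_on UNIV v"
    using ud vd by (auto intro!: continuous_at_imp_continuous_on intro: DERIV_isCont)
  have c1: "continuous_on UNIV u1" "continuous_on UNIV v1"
    unfolding u1_def v1_def
    using lipschitz_continuous[OF shift_mean_lipschitz[OF up_jump_measure d(5) d(6)]]
      lipschitz_continuous[OF shift_mean_lipschitz[OF down_jump_measure d(5) d(6)]] by auto
  have hu: "h1 x = u x - u1 x / \<alpha>1" and hv: "h1 x = v x + v1 x / \<alpha>2" for x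
    using shift_mean_up_jump[OF d(2) d(4) d(5) d(11), of x] shift_mean_down_jump[OF d(2) d(4) d(5) d(11), of x]
    by (simp_all add: u_def u1_def v_def v1_def)
  have [measurable]: "u \<in> borel_measurable borel" "v \<in> borel_measurable borel" "h1 \<in> borel_measurable borel"
    using c d by (auto intro: borel_measurable_continuous_onI)
  define A where "A z = fst z * h1 (fst z - snd z) - p1 / \<alpha>1 * u (fst z - snd z)" for z
  define B where "B z = snd z * h1 (fst z - snd z) - p2 / \<alpha>2 * v (fst z - snd z)" for z
  let ?P = "gamma_law \<alpha>1 p1 \<Otimes>\<^sub>M gamma_law \<alpha>2 p2"
  interpret P: finite_measure ?P by (rule finite_measure_pair_measure) unfold_locales
  have m: "integrable (gamma_law \<alpha>1 p1) (\<lambda>x. x)" "integrable (gamma_law \<alpha>2 p2) (\<lambda>x. x)"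
    using integrable_gamma_law_moment[of \<alpha>1 p1 1] integrable_gamma_law_moment[of \<alpha>2 p2 1] pos by simp_all
  have m2: "integrable ?P fst" "integrable ?P snd"
    using integrable_pair_mult[OF m(1), of "\<lambda>_. 1"] integrable_pair_mult[OF _ m(2), of "\<lambda>_. 1"]
    by (simp_all add: case_prod_unfold)
  have iA: "integrable ?P A" and iB: "integrable ?P B"
    unfolding A_def B_def
    by (intro Bochner_Integration.integrable_diff integrable_mult_right
        integrable_bounded_mult[OF m2(1) _ d(4)] integrable_bounded_mult[OF m2(2) _ d(4)]
        abs_integral_le_const(1)[OF P.finite_measure_axioms _ ub(1)]
        abs_integral_le_const(1)[OF P.finite_measure_axioms _ vb(1)]; measurable)+
  have A0: "(\<integral>x. A (x, y) \<partial>gamma_law \<alpha>1 p1) = 0" for y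
  proof -
    have dd: "((\<lambda>x. u (x - y)) has_real_derivative u1 (x - y)) (at x)" for x
      by (rule DERIV_cong[OF DERIV_chain2[OF ud]]) (auto intro!: derivative_eq_intros)
    have cc: "continuous_on UNIV (\<lambda>x. u1 (x - y))"
      by (intro continuous_on_compose2[OF c1(1)] continuous_intros) auto
    have "(\<integral>x. x * h1 (x - y) \<partial>gamma_law \<alpha>1 p1) = p1 / \<alpha>1 * (\<integral>x. u (x - y) \<partial>gamma_law \<alpha>1 p1)"
      using gamma_law_stein[OF pos(1,2) dd ub(1) ub(2) cc] by (simp add: hu)
    moreover have "integrable (gamma_law \<alpha>1 p1) (\<lambda>x. x * h1 (x - y))"
      using pos by (intro integrable_bounded_mult[OF m(1) _ d(4)]) simp
    moreover have "integrable (gamma_law \<alpha>1 p1) (\<lambda>x. u (x - y))"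
      using pos ub(1) by (intro abs_integral_le_const(1)[OF g1.finite_measure_axioms]) auto
    ultimately show ?thesis unfolding A_def by simp
  qed
  have B0: "(\<integral>y. B (x, y) \<partial>gamma_law \<alpha>2 p2) = 0" for x
  proof -
    have dd: "((\<lambda>y. v (x - y)) has_real_derivative - v1 (x - y)) (at y)" for y
      by (rule DERIV_cong[OF DERIV_chain2[OF vd]]) (auto intro!: derivative_eq_intros)
    have cc: "continuous_on UNIV (\<lambda>y. - v1 (x - y))"
      by (intro continuous_intros continuous_on_compose2[OF c1(2)]) auto
    have "(\<integral>y. y * h1 (x - y) \<partial>gamma_law \<alpha>2 p2) = p2 / \<alpha>2 * (\<integral>y. v (x - y) \<partial>gamma_law \<alpha>2 p2)"
      using gamma_law_stein[OF pos(3,4) dd vb(1) _ cc, of b] vb(2) by (simp add: hv)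
    moreover have "integrable (gamma_law \<alpha>2 p2) (\<lambda>y. y * h1 (x - y))"
      using pos by (intro integrable_bounded_mult[OF m(2) _ d(4)]) simp
    moreover have "integrable (gamma_law \<alpha>2 p2) (\<lambda>y. v (x - y))"
      using pos vb(1) by (intro abs_integral_le_const(1)[OF g2.finite_measure_axioms]) auto
    ultimately show ?thesis unfolding B_def by simp
  qed
  have "(\<integral>z. A z \<partial>?P) = (\<integral>y. \<integral>x. A (x, y) \<partial>gamma_law \<alpha>1 p1 \<partial>gamma_law \<alpha>2 p2)"
    using gp.integral_snd[of "\<lambda>x y. A (x, y)"] iA by simp
  then have A: "(\<integral>z. A z \<partial>?P) = 0" by (simp add: A0)
  have "(\<integral>z. B z \<partial>?P) = (\<integral>x. \<integral>y. B (x, y) \<partial>gamma_law \<alpha>2 p2 \<partial>gamma_law \<alpha>1 p1)"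
    using gp.integral_fst'[OF iB] by simp
  then have B: "(\<integral>z. B z \<partial>?P) = 0" by (simp add: B0)
  have [measurable]: "jump_gen bg_jumps h h1 \<in> borel_measurable borel"
    unfolding jump_gen_bg[OF h, abs_def] u_def[symmetric] v_def[symmetric] by measurable
  have "(\<integral>x. jump_gen bg_jumps h h1 x \<partial>bilateral_gamma \<alpha>1 p1 \<alpha>2 p2)
      = (\<integral>z. jump_gen bg_jumps h h1 (case z of (x, y) \<Rightarrow> x - y) \<partial>?P)"
    unfolding bilateral_gamma_def by (rule integral_distr) measurable
  also have "\<dots> = (\<integral>z. B z - A z \<partial>?P)"
    by (rule Bochner_Integration.integral_cong)
       (auto simp: A_def B_def jump_gen_bg[OF h] u_def v_def algebra_simps)
  also have "\<dots> = 0" using iA iB A B by simp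
  finally show ?thesis .
qed

end

section \<open>Finite Gaussian chaos\<close>

lemma FTC_whole_line:
  fixes F f :: "real \<Rightarrow> real"
  assumes "\<And>x. (F has_real_derivative f x) (at x)" "\<And>x. isCont f x"
    and int: "integrable lborel f"
    and A: "(F \<longlongrightarrow> A) at_bot" and B: "(F \<longlongrightarrow> B) at_top"
  shows "(\<integral>x. f x \<partial>lborel) = B - A"
proof -
  have "(LBINT x=-\<infinity>..\<infinity>. f x) = B - A"
  proof (rule interval_integral_FTC_integrable[where F=F])
    show "set_integrable lborel (einterval (-\<infinity>) \<infinity>) f"
      using int by (simp add: set_integrable_def)
    show "((F \<circ> real_of_ereal) \<longlongrightarrow> A) (at_right (-\<infinity>))"
      using A by (simp only: ereal_tendsto_simps)
    show "((F \<circ> real_of_ereal) \<longlongrightarrow> B) (at_left \<infinity>)"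
      using B by (simp only: ereal_tendsto_simps)
  qed (use assms in \<open>auto simp: has_real_derivative_iff_has_vector_derivative\<close>)
  then show ?thesis
    by (simp add: interval_lebesgue_integral_def set_lebesgue_integral_def)
qed

text \<open>The integrand is the derivative of minus density times
  \<open>z * f (l * (z\<^sup>2 - 1) + y)\<close>: differentiating the density and the factor
  \<open>z\<close> gives \<open>z\<^sup>2 - 1\<close>, and the inner derivative
  \<open>2 * l * z\<close> meets that factor \<open>z\<close>.\<close>

lemma std_normal_second_chaos_ibp:
  assumes f: "\<And>x. (f has_real_derivative f1 x) (at x)" "\<And>x. \<bar>f x\<bar> \<le> K" "\<And>x. \<bar>f1 x\<bar> \<le> A"
    and cont: "continuous_on UNIV f1"
  shows "(\<integral>z. std_normal_density z * ((z\<^sup>2 - 1) * f (l * (z\<^sup>2 - 1) + y) - 2 * l * (z\<^sup>2 * f1 (l * (z\<^sup>2 - 1) + y))) \<partial>lborel) = 0"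
proof -
  have cw: "continuous_on UNIV f"
    using f(1) by (auto intro: continuous_at_imp_continuous_on DERIV_isCont)
  have [measurable]: "f \<in> borel_measurable borel" "f1 \<in> borel_measurable borel"
    using cw cont by (auto intro: borel_measurable_continuous_onI)
  have iw: "isCont f x" "isCont f1 x" for x
    using cw cont by (auto simp: continuous_on_eq_continuous_at)
  define g where "g z = l * (z\<^sup>2 - 1) + y" for z :: real
  define F where "F z = - (std_normal_density z * z * f (g z))" for z
  define D where "D z = std_normal_density z * ((z\<^sup>2 - 1) * f (g z) - 2 * l * (z\<^sup>2 * f1 (g z)))" for z
  have dens: "(std_normal_density has_real_derivative - z * std_normal_density z) (at z)" for z
    unfolding std_normal_density_def[abs_def]
    by (rule DERIV_cong, rule derivative_eq_intros | simp)+
  have Fd: "(F has_real_derivative D z) (at z)" for z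
  proof -
    have "(g has_real_derivative 2 * l * z) (at z)"
      unfolding g_def[abs_def] by (auto intro!: derivative_eq_intros)
    from DERIV_chain2[OF f(1) this]
    have "((\<lambda>z. f (g z)) has_real_derivative f1 (g z) * (2 * l * z)) (at z)" .
    then show ?thesis unfolding F_def D_def
      by (auto intro!: derivative_eq_intros dens simp: algebra_simps power2_eq_square)
  qed
  have intk: "integrable lborel (\<lambda>z. std_normal_density z * z ^ k)" for k
    by (rule integrable_std_normal_moment)
  have intD: "integrable lborel D"
  proof -
    have "integrable lborel (\<lambda>z. (std_normal_density z * z ^ 2) * f (g z) - (std_normal_density z * z ^ 0) * f (g z)
        - 2 * l * ((std_normal_density z * z ^ 2) * f1 (g z)))"
      by (intro Bochner_Integration.integrable_diff integrable_mult_right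
          integrable_bounded_mult[OF intk _ f(2)] integrable_bounded_mult[OF intk _ f(3)])
         (simp_all add: g_def)
    then show ?thesis unfolding D_def by (simp add: algebra_simps)
  qed
  have contD: "isCont D z" for z
    unfolding D_def g_def std_normal_density_def
    by (intro continuous_intros isCont_o2[OF _ iw(1)] isCont_o2[OF _ iw(2)]) auto
  have Fb: "norm (F z) \<le> std_normal_density z * \<bar>z\<bar> * K" for z
    using f(2)[of "g z"] by (auto simp: F_def abs_mult intro!: mult_left_mono)
  have "(\<integral>z. D z \<partial>lborel) = 0 - 0"
  proof (rule FTC_whole_line[OF Fd contD intD])
    have "((\<lambda>z. std_normal_density z * \<bar>z\<bar>) \<longlongrightarrow> 0) at_bot" "((\<lambda>z. std_normal_density z * \<bar>z\<bar>) \<longlongrightarrow> 0) at_top"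
      unfolding std_normal_density_def by real_asymp+
    then have "((\<lambda>z. std_normal_density z * \<bar>z\<bar> * K) \<longlongrightarrow> 0) at_bot" "((\<lambda>z. std_normal_density z * \<bar>z\<bar> * K) \<longlongrightarrow> 0) at_top"
      by (auto intro: tendsto_mult_left_zero)
    then show "(F \<longlongrightarrow> 0) at_bot" "(F \<longlongrightarrow> 0) at_top"
      using Lim_null_comparison[OF always_eventually, of F "\<lambda>z. std_normal_density z * \<bar>z\<bar> * K"] Fb by blast+
  qed
  then show ?thesis by (simp add: D_def g_def)
qed

text \<open>For each fixed value of \<open>Y\<close> this is the one-dimensional identity; Fubini
  integrates it over the law of \<open>Y\<close>.\<close>

lemma (in prob_space) indep_second_chaos_ibp:
  assumes ind: "indep_var borel Z borel Y"
    and Z: "distributed M lborel Z std_normal_density"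
    and f: "\<And>x. (f has_real_derivative f1 x) (at x)" "\<And>x. \<bar>f x\<bar> \<le> K" "\<And>x. \<bar>f1 x\<bar> \<le> A"
    and cont: "continuous_on UNIV f1"
  shows "expectation (\<lambda>w. ((Z w)\<^sup>2 - 1) * f (l * ((Z w)\<^sup>2 - 1) + Y w))
    = 2 * l * expectation (\<lambda>w. (Z w)\<^sup>2 * f1 (l * ((Z w)\<^sup>2 - 1) + Y w))"
proof -
  have cw: "continuous_on UNIV f"
    using f(1) by (auto intro: continuous_at_imp_continuous_on DERIV_isCont)
  have fm[measurable]: "f \<in> borel_measurable borel" "f1 \<in> borel_measurable borel"
    using cw cont by (auto intro: borel_measurable_continuous_onI)
  have ZY[measurable]: "random_variable borel Z" "random_variable borel Y"
    and joint: "distr M borel Z \<Otimes>\<^sub>M distr M borel Y = distr M (borel \<Otimes>\<^sub>M borel) (\<lambda>x. (Z x, Y x))"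
    using ind by (auto simp: indep_var_distribution_eq)
  have dZ: "distr M borel Z = density lborel std_normal_density"
    using Z by (simp add: distributed_def cong: distr_cong)
  have iZ: "integrable M (\<lambda>w. (Z w) ^ 2)"
  proof -
    have "integrable (distr M borel Z) (\<lambda>x. x ^ 2)"
      unfolding dZ using integrable_std_normal_distribution_moment[of 2] by simp
    then show ?thesis by (subst (asm) integrable_distr_eq) auto
  qed
  define H where "H = (\<lambda>(z, y). (z\<^sup>2 - 1) * f (l * (z\<^sup>2 - 1) + y) - 2 * l * (z\<^sup>2 * f1 (l * (z\<^sup>2 - 1) + y)))"
  have [measurable]: "H \<in> borel_measurable (borel \<Otimes>\<^sub>M borel)" unfolding H_def by measurable
  have i1: "integrable M (\<lambda>w. ((Z w)\<^sup>2 - 1) * f (l * ((Z w)\<^sup>2 - 1) + Y w))"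
    by (rule integrable_bounded_mult[OF _ _ f(2)]) (use iZ in auto)
  have i2: "integrable M (\<lambda>w. (Z w)\<^sup>2 * f1 (l * ((Z w)\<^sup>2 - 1) + Y w))"
    by (rule integrable_bounded_mult[OF iZ _ f(3)]) simp
  have iH: "integrable M (\<lambda>w. H (Z w, Y w))"
    unfolding H_def using i1 i2 by simp
  interpret Zd: prob_space "distr M borel Z" by (rule prob_space_distr) simp
  interpret Yd: prob_space "distr M borel Y" by (rule prob_space_distr) simp
  interpret pair_sigma_finite "distr M borel Z" "distr M borel Y" ..
  have "expectation (\<lambda>w. H (Z w, Y w)) = (\<integral>x. H x \<partial>(distr M borel Z \<Otimes>\<^sub>M distr M borel Y))"
    unfolding joint by (rule integral_distr[symmetric]) measurable
  also have "\<dots> = (\<integral>y. \<integral>z. H (z, y) \<partial>distr M borel Z \<partial>distr M borel Y)"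
  proof -
    have "integrable (distr M borel Z \<Otimes>\<^sub>M distr M borel Y) H"
      unfolding joint using iH by (subst integrable_distr_eq) auto
    then show ?thesis using integral_snd[of "\<lambda>z y. H (z, y)"] by simp
  qed
  also have "\<dots> = 0"
  proof -
    have "(\<integral>z. H (z, y) \<partial>distr M borel Z) = 0" for y
      unfolding dZ H_def
      using std_normal_second_chaos_ibp[OF f cont, of l y] by (subst integral_density) auto
    then show ?thesis by simp
  qed
  finally show ?thesis unfolding H_def using i1 i2 by simp
qed

lemma (in prob_space) expectation_abs_le_sqrt:
  fixes X :: "'a \<Rightarrow> real"
  assumes "random_variable borel X" "integrable M (\<lambda>w. (X w)\<^sup>2)"
  shows "expectation (\<lambda>w. \<bar>X w\<bar>) \<le> sqrt (expectation (\<lambda>w. (X w)\<^sup>2))"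
proof (rule real_le_rsqrt)
  have i: "integrable M (\<lambda>w. \<bar>X w\<bar>)"
    using square_integrable_imp_integrable[OF assms] by (rule integrable_abs)
  have "0 \<le> variance (\<lambda>w. \<bar>X w\<bar>)" by (rule variance_positive)
  also have "\<dots> = expectation (\<lambda>w. \<bar>X w\<bar>\<^sup>2) - (expectation (\<lambda>w. \<bar>X w\<bar>))\<^sup>2"
    using i assms(2) by (intro variance_eq) simp_all
  finally show "(expectation (\<lambda>w. \<bar>X w\<bar>))\<^sup>2 \<le> expectation (\<lambda>w. (X w)\<^sup>2)" by simp
qed

locale gaussian_chaos = prob_space M for M :: "'a measure" +
  fixes S :: "'i set" and Z :: "'i \<Rightarrow> 'a \<Rightarrow> real" and l :: "'i \<Rightarrow> real"
  assumes finite_S: "finite S" and indep_Z: "indep_vars (\<lambda>_. borel) Z S"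
    and normal_Z: "\<And>i. i \<in> S \<Longrightarrow> distributed M lborel (Z i) std_normal_density"
begin

definition C :: "'i \<Rightarrow> 'a \<Rightarrow> real" where "C i w = (Z i w)\<^sup>2 - 1"

definition G :: "'a \<Rightarrow> real" where "G w = (\<Sum>i\<in>S. l i * C i w)"

text \<open>Cumulants in disguise: for \<open>m \<ge> 2\<close> the cumulant of \<open>G\<close> of
  order \<open>m\<close> is \<open>2^(m-1) (m-1)!\<close> times this power sum.\<close>

definition psum :: "nat \<Rightarrow> real" where "psum m = (\<Sum>i\<in>S. l i ^ m)"

lemma Z_measurable[measurable]: "i \<in> S \<Longrightarrow> random_variable borel (Z i)"
  using indep_Z by (auto simp: indep_vars_def)

lemma C_measurable[measurable]: "i \<in> S \<Longrightarrow> random_variable borel (C i)"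
  unfolding C_def[abs_def] by measurable

lemma G_measurable[measurable]: "random_variable borel G"
  unfolding G_def[abs_def] by measurable

lemma Z_moment:
  assumes i: "i \<in> S"
  shows "integrable M (\<lambda>w. Z i w ^ k)"
    "expectation (\<lambda>w. Z i w ^ (2 * k)) = fact (2 * k) / (2 ^ k * fact k)"
proof -
  note [measurable] = Z_measurable[OF i]
  have d: "distr M borel (Z i) = density lborel std_normal_density"
    using normal_Z[OF i] by (simp add: distributed_def cong: distr_cong)
  have "integrable (distr M borel (Z i)) (\<lambda>x. x ^ k)"
    unfolding d by (rule integrable_std_normal_distribution_moment)
  then show "integrable M (\<lambda>w. Z i w ^ k)" by (subst (asm) integrable_distr_eq) auto
  have "expectation (\<lambda>w. Z i w ^ (2 * k)) = (\<integral>x. x ^ (2 * k) \<partial>distr M borel (Z i))"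
    by (subst integral_distr) auto
  then show "expectation (\<lambda>w. Z i w ^ (2 * k)) = fact (2 * k) / (2 ^ k * fact k)"
    unfolding d by (simp only: std_normal_distribution_even_moments(1))
qed

lemma C_integrable: "i \<in> S \<Longrightarrow> integrable M (C i)"
  unfolding C_def[abs_def] using Z_moment(1)[of i 2] by simp

lemma expectation_C: "i \<in> S \<Longrightarrow> expectation (C i) = 0"
  unfolding C_def[abs_def] using Z_moment(1)[of i 2] Z_moment(2)[of i 1] by (simp add: prob_space)

lemma expectation_C_square:
  assumes i: "i \<in> S"
  shows "integrable M (\<lambda>w. C i w * C i w)" "expectation (\<lambda>w. C i w * C i w) = 2"
proof -
  have eq: "(\<lambda>w. C i w * C i w) = (\<lambda>w. Z i w ^ (2 * 2) - 2 * Z i w ^ (2 * 1) + 1)"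
    by (auto simp: C_def fun_eq_iff power2_eq_square power4_eq_xxxx algebra_simps)
  show "integrable M (\<lambda>w. C i w * C i w)"
    unfolding eq by (intro Bochner_Integration.integrable_add Bochner_Integration.integrable_diff
        integrable_mult_right Z_moment i) simp
  have "expectation (\<lambda>w. C i w * C i w) = expectation (\<lambda>w. Z i w ^ (2 * 2)) - 2 * expectation (\<lambda>w. Z i w ^ (2 * 1)) + 1"
    unfolding eq using Z_moment(1)[OF i, of "2 * 2"] Z_moment(1)[OF i, of "2 * 1"] by (simp add: prob_space)
  also have "\<dots> = 2" unfolding Z_moment(2)[OF i] by (simp add: fact_numeral)
  finally show "expectation (\<lambda>w. C i w * C i w) = 2" .
qed

lemma expectation_C_mult:
  assumes ij: "i \<in> S" "j \<in> S" "i \<noteq> j"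
  shows "integrable M (\<lambda>w. C i w * C j w)" "expectation (\<lambda>w. C i w * C j w) = 0"
proof -
  have ind: "indep_vars (\<lambda>_. borel) C {i, j}"
    unfolding C_def[abs_def]
    by (rule indep_vars_compose2[OF indep_vars_subset[OF indep_Z], where Y="\<lambda>i z. z\<^sup>2 - 1"]) (use ij in auto)
  note * = indep_vars_integrable[OF _ ind] indep_vars_lebesgue_integral[OF _ ind]
  show "integrable M (\<lambda>w. C i w * C j w)" "expectation (\<lambda>w. C i w * C j w) = 0"
    using * ij C_integrable expectation_C by auto
qed

text \<open>The \<open>C i\<close> are centred, uncorrelated and of variance 2.\<close>

lemma expectation_chaos_square:
  "integrable M (\<lambda>w. (\<Sum>i\<in>S. r i * C i w)\<^sup>2)"
  "expectation (\<lambda>w. ((\<Sum>i\<in>S. r i * C i w) + k)\<^sup>2) = 2 * (\<Sum>i\<in>S. (r i)\<^sup>2) + k\<^sup>2"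
proof -
  let ?S = "\<lambda>w. \<Sum>i\<in>S. r i * C i w"
  have sq: "(?S w)\<^sup>2 = (\<Sum>i\<in>S. \<Sum>j\<in>S. (r i * r j) * (C i w * C j w))" for w
    by (simp add: power2_eq_square sum_product mult_ac)
  have iC: "integrable M (\<lambda>w. C i w * C j w)" if "i \<in> S" "j \<in> S" for i j
    using expectation_C_square expectation_C_mult that by (cases "i = j") auto
  show i: "integrable M (\<lambda>w. (?S w)\<^sup>2)"
    unfolding sq by (intro Bochner_Integration.integrable_sum integrable_mult_right iC)
  have i1: "integrable M ?S"
    by (intro Bochner_Integration.integrable_sum integrable_mult_right C_integrable)
  have e1: "expectation ?S = 0"
    by (subst Bochner_Integration.integral_sum) (auto simp: C_integrable expectation_C)
  have e2: "expectation (\<lambda>w. (?S w)\<^sup>2) = 2 * (\<Sum>i\<in>S. (r i)\<^sup>2)"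
  proof -
    have "expectation (\<lambda>w. (?S w)\<^sup>2)
        = (\<Sum>i\<in>S. \<Sum>j\<in>S. (r i * r j) * expectation (\<lambda>w. C i w * C j w))"
      unfolding sq using iC by (simp add: Bochner_Integration.integral_sum)
    also have "\<dots> = (\<Sum>i\<in>S. \<Sum>j\<in>S. if i = j then 2 * (r i)\<^sup>2 else 0)"
      by (intro sum.cong refl)
         (auto simp: expectation_C_square expectation_C_mult power2_eq_square)
    also have "\<dots> = 2 * (\<Sum>i\<in>S. (r i)\<^sup>2)"
      using finite_S by (simp add: sum_distrib_left)
    finally show ?thesis .
  qed
  have "expectation (\<lambda>w. (?S w + k)\<^sup>2)
      = expectation (\<lambda>w. (?S w)\<^sup>2 + 2 * k * ?S w + k\<^sup>2)"
    by (simp add: power2_sum algebra_simps)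
  also have "\<dots> = 2 * (\<Sum>i\<in>S. (r i)\<^sup>2) + k\<^sup>2"
    using i i1 e1 e2 by (simp add: prob_space)
  finally show "expectation (\<lambda>w. (?S w + k)\<^sup>2) = 2 * (\<Sum>i\<in>S. (r i)\<^sup>2) + k\<^sup>2" .
qed

lemma G_integrable: "integrable M G" "integrable M (\<lambda>w. (G w)\<^sup>2)"
  unfolding G_def[abs_def]
  by (intro Bochner_Integration.integrable_sum integrable_mult_right C_integrable, simp)
     (rule expectation_chaos_square)

lemma chaos_ibp:
  assumes j: "j \<in> S"
    and f: "\<And>x. (f has_real_derivative f1 x) (at x)" "\<And>x. \<bar>f x\<bar> \<le> K" "\<And>x. \<bar>f1 x\<bar> \<le> A"
    and cont: "continuous_on UNIV f1"
  shows "expectation (\<lambda>w. C j w * f (G w)) = 2 * l j * expectation (\<lambda>w. (C j w + 1) * f1 (G w))"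
proof -
  \<comment> \<open>Index \<open>j\<close> is left untransformed, so that splitting the sum yields
    \<open>Z j\<close> itself, independent of all other summands together.\<close>
  define Y where "Y i z = (if i = j then z else l i * (z\<^sup>2 - 1))" for i and z :: real
  have "indep_vars (\<lambda>_. borel) (\<lambda>i w. Y i (Z i w)) S"
    by (rule indep_vars_compose2[OF indep_Z]) (simp add: Y_def)
  then have "indep_vars (\<lambda>_. borel) (\<lambda>i w. Y i (Z i w)) (insert j (S - {j}))"
    using j by (simp add: insert_absorb)
  from indep_vars_sum[OF _ _ this] finite_S
  have "indep_var borel (\<lambda>w. Y j (Z j w)) borel (\<lambda>w. \<Sum>i\<in>S - {j}. Y i (Z i w))" by simp
  then have ind: "indep_var borel (Z j) borel (\<lambda>w. \<Sum>i\<in>S - {j}. l i * C i w)"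
    by (simp add: Y_def C_def)
  have G: "G w = l j * ((Z j w)\<^sup>2 - 1) + (\<Sum>i\<in>S - {j}. l i * C i w)" for w
    unfolding G_def using j finite_S by (simp add: sum.remove C_def)
  show ?thesis
    using indep_second_chaos_ibp[OF ind normal_Z[OF j] f cont, of "l j"]
    by (simp add: G C_def)
qed

text \<open>Integration by parts replaces \<open>C i\<close> by \<open>C i + 1\<close>. Only the
  part with \<open>C i\<close> is integrated again; the constant part leaves
  \<open>2 * psum 2\<close>, the variance of \<open>G\<close>, as coefficient of the mean of
  \<open>f1 (G w)\<close>, to be compared with \<eta>. All the rest multiplies \<open>f2\<close>,
  and Cauchy-Schwarz replaces its random coefficient by a root mean square.\<close>

lemma stein_functional:
  assumes f: "\<And>x. (f has_real_derivative f1 x) (at x)" "\<And>x. (f1 has_real_derivative f2 x) (at x)"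
    and b: "\<And>x. \<bar>f x\<bar> \<le> K0" "\<And>x. \<bar>f1 x\<bar> \<le> K1" "\<And>x. \<bar>f2 x\<bar> \<le> K2"
    and c: "continuous_on UNIV f2"
  shows "\<bar>expectation (\<lambda>w. - G w * f (G w) + \<beta> * G w * f1 (G w) + \<gamma> * G w * f2 (G w)
      + \<delta> * f (G w) + \<eta> * f1 (G w))\<bar>
    \<le> \<bar>\<delta>\<bar> * K0 + \<bar>\<eta> - 2 * psum 2\<bar> * K1
      + sqrt (2 * (\<Sum>i\<in>S. (- 4 * l i ^ 3 + 2 * \<beta> * l i ^ 2 + \<gamma> * l i)\<^sup>2)
          + (2 * \<beta> * psum 2 - 4 * psum 3)\<^sup>2) * K2"
proof -
  let ?C = "\<lambda>i g. expectation (\<lambda>w. C i w * g (G w))" and ?G = "\<lambda>g. expectation (\<lambda>w. G w * g (G w))"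
  have cf: "continuous_on UNIV f" "continuous_on UNIV f1"
    using f by (auto intro!: continuous_at_imp_continuous_on intro: DERIV_isCont)
  have [measurable]: "f \<in> borel_measurable borel" "f1 \<in> borel_measurable borel" "f2 \<in> borel_measurable borel"
    using cf c by (auto intro: borel_measurable_continuous_onI)
  have iC: "integrable M (\<lambda>w. C i w * f (G w))" "integrable M (\<lambda>w. C i w * f1 (G w))"
    "integrable M (\<lambda>w. C i w * f2 (G w))" if "i \<in> S" for i
    using that b by (auto intro!: integrable_bounded_mult[OF C_integrable])
  have i0: "integrable M (\<lambda>w. f (G w))" "integrable M (\<lambda>w. f1 (G w))" "integrable M (\<lambda>w. f2 (G w))"
    using integrable_bounded_mult[of M "\<lambda>_. 1::real" "\<lambda>w. f (G w)" K0]
      integrable_bounded_mult[of M "\<lambda>_. 1::real" "\<lambda>w. f1 (G w)" K1]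
      integrable_bounded_mult[of M "\<lambda>_. 1::real" "\<lambda>w. f2 (G w)" K2] b by auto
  have iG: "integrable M (\<lambda>w. G w * f (G w))" "integrable M (\<lambda>w. G w * f1 (G w))"
    "integrable M (\<lambda>w. G w * f2 (G w))"
    using b by (auto intro!: integrable_bounded_mult[OF G_integrable(1)])
  have expand: "expectation (\<lambda>w. G w * g (G w)) = (\<Sum>i\<in>S. l i * expectation (\<lambda>w. C i w * g (G w)))"
    if "\<And>i. i \<in> S \<Longrightarrow> integrable M (\<lambda>w. C i w * g (G w))" for g :: "real \<Rightarrow> real"
  proof -
    have "expectation (\<lambda>w. G w * g (G w)) = expectation (\<lambda>w. \<Sum>i\<in>S. l i * (C i w * g (G w)))"
      by (simp add: G_def sum_distrib_right mult_ac)
    then show ?thesis using that by (simp add: Bochner_Integration.integral_sum)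
  qed
  have ex: "?G f = (\<Sum>i\<in>S. l i * ?C i f)"
    "?G f1 = (\<Sum>i\<in>S. l i * ?C i f1)"
    "?G f2 = (\<Sum>i\<in>S. l i * ?C i f2)"
    by (intro expand iC; assumption)+
  have ibp1: "?C i f
      = 2 * l i * (?C i f1 + expectation (\<lambda>w. f1 (G w)))" if "i \<in> S" for i
    using chaos_ibp[OF that f(1) b(1,2) cf(2)] iC(2)[OF that] i0 by (simp add: distrib_right)
  have ibp2: "?C i f1
      = 2 * l i * (?C i f2 + expectation (\<lambda>w. f2 (G w)))" if "i \<in> S" for i
    using chaos_ibp[OF that f(2) b(2,3) c] iC(3)[OF that] i0 by (simp add: distrib_right)
  let ?e1 = "expectation (\<lambda>w. f1 (G w))" and ?e2 = "expectation (\<lambda>w. f2 (G w))"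
  have E0: "?G f
      = 2 * psum 2 * ?e1 + (\<Sum>i\<in>S. 4 * l i ^ 3 * ?C i f2) + 4 * psum 3 * ?e2"
  proof -
    have "?G f = (\<Sum>i\<in>S. 2 * l i ^ 2 * ?e1 + 4 * l i ^ 3 * ?C i f2 + 4 * l i ^ 3 * ?e2)"
      unfolding ex(1)
      by (intro sum.cong refl) (simp add: ibp1 ibp2 power2_eq_square power3_eq_cube algebra_simps)
    then show ?thesis
      by (simp add: sum.distrib psum_def sum_distrib_left sum_distrib_right)
  qed
  have E1: "?G f1 = (\<Sum>i\<in>S. 2 * l i ^ 2 * ?C i f2) + 2 * psum 2 * ?e2"
  proof -
    have "?G f1 = (\<Sum>i\<in>S. 2 * l i ^ 2 * ?C i f2 + 2 * l i ^ 2 * ?e2)"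
      unfolding ex(2)
      by (intro sum.cong refl) (simp add: ibp2 power2_eq_square algebra_simps)
    then show ?thesis
      by (simp add: sum.distrib psum_def sum_distrib_left sum_distrib_right)
  qed
  \<comment> \<open>\<open>R\<close> below collects the coefficient of \<open>f2 (G w)\<close>: the
    cubes and \<open>psum 3\<close> come from integrating \<open>- G f\<close> twice, the terms with
    \<beta> from one integration, the term with \<gamma> from none.\<close>
  define r where "r i = - 4 * l i ^ 3 + 2 * \<beta> * l i ^ 2 + \<gamma> * l i" for i
  define k where "k = 2 * \<beta> * psum 2 - 4 * psum 3"
  define R where "R w = (\<Sum>i\<in>S. r i * C i w) + k" for w
  have [measurable]: "random_variable borel R" unfolding R_def[abs_def] by measurable
  have R2: "integrable M (\<lambda>w. (R w)\<^sup>2)" "expectation (\<lambda>w. (R w)\<^sup>2) = 2 * (\<Sum>i\<in>S. (r i)\<^sup>2) + k\<^sup>2"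
  proof -
    show "expectation (\<lambda>w. (R w)\<^sup>2) = 2 * (\<Sum>i\<in>S. (r i)\<^sup>2) + k\<^sup>2"
      unfolding R_def by (rule expectation_chaos_square)
    have "integrable M (\<lambda>w. (\<Sum>i\<in>S. r i * C i w)\<^sup>2 + 2 * k * (\<Sum>i\<in>S. r i * C i w) + k\<^sup>2)"
      by (intro Bochner_Integration.integrable_add integrable_mult_right expectation_chaos_square
          Bochner_Integration.integrable_sum C_integrable) auto
    then show "integrable M (\<lambda>w. (R w)\<^sup>2)"
      by (simp add: R_def power2_sum algebra_simps)
  qed
  have iR: "integrable M R" by (rule square_integrable_imp_integrable[OF _ R2(1)]) simp
  have ER: "expectation (\<lambda>w. R w * f2 (G w)) = (\<Sum>i\<in>S. r i * ?C i f2) + k * ?e2"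
  proof -
    have "expectation (\<lambda>w. R w * f2 (G w)) = expectation (\<lambda>w. (\<Sum>i\<in>S. r i * (C i w * f2 (G w))) + k * f2 (G w))"
      by (simp add: R_def distrib_right sum_distrib_right mult.assoc)
    also have "\<dots> = (\<Sum>i\<in>S. r i * ?C i f2) + k * ?e2"
      using iC(3) i0 by (simp add: Bochner_Integration.integral_sum)
    finally show ?thesis .
  qed
  have "expectation (\<lambda>w. - G w * f (G w) + \<beta> * G w * f1 (G w) + \<gamma> * G w * f2 (G w)
      + \<delta> * f (G w) + \<eta> * f1 (G w))
    = - ?G f + \<beta> * ?G f1
      + \<gamma> * ?G f2 + \<delta> * expectation (\<lambda>w. f (G w)) + \<eta> * ?e1"
    using iG i0 by (simp add: mult.assoc)
  also have "\<dots> = \<delta> * expectation (\<lambda>w. f (G w)) + (\<eta> - 2 * psum 2) * ?e1 + expectation (\<lambda>w. R w * f2 (G w))"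
    unfolding E0 E1 ER ex(3) k_def r_def
    by (simp add: algebra_simps sum.distrib sum_subtractf sum_distrib_left)
  also have "\<bar>\<dots>\<bar> \<le> \<bar>\<delta>\<bar> * K0 + \<bar>\<eta> - 2 * psum 2\<bar> * K1 + sqrt (2 * (\<Sum>i\<in>S. (r i)\<^sup>2) + k\<^sup>2) * K2"
  proof -
    have bE: "\<bar>expectation (\<lambda>w. g (G w))\<bar> \<le> K" if "\<And>x. \<bar>g x\<bar> \<le> K" "integrable M (\<lambda>w. g (G w))" for g and K :: real
    proof -
      have "\<bar>expectation (\<lambda>w. g (G w))\<bar> \<le> expectation (\<lambda>w. \<bar>g (G w)\<bar>)" by (rule integral_abs_bound)
      also have "\<dots> \<le> expectation (\<lambda>w. K)" using that by (intro integral_mono) auto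
      finally show ?thesis by (simp add: prob_space)
    qed
    have K2: "0 \<le> K2" using b(3)[of 0] by linarith
    have "\<bar>expectation (\<lambda>w. R w * f2 (G w))\<bar> \<le> expectation (\<lambda>w. \<bar>R w * f2 (G w)\<bar>)" by (rule integral_abs_bound)
    also have "\<dots> \<le> expectation (\<lambda>w. \<bar>R w\<bar> * K2)"
      using iR b(3) by (intro integral_mono integrable_abs integrable_bounded_mult[OF iR _ b(3)])
        (auto simp: abs_mult intro: mult_left_mono)
    also have "\<dots> = expectation (\<lambda>w. \<bar>R w\<bar>) * K2" by simp
    also have "\<dots> \<le> sqrt (expectation (\<lambda>w. (R w)\<^sup>2)) * K2"
      by (rule mult_right_mono[OF expectation_abs_le_sqrt K2]) (simp_all add: R2(1))
    finally have 3: "\<bar>expectation (\<lambda>w. R w * f2 (G w))\<bar> \<le> sqrt (2 * (\<Sum>i\<in>S. (r i)\<^sup>2) + k\<^sup>2) * K2"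
      unfolding R2(2) .
    have 1: "\<bar>\<delta> * expectation (\<lambda>w. f (G w))\<bar> \<le> \<bar>\<delta>\<bar> * K0"
      unfolding abs_mult by (intro mult_left_mono bE b i0) auto
    have 2: "\<bar>(\<eta> - 2 * psum 2) * ?e1\<bar> \<le> \<bar>\<eta> - 2 * psum 2\<bar> * K1"
      unfolding abs_mult by (intro mult_left_mono bE b i0) auto
    show ?thesis using 1 2 3 by linarith
  qed
  finally show ?thesis unfolding r_def k_def .
qed

end

definition chaos_log :: "'i set \<Rightarrow> ('i \<Rightarrow> real) \<Rightarrow> complex \<Rightarrow> complex" where
  "chaos_log S l z = (\<Sum>i\<in>S. (- Ln (1 - 2 * \<i> * of_real (l i) * z) - 2 * \<i> * of_real (l i) * z) / 2)"

context gaussian_chaos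
begin

definition cf :: "real \<Rightarrow> complex" where
  "cf t = (CLINT w|M. iexp (t * G w))"

lemma integrable_mult_iexp:
  assumes "integrable M X"
  shows "integrable M (\<lambda>w. complex_of_real (X w) * iexp (t * G w))"
proof (rule Bochner_Integration.integrable_bound)
  show "integrable M X" by fact
  have [measurable]: "X \<in> borel_measurable M" using assms by simp
  show "(\<lambda>w. complex_of_real (X w) * iexp (t * G w)) \<in> borel_measurable M" by measurable
qed (auto simp: norm_mult)

text \<open>Integration by parts takes real test functions, hence cosine and sine. Together they
  give \<open>A = k * (A + cf t)\<close> with \<open>k = 2 i l t\<close>, an equation that is solved
  for the unknown expectation \<open>A\<close>.\<close>

lemma iexp_ibp:
  assumes i: "i \<in> S"
  shows "(CLINT w|M. of_real (C i w) * iexp (t * G w)) * (1 - 2 * \<i> * l i * t) = 2 * \<i> * l i * t * cf t"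
proof -
  have trig: "(CLINT w|M. of_real (X w) * iexp (t * G w)) =
      of_real (expectation (\<lambda>w. X w * cos (t * G w))) + \<i> * of_real (expectation (\<lambda>w. X w * sin (t * G w)))"
    if "integrable M X" for X
  proof (rule complex_eqI)
    have i: "integrable M (\<lambda>w. complex_of_real (X w) * iexp (t * G w))"
      using that by (rule integrable_mult_iexp)
    show "Re (CLINT w|M. of_real (X w) * iexp (t * G w)) = Re (of_real (expectation (\<lambda>w. X w * cos (t * G w)))
        + \<i> * of_real (expectation (\<lambda>w. X w * sin (t * G w))))"
      using integral_Re[OF i] by (simp add: Re_exp)
    show "Im (CLINT w|M. of_real (X w) * iexp (t * G w)) = Im (of_real (expectation (\<lambda>w. X w * cos (t * G w)))
        + \<i> * of_real (expectation (\<lambda>w. X w * sin (t * G w))))"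
      using integral_Im[OF i] by (simp add: Im_exp)
  qed
  have Cc: "expectation (\<lambda>w. C i w * cos (t * G w))
      = 2 * l i * expectation (\<lambda>w. (C i w + 1) * (- t * sin (t * G w)))"
    by (rule chaos_ibp[OF i, of "\<lambda>x. cos (t * x)" "\<lambda>x. - t * sin (t * x)" 1 "\<bar>t\<bar>"])
       (auto intro!: derivative_eq_intros continuous_intros simp: abs_mult mult_left_le)
  have Cs: "expectation (\<lambda>w. C i w * sin (t * G w))
      = 2 * l i * expectation (\<lambda>w. (C i w + 1) * (t * cos (t * G w)))"
    by (rule chaos_ibp[OF i, of "\<lambda>x. sin (t * x)" "\<lambda>x. t * cos (t * x)" 1 "\<bar>t\<bar>"])
       (auto intro!: derivative_eq_intros continuous_intros simp: abs_mult mult_left_le)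
  have iC1: "integrable M (\<lambda>w. C i w + 1)" using C_integrable[OF i] by simp
  have cc: "expectation (\<lambda>w. C i w * cos (t * G w)) = - 2 * l i * t * expectation (\<lambda>w. (C i w + 1) * sin (t * G w))"
  proof -
    have "(\<lambda>w. (C i w + 1) * (- t * sin (t * G w))) = (\<lambda>w. - t * ((C i w + 1) * sin (t * G w)))"
      by (simp add: fun_eq_iff)
    then show ?thesis unfolding Cc by (simp only: integral_mult_right_zero)
  qed
  have cs: "expectation (\<lambda>w. C i w * sin (t * G w)) = 2 * l i * t * expectation (\<lambda>w. (C i w + 1) * cos (t * G w))"
  proof -
    have "(\<lambda>w. (C i w + 1) * (t * cos (t * G w))) = (\<lambda>w. t * ((C i w + 1) * cos (t * G w)))"
      by (simp add: fun_eq_iff)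
    then show ?thesis unfolding Cs by (simp only: integral_mult_right_zero)
  qed
  let ?A = "CLINT w|M. of_real (C i w) * iexp (t * G w)"
  have "?A = 2 * \<i> * l i * t * (CLINT w|M. of_real (C i w + 1) * iexp (t * G w))"
    unfolding trig[OF C_integrable[OF i]] trig[OF iC1] cc cs by (simp add: algebra_simps)
  also have "(CLINT w|M. of_real (C i w + 1) * iexp (t * G w)) = ?A + cf t"
    unfolding cf_def
    using integrable_mult_iexp[OF C_integrable[OF i], of t] integrable_mult_iexp[of "\<lambda>_. 1" t]
    by (simp add: distrib_right)
  finally have "?A = 2 * \<i> * l i * t * (?A + cf t)" .
  moreover have "A = k * (A + c) \<Longrightarrow> A * (1 - k) = k * c" for A k c :: complex by algebra
  ultimately show ?thesis by blast
qed

text \<open>The second moment of \<open>G\<close> turns the pointwise Taylor remainder of the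
  exponential into one that is quadratic in \<open>s - t\<close>.\<close>

lemma cf_deriv:
  "(cf has_vector_derivative \<i> * (CLINT w|M. of_real (G w) * iexp (t * G w))) (at t)"
proof -
  define D where "D = \<i> * (CLINT w|M. of_real (G w) * iexp (t * G w))"
  define K where "K = expectation (\<lambda>w. (G w)\<^sup>2)"
  have i0: "integrable M (\<lambda>w. iexp (s * G w))" for s
    using integrable_mult_iexp[of "\<lambda>_. 1" s] by simp
  have bound: "norm (cf s - cf t - (s - t) *\<^sub>R D) \<le> K * (s - t)\<^sup>2" for s
  proof -
    let ?d = "\<lambda>w. iexp (s * G w) - iexp (t * G w) - (s - t) * (\<i> * (of_real (G w) * iexp (t * G w)))"
    have eq: "cf s - cf t - (s - t) *\<^sub>R D
      = (CLINT w|M. ?d w)"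
      unfolding cf_def D_def
      using i0 integrable_mult_iexp[OF G_integrable(1), of t] by (simp add: scaleR_conv_of_real)
    have "norm (cf s - cf t - (s - t) *\<^sub>R D) \<le> expectation (\<lambda>w. norm (?d w))"
      unfolding eq by (rule integral_norm_bound)
    also have "\<dots> \<le> expectation (\<lambda>w. (s - t)\<^sup>2 * (G w)\<^sup>2)"
    proof (rule integral_mono)
      show "integrable M (\<lambda>w. norm (?d w))"
        by (intro integrable_norm Bochner_Integration.integrable_diff integrable_mult_right i0
            integrable_mult_iexp G_integrable)
      show "integrable M (\<lambda>w. (s - t)\<^sup>2 * (G w)\<^sup>2)" using G_integrable by simp
      fix w
      define x where "x = (s - t) * G w"
      have e: "iexp (s * G w) = iexp (t * G w) * iexp x"
      proof -
        have "\<i> * complex_of_real (s * G w) = \<i> * complex_of_real (t * G w) + \<i> * complex_of_real x"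
          by (simp add: x_def algebra_simps)
        then show ?thesis by (simp only: exp_add)
      qed
      have "?d w
          = iexp (t * G w) * (iexp x - (\<Sum>k\<le>Suc 0. (\<i> * x) ^ k / fact k))"
      proof -
        have "(\<Sum>k\<le>Suc 0. (\<i> * complex_of_real x) ^ k / fact k) = 1 + \<i> * of_real x"
          by simp
        moreover have "complex_of_real x = (of_real s - of_real t) * of_real (G w)"
          by (simp add: x_def)
        ultimately show ?thesis
          unfolding e by (simp only:) (simp add: algebra_simps)
      qed
      then have "norm (?d w)
          = norm (iexp x - (\<Sum>k\<le>Suc 0. (\<i> * x) ^ k / fact k))"
        by (simp add: norm_mult)
      also have "\<dots> \<le> \<bar>x\<bar> ^ Suc (Suc 0) / fact (Suc (Suc 0))" by (rule iexp_approx1)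
      also have "\<dots> \<le> x\<^sup>2" by (simp add: power2_eq_square)
      also have "\<dots> = (s - t)\<^sup>2 * (G w)\<^sup>2" by (simp add: x_def power_mult_distrib)
      finally show "norm (?d w)
          \<le> (s - t)\<^sup>2 * (G w)\<^sup>2" .
    qed
    finally show ?thesis by (simp add: K_def mult.commute)
  qed
  have "((\<lambda>s. norm (cf s - cf t - (s - t) *\<^sub>R D) / norm (s - t)) \<longlongrightarrow> 0) (at t)"
  proof (rule tendsto_sandwich[where f="\<lambda>_. 0" and h="\<lambda>s. K * \<bar>s - t\<bar>"])
    show "\<forall>\<^sub>F s in at t. norm (cf s - cf t - (s - t) *\<^sub>R D) / norm (s - t) \<le> K * \<bar>s - t\<bar>"
    proof (rule eventually_at_filter[THEN iffD2, OF always_eventually], intro allI impI)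
      fix s assume "s \<noteq> t"
      have "norm (cf s - cf t - (s - t) *\<^sub>R D) / norm (s - t) \<le> (K * (s - t)\<^sup>2) / norm (s - t)"
        by (intro divide_right_mono bound) auto
      also have "\<dots> = K * \<bar>s - t\<bar>"
        using \<open>s \<noteq> t\<close> by (simp add: field_simps power2_eq_square flip: abs_mult)
      finally show "norm (cf s - cf t - (s - t) *\<^sub>R D) / norm (s - t) \<le> K * \<bar>s - t\<bar>" .
    qed
    have "((\<lambda>s. K * \<bar>s - t\<bar>) \<longlongrightarrow> K * \<bar>t - t\<bar>) (at t)" by (intro tendsto_intros)
    then show "((\<lambda>s. K * \<bar>s - t\<bar>) \<longlongrightarrow> 0) (at t)" by simp
  qed auto
  then show ?thesis
    unfolding has_vector_derivative_def has_derivative_iff_norm D_def[symmetric]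
    by (simp add: bounded_linear_scaleR_left)
qed

text \<open>Both sides solve \<open>y' = \<Lambda> y\<close> with value 1 at 0, so their quotient is
  constant. For \<open>cf\<close> the equation follows by writing \<open>G\<close> as a combination
  of the \<open>C i\<close> and inserting the solved integration by parts for each of them.\<close>

lemma cf_eq_exp: "cf t = exp (chaos_log S l (of_real t))"
proof -
  have nz: "1 - 2 * \<i> * complex_of_real a * of_real s \<notin> \<real>\<^sub>\<le>\<^sub>0" for a s
    by (auto simp: complex_nonpos_Reals_iff)
  have nz0: "1 - 2 * \<i> * complex_of_real a * of_real s \<noteq> 0" for a s
    using nz[of a s] by auto
  define \<Lambda> where "\<Lambda> s = (\<Sum>i\<in>S. - 2 * (complex_of_real (l i))\<^sup>2 * of_real s / (1 - 2 * \<i> * l i * s))" for s :: real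
  have logd: "((\<lambda>s. chaos_log S l (of_real s)) has_vector_derivative \<Lambda> s) (at s)" for s
  proof -
    have "(chaos_log S l has_field_derivative \<Lambda> s) (at (of_real s))"
      unfolding chaos_log_def \<Lambda>_def
    proof (rule DERIV_sum)
      fix i assume "i \<in> S"
      show "((\<lambda>z. (- Ln (1 - 2 * \<i> * complex_of_real (l i) * z) - 2 * \<i> * complex_of_real (l i) * z) / 2)
        has_field_derivative - 2 * (complex_of_real (l i))\<^sup>2 * of_real s / (1 - 2 * \<i> * l i * s)) (at (of_real s))"
      proof -
        define a where "a = 2 * \<i> * complex_of_real (l i)"
        have na: "1 - a * of_real s \<notin> \<real>\<^sub>\<le>\<^sub>0" "1 - a * of_real s \<noteq> 0"
          using nz[of "l i" s] nz0[of "l i" s] by (simp_all add: a_def)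
        have a2: "a * a = - 4 * (complex_of_real (l i))\<^sup>2"
          by (simp add: a_def power2_eq_square)
        have "((\<lambda>z. (- Ln (1 - a * z) - a * z) / 2) has_field_derivative (a / (1 - a * of_real s) - a) / 2) (at (of_real s))"
        proof -
          have D: "((\<lambda>z. 1 - a * z) has_field_derivative - a) (at (of_real s))"
            by (auto intro!: derivative_eq_intros)
          have "((\<lambda>z. (- Ln (1 - a * z) - a * z) / 2) has_field_derivative
              (- (inverse (1 - a * of_real s) * - a) - a) / 2) (at (of_real s))"
            by (rule DERIV_cdivide[OF DERIV_diff[OF DERIV_minus[OF
                DERIV_chain2[OF has_field_derivative_Ln[OF na(1)] D]] DERIV_cmult_Id]])
          moreover have "- (inverse (1 - a * of_real s) * - a) = a / (1 - a * of_real s)"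
            by (simp add: field_class.field_divide_inverse)
          ultimately show ?thesis by (simp only:)
        qed
        moreover have "(a / (1 - a * of_real s) - a) / 2 = (a * a) * of_real s / 2 / (1 - a * of_real s)"
          using na(2) by (simp add: field_simps)
        moreover have "(a * a) * of_real s / 2 / (1 - a * of_real s)
            = - 2 * (complex_of_real (l i))\<^sup>2 * of_real s / (1 - 2 * \<i> * l i * s)"
          unfolding a2 by (simp add: a_def)
        ultimately show ?thesis by (simp only: a_def)
      qed
    qed
    then show ?thesis by (rule has_vector_derivative_real_field)
  qed
  have cfd: "(cf has_vector_derivative \<Lambda> s * cf s) (at s)" for s
  proof -
    have iC: "integrable M (\<lambda>w. complex_of_real (C i w) * iexp (s * G w))" if "i \<in> S" for i
      using C_integrable[OF that] by (rule integrable_mult_iexp)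
    have pt: "of_real (G w) * e = (\<Sum>i\<in>S. of_real (l i) * (of_real (C i w) * e))" for w and e :: complex
      unfolding G_def by (simp add: sum_distrib_right mult.assoc)
    have sum: "(CLINT w|M. of_real (G w) * iexp (s * G w))
        = (\<Sum>i\<in>S. of_real (l i) * (CLINT w|M. of_real (C i w) * iexp (s * G w)))"
      unfolding pt using iC by (simp add: Bochner_Integration.integral_sum)
    have "\<i> * (\<Sum>i\<in>S. of_real (l i) * (CLINT w|M. of_real (C i w) * iexp (s * G w))) = \<Lambda> s * cf s"
      unfolding \<Lambda>_def sum_distrib_left sum_distrib_right
    proof (intro sum.cong refl)
      fix i assume i: "i \<in> S"
      have "(CLINT w|M. of_real (C i w) * iexp (s * G w)) = 2 * \<i> * l i * s * cf s / (1 - 2 * \<i> * l i * s)"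
        using iexp_ibp[OF i, of s] nz0[of "l i" s] by (simp add: field_simps)
      moreover have "\<i> * (L * (2 * \<i> * L * x * c / w)) = - 2 * L\<^sup>2 * x / w * c" for L x c w :: complex
      proof -
        have "\<i> * (L * (2 * \<i> * L * x * c / w)) = (\<i> * \<i>) * (2 * L * L * x * c * inverse w)"
          by (simp only: divide_inverse mult_ac)
        then show ?thesis by (simp add: power2_eq_square divide_inverse mult_ac)
      qed
      ultimately show "\<i> * (complex_of_real (l i) * (CLINT w|M. of_real (C i w) * iexp (s * G w)))
          = - 2 * (complex_of_real (l i))\<^sup>2 * of_real s / (1 - 2 * \<i> * l i * s) * cf s"
        by (simp only:)
    qed
    then show ?thesis using cf_deriv[of s] unfolding sum by simp
  qed
  have zero: "((\<lambda>s. exp (- chaos_log S l (of_real s)) * cf s) has_vector_derivative 0) (at s within UNIV)" for s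
  proof -
    have "((\<lambda>s. exp (- chaos_log S l (of_real s))) has_vector_derivative
        (- \<Lambda> s) * exp (- chaos_log S l (of_real s))) (at s)"
      by (rule field_vector_diff_chain_at[OF has_vector_derivative_minus[OF logd] DERIV_exp, unfolded o_def])
    note has_vector_derivative_mult[OF this cfd]
    moreover have "e * (\<Lambda> s * cf s) + (- \<Lambda> s * e) * cf s = 0" for e by (simp add: algebra_simps)
    ultimately show ?thesis by (simp only:)
  qed
  have "\<exists>c. \<forall>s. exp (- chaos_log S l (of_real s)) * cf s = c"
  proof (rule has_vector_derivative_zero_constant[OF convex_UNIV zero])
    fix c assume "\<And>s. s \<in> UNIV \<Longrightarrow> exp (- chaos_log S l (of_real s)) * cf s = c"
    then show "\<exists>c. \<forall>s. exp (- chaos_log S l (of_real s)) * cf s = c" by blast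
  qed
  then obtain c where c: "\<And>s. exp (- chaos_log S l (of_real s)) * cf s = c" by blast
  have "cf 0 = 1" unfolding cf_def by (simp add: prob_space)
  with c[of 0] have "c = 1" by (simp add: chaos_log_def)
  with c[of t] have "exp (- chaos_log S l (of_real t)) * cf t = 1" by simp
  then have "exp (chaos_log S l (of_real t)) * (exp (- chaos_log S l (of_real t)) * cf t)
      = exp (chaos_log S l (of_real t))" by (simp only: mult_1_right)
  then show ?thesis by (simp only: mult.assoc[symmetric] exp_add[symmetric] add.right_inverse exp_zero mult_1_left)
qed

end

lemma Ln_higher_deriv:
  assumes "z \<in> {z. 1 - a * z \<notin> \<real>\<^sub>\<le>\<^sub>0}"
  shows "(deriv ^^ Suc n) (\<lambda>z. - Ln (1 - a * z)) z = fact n * a ^ Suc n / (1 - a * z) ^ Suc n"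
  using assms
proof (induction n arbitrary: z)
  case 0
  then have nz: "1 - a * z \<noteq> 0" by auto
  have "((\<lambda>z. - Ln (1 - a * z)) has_field_derivative a / (1 - a * z)) (at z)"
  proof -
    have D: "((\<lambda>z. 1 - a * z) has_field_derivative - a) (at z)"
      by (auto intro!: derivative_eq_intros)
    have "1 - a * z \<notin> \<real>\<^sub>\<le>\<^sub>0" using 0 by simp
    from DERIV_minus[OF DERIV_chain2[OF has_field_derivative_Ln[OF this] D]]
    show ?thesis by (simp add: field_class.field_divide_inverse mult.commute)
  qed
  then show ?case by (simp add: DERIV_imp_deriv)
next
  case (Suc n)
  have nz: "1 - a * z \<noteq> 0" using Suc.prems by auto
  have op: "open {z. 1 - a * z \<notin> \<real>\<^sub>\<le>\<^sub>0}"
  proof -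
    have "{z. 1 - a * z \<notin> \<real>\<^sub>\<le>\<^sub>0} = (\<lambda>z. 1 - a * z) -` (- \<real>\<^sub>\<le>\<^sub>0)" by auto
    moreover have "open ((\<lambda>z. 1 - a * z) -` (- \<real>\<^sub>\<le>\<^sub>0))"
      by (intro open_vimage continuous_intros) (auto simp: closed_nonpos_Reals_complex)
    ultimately show ?thesis by simp
  qed
  have "(deriv ^^ Suc (Suc n)) (\<lambda>z. - Ln (1 - a * z)) z = deriv ((deriv ^^ Suc n) (\<lambda>z. - Ln (1 - a * z))) z"
    by simp
  \<comment> \<open>Avoiding the branch cut is an open condition, so the induction hypothesis holds
    in a neighbourhood and can be differentiated.\<close>
  also have "\<dots> = deriv (\<lambda>z. fact n * a ^ Suc n / (1 - a * z) ^ Suc n) z"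
    using op Suc.prems Suc.IH
    by (intro deriv_cong_ev refl eventually_mono[OF eventually_nhds_in_open[OF op Suc.prems]]) blast
  also have "\<dots> = fact (Suc n) * a ^ Suc (Suc n) / (1 - a * z) ^ Suc (Suc n)"
  proof (rule DERIV_imp_deriv)
    define w where "w = 1 - a * z"
    have w: "w \<noteq> 0" using nz by (simp add: w_def)
    have P: "((\<lambda>z. (1 - a * z) ^ Suc n) has_field_derivative - (of_nat (Suc n) * a * w ^ n)) (at z)"
      unfolding w_def by (auto intro!: derivative_eq_intros simp del: power_Suc of_nat_Suc)
    have "((\<lambda>z. inverse ((1 - a * z) ^ Suc n)) has_field_derivative
        - (inverse (w ^ Suc n) * - (of_nat (Suc n) * a * w ^ n) * inverse (w ^ Suc n))) (at z)"
      using DERIV_inverse'[OF P] nz by (simp add: w_def)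
    also have "- (inverse (w ^ Suc n) * - (of_nat (Suc n) * a * w ^ n) * inverse (w ^ Suc n))
        = of_nat (Suc n) * a * inverse (w ^ Suc (Suc n))"
      using w by (simp add: divide_simps del: of_nat_Suc)
    finally have "((\<lambda>z. inverse ((1 - a * z) ^ Suc n)) has_field_derivative
        of_nat (Suc n) * a * inverse (w ^ Suc (Suc n))) (at z)" .
    from DERIV_cmult[OF this, of "fact n * a ^ Suc n"]
    show "((\<lambda>z. fact n * a ^ Suc n / (1 - a * z) ^ Suc n) has_field_derivative
      fact (Suc n) * a ^ Suc (Suc n) / (1 - a * z) ^ Suc (Suc n)) (at z)"
      unfolding w_def[symmetric] divide_inverse by (simp add: mult_ac del: of_nat_Suc)
  qed
  finally show ?case .
qed

section \<open>Cumulants\<close>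

text \<open>The subtracted linear term leaves summands of the order of \<open>|l z|^2\<close>, so
  the radius depends only on a bound for the sum of squares; the sum of the \<open>|l i|\<close> may
  be unbounded along the approximations. The condition on \<open>r\<close> keeps each argument of
  \<open>Ln\<close> within 1/2 of 1. The final bound 1 lies below \<pi>, as needed for inverting the
  exponential.\<close>

lemma chaos_log_bounded:
  assumes K: "(\<Sum>i\<in>S. (l i)\<^sup>2) \<le> K" "4 * r\<^sup>2 * K \<le> 1 / 4" and fin: "finite S"
    and z: "z \<in> ball 0 r"
  shows "i \<in> S \<Longrightarrow> norm (2 * \<i> * of_real (l i) * z) \<le> 1 / 2"
    and "norm (chaos_log S l z) \<le> 1"
proof -
  have zr: "norm z < r" using z by simp
  have S: "0 \<le> (\<Sum>i\<in>S. (l i)\<^sup>2)" by (intro sum_nonneg) auto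
  have zl: "4 * (l i)\<^sup>2 * (norm z)\<^sup>2 \<le> 1 / 4" if "i \<in> S" for i
  proof -
    have "(l i)\<^sup>2 \<le> K" using K(1) member_le_sum[OF that, of "\<lambda>i. (l i)\<^sup>2"] fin by auto
    moreover have "(norm z)\<^sup>2 \<le> r\<^sup>2" using zr by (intro power_mono) auto
    ultimately have "(l i)\<^sup>2 * (norm z)\<^sup>2 \<le> K * r\<^sup>2" by (intro mult_mono) (auto intro: order_trans[OF zero_le_power2])
    then show ?thesis using K(2) by (simp add: mult_ac)
  qed
  show half: "norm (2 * \<i> * of_real (l i) * z) \<le> 1 / 2" if "i \<in> S" for i
  proof (rule power2_le_imp_le)
    show "(norm (2 * \<i> * of_real (l i) * z))\<^sup>2 \<le> (1 / 2)\<^sup>2"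
      using zl[OF that] by (simp add: norm_mult power_mult_distrib) (simp add: power2_eq_square)
  qed simp
  have "norm (chaos_log S l z) \<le> (\<Sum>i\<in>S. 4 * (l i)\<^sup>2 * (norm z)\<^sup>2)"
    unfolding chaos_log_def
  proof (rule sum_norm_le)
    fix i assume i: "i \<in> S"
    define w where "w = 2 * \<i> * of_real (l i) * z"
    have w: "norm w \<le> 1 / 2" using half[OF i] by (simp add: w_def)
    have "norm (ln (1 + - w) - - w) \<le> (norm (- w))\<^sup>2 / (1 - norm (- w))"
      using w by (intro Ln_approx_linear) auto
    also have "\<dots> \<le> (norm w)\<^sup>2 / (1 / 2)"
      unfolding norm_minus_cancel using w by (intro divide_left_mono) auto
    finally have "norm (- Ln (1 - w) - w) \<le> 2 * (norm w)\<^sup>2"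
      using norm_minus_cancel[of "Ln (1 - w) + w"] by simp
    moreover have "(norm w)\<^sup>2 = 4 * (l i)\<^sup>2 * (norm z)\<^sup>2"
      by (simp add: w_def norm_mult power_mult_distrib)
    ultimately have "norm ((- Ln (1 - w) - w) / 2) \<le> 4 * (l i)\<^sup>2 * (norm z)\<^sup>2"
      by (simp add: norm_divide)
    then show "norm ((- Ln (1 - 2 * \<i> * of_real (l i) * z) - 2 * \<i> * of_real (l i) * z) / 2) \<le> 4 * (l i)\<^sup>2 * (norm z)\<^sup>2"
      by (simp add: w_def)
  qed
  also have "\<dots> = 4 * (norm z)\<^sup>2 * (\<Sum>i\<in>S. (l i)\<^sup>2)"
    by (simp add: sum_distrib_left mult_ac)
  also have "\<dots> \<le> 4 * r\<^sup>2 * K"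
    using K(1) zr S by (intro mult_mono power_mono) auto
  finally show "norm (chaos_log S l z) \<le> 1" using K(2) by linarith
qed

lemma Re_pos_notin_nonpos: "0 < Re z \<Longrightarrow> z \<notin> \<real>\<^sub>\<le>\<^sub>0"
  by (auto simp: complex_nonpos_Reals_iff)

lemma chaos_log_holomorphic:
  assumes half: "\<And>i z. i \<in> S \<Longrightarrow> z \<in> A \<Longrightarrow> norm (2 * \<i> * of_real (l i) * z) \<le> 1 / 2"
  shows "chaos_log S l holomorphic_on A"
proof -
  have "1 - 2 * \<i> * of_real (l i) * z \<notin> \<real>\<^sub>\<le>\<^sub>0" if "i \<in> S" "z \<in> A" for i z
  proof (rule Re_pos_notin_nonpos)
    have "\<bar>Re (2 * \<i> * of_real (l i) * z)\<bar> \<le> 1 / 2"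
      using half[OF that] abs_Re_le_cmod order_trans by blast
    then show "0 < Re (1 - 2 * \<i> * of_real (l i) * z)" unfolding minus_complex.simps one_complex.simps
      by linarith
  qed
  then show ?thesis unfolding chaos_log_def by (intro holomorphic_intros) auto
qed

text \<open>Orders from 2 on, where the linear term, which only centres the variable, has derivative
  0.\<close>

lemma chaos_log_higher_deriv:
  assumes fin: "finite S"
  shows "(deriv ^^ Suc (Suc n)) (chaos_log S l) 0
    = \<i> ^ Suc (Suc n) * of_real (2 ^ Suc n * fact (Suc n) * (\<Sum>i\<in>S. l i ^ Suc (Suc n)))"
proof -
  define h where "h i z = (- Ln (1 - 2 * \<i> * of_real (l i) * z) - 2 * \<i> * of_real (l i) * z) / 2" for i z
  have h: "(deriv ^^ Suc (Suc n)) (h i) 0 = \<i> ^ Suc (Suc n) * of_real (2 ^ Suc n * fact (Suc n) * l i ^ Suc (Suc n))"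
    and an: "h i analytic_on {0}" for i
  proof -
    define a where "a = 2 * \<i> * complex_of_real (l i)"
    have 1: "(\<lambda>z. - Ln (1 - a * z)) analytic_on {0}"
      by (intro analytic_intros) auto
    have 2: "(\<lambda>z. a * z) analytic_on {0}" by (intro analytic_intros)
    have heq: "h i = (\<lambda>z. (1 / 2) * (- Ln (1 - a * z) - a * z))"
      by (simp add: h_def a_def fun_eq_iff)
    show "h i analytic_on {0}" unfolding heq by (intro analytic_intros 1 2)
    have "(deriv ^^ Suc (Suc n)) (h i) 0 = (1 / 2) * (deriv ^^ Suc (Suc n)) (\<lambda>z. - Ln (1 - a * z) - a * z) 0"
      unfolding heq by (rule higher_deriv_cmult') (intro analytic_intros 1 2)
    also have "(deriv ^^ Suc (Suc n)) (\<lambda>z. - Ln (1 - a * z) - a * z) 0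
        = (deriv ^^ Suc (Suc n)) (\<lambda>z. - Ln (1 - a * z)) 0 - (deriv ^^ Suc (Suc n)) (\<lambda>z. a * z) 0"
      by (rule higher_deriv_diff_at[OF 1 2])
    also have "(deriv ^^ Suc (Suc n)) (\<lambda>z. - Ln (1 - a * z)) 0 = fact (Suc n) * a ^ Suc (Suc n)"
      by (subst Ln_higher_deriv) simp_all
    also have "(deriv ^^ Suc (Suc n)) (\<lambda>z. a * z) 0 = 0"
      by (simp only: higher_deriv_linear) simp
    finally have "(deriv ^^ Suc (Suc n)) (h i) 0 = (1 / 2) * (fact (Suc n) * a ^ Suc (Suc n))" by simp
    also have "\<dots> = \<i> ^ Suc (Suc n) * of_real (2 ^ Suc n * fact (Suc n) * l i ^ Suc (Suc n))"
      unfolding a_def by (simp add: power_mult_distrib)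
    finally show "(deriv ^^ Suc (Suc n)) (h i) 0 = \<i> ^ Suc (Suc n) * of_real (2 ^ Suc n * fact (Suc n) * l i ^ Suc (Suc n))" .
  qed
  have "(deriv ^^ k) (\<lambda>z. \<Sum>i\<in>T. h i z) 0 = (\<Sum>i\<in>T. (deriv ^^ k) (h i) 0)" if "finite T" for T k
    using that
  proof (induction T)
    case (insert i T)
    have "(\<lambda>z. \<Sum>i\<in>T. h i z) analytic_on {0}" by (intro analytic_intros an)
    with insert show ?case by (simp add: higher_deriv_add_at[OF an])
  qed simp
  from this[OF fin, of "Suc (Suc n)"] show ?thesis
    unfolding chaos_log_def h_def[symmetric] h by (simp only: of_real_sum sum_distrib_left of_real_mult)
qed

text \<open>Proved on the whole interval and not just at 0, because each further derivative needs
  the identity in a neighbourhood.\<close>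

lemma iterated_vector_derivative_of_real:
  assumes hol: "F holomorphic_on ball 0 r"
    and eq: "\<And>t. \<bar>t\<bar> < r \<Longrightarrow> g t = F (complex_of_real t)"
  shows "\<bar>t\<bar> < r \<Longrightarrow> ((\<lambda>g t. vector_derivative g (at t)) ^^ m) g t = (deriv ^^ m) F (of_real t)"
proof (induction m arbitrary: t)
  case (Suc m)
  have "(deriv ^^ m) F holomorphic_on ball 0 r" using hol by (intro holomorphic_higher_deriv) auto
  then have "((deriv ^^ m) F has_field_derivative deriv ((deriv ^^ m) F) (of_real t)) (at (of_real t))"
    using Suc.prems by (intro holomorphic_derivI[of _ "ball 0 r"]) auto
  then have "((\<lambda>t. (deriv ^^ m) F (of_real t)) has_vector_derivative deriv ((deriv ^^ m) F) (of_real t)) (at t)"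
    by (rule has_vector_derivative_real_field)
  then have "(((\<lambda>g t. vector_derivative g (at t)) ^^ m) g has_vector_derivative deriv ((deriv ^^ m) F) (of_real t)) (at t)"
  proof (rule has_vector_derivative_transform_within_open)
    show "open {-r<..<r}" by simp
    show "t \<in> {-r<..<r}" using Suc.prems by auto
    fix y assume "y \<in> {-r<..<r}"
    then show "(deriv ^^ m) F (of_real y) = ((\<lambda>g t. vector_derivative g (at t)) ^^ m) g y"
      using Suc.IH[of y] by auto
  qed
  then show ?case by (simp add: vector_derivative_at)
qed (use eq in simp)

text \<open>Since \<open>|Im F| \<le> 1 < \<pi>\<close>, the principal logarithm recovers
  \<open>F\<close> from \<open>exp F\<close>.\<close>

lemma cumulant_eq_higher_deriv:
  assumes r: "0 < r" and hol: "F holomorphic_on ball 0 r"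
    and bd: "\<And>z. z \<in> ball 0 r \<Longrightarrow> norm (F z) \<le> 1"
    and cf: "\<And>t. \<bar>t\<bar> < r \<Longrightarrow> char (distr M borel Y) t = exp (F (of_real t))"
  shows "cumulant M Y m = Re ((- \<i>) ^ m * (deriv ^^ m) F 0)"
proof -
  have Ln: "Ln (char (distr M borel Y) t) = F (of_real t)" if "\<bar>t\<bar> < r" for t
  proof -
    have "norm (F (of_real t)) \<le> 1" using that by (intro bd) auto
    then have "\<bar>Im (F (of_real t))\<bar> \<le> 1" using abs_Im_le_cmod order_trans by blast
    then show ?thesis unfolding cf[OF that] using pi_gt3 by (intro Ln_exp) auto
  qed
  show ?thesis unfolding cumulant_def
    using iterated_vector_derivative_of_real[OF hol Ln, of 0 m] r by simp
qed

text \<open>Pointwise convergence at real \<open>t\<close> does not control derivatives at 0; a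
  common bound on a complex disc does. The limit \<open>g\<close> is identified through
  \<open>exp g\<close> as the logarithm of the characteristic function of \<open>Y\<close>, and a
  subsequence suffices for passing to the limit in an inequality.\<close>

lemma cumulant_limit:
  fixes F :: "nat \<Rightarrow> complex \<Rightarrow> complex"
  assumes r: "0 < r" and hol: "\<And>n. F n holomorphic_on ball 0 r"
    and bd: "\<And>n z. z \<in> ball 0 r \<Longrightarrow> norm (F n z) \<le> 1"
    and cf: "\<And>t. \<bar>t\<bar> < r \<Longrightarrow> (\<lambda>n. exp (F n (of_real t))) \<longlonglongrightarrow> char (distr M borel Y) t"
  obtains s :: "nat \<Rightarrow> nat" where "strict_mono s"
    "\<And>m. (\<lambda>n. Re ((- \<i>) ^ m * (deriv ^^ m) (F (s n)) 0)) \<longlonglongrightarrow> cumulant M Y m"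
proof -
  obtain g s where g: "g holomorphic_on ball 0 r" and s: "strict_mono (s :: nat \<Rightarrow> nat)"
    and lim: "\<And>x. x \<in> ball 0 r \<Longrightarrow> (\<lambda>n. F (s n) x) \<longlonglongrightarrow> g x"
    and unif: "\<And>K. compact K \<Longrightarrow> K \<subseteq> ball 0 r \<Longrightarrow> uniform_limit K (F \<circ> s) g sequentially"
  proof (rule Montel[of "ball 0 r" "range F" F])
    show "\<exists>B. \<forall>h\<in>range F. \<forall>z\<in>K. norm (h z) \<le> B" if "compact K" "K \<subseteq> ball 0 r" for K
      using bd that by (intro exI[of _ 1]) auto
  qed (use hol in auto)
  have gb: "norm (g z) \<le> 1" if "z \<in> ball 0 r" for z
    by (rule tendsto_upperbound[OF tendsto_norm[OF lim[OF that]]]) (use bd that in auto)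
  have gcf: "char (distr M borel Y) t = exp (g (of_real t))" if "\<bar>t\<bar> < r" for t
  proof (rule LIMSEQ_unique)
    show "(\<lambda>n. exp (F (s n) (of_real t))) \<longlonglongrightarrow> char (distr M borel Y) t"
      using LIMSEQ_subseq_LIMSEQ[OF cf[OF that] s] by (simp add: o_def)
    show "(\<lambda>n. exp (F (s n) (of_real t))) \<longlonglongrightarrow> exp (g (of_real t))"
      using that by (intro tendsto_exp lim) auto
  qed
  \<comment> \<open>Half the radius, since local uniform convergence is uniform on compact subsets
    only.\<close>
  have "uniform_limit (cball 0 (r / 2)) (F \<circ> s) g sequentially"
    using r by (intro unif) auto
  then have "uniform_limit (ball 0 (r / 2)) (F \<circ> s) g sequentially"
    by (rule uniform_limit_on_subset) auto
  then have D: "(\<lambda>n. (deriv ^^ m) ((F \<circ> s) n) 0) \<longlonglongrightarrow> (deriv ^^ m) g 0" for m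
  proof (rule higher_deriv_complex_uniform_limit)
    show "\<forall>\<^sub>F n in sequentially. (F \<circ> s) n holomorphic_on ball 0 (r / 2)"
      using r by (intro always_eventually allI) (auto intro: holomorphic_on_subset[OF hol])
  qed (use r in auto)
  have cum: "cumulant M Y m = Re ((- \<i>) ^ m * (deriv ^^ m) g 0)" for m
    using r g gb gcf by (rule cumulant_eq_higher_deriv)
  show ?thesis
  proof (rule that[OF s])
    show "(\<lambda>n. Re ((- \<i>) ^ m * (deriv ^^ m) (F (s n)) 0)) \<longlonglongrightarrow> cumulant M Y m" for m
      unfolding cum using D[of m] by (intro tendsto_intros) simp
  qed
qed

section \<open>Diagonalisation of symmetric tensors\<close>

lemma span_orthonormal_expansion:
  fixes B :: "'h::real_inner set"
  assumes fin: "finite B" and orth: "pairwise orthogonal B" and unit: "\<And>b. b \<in> B \<Longrightarrow> norm b = 1"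
    and x: "x \<in> span B"
  shows "x = (\<Sum>b\<in>B. (x \<bullet> b) *\<^sub>R b)"
proof -
  obtain t where t: "x = (\<Sum>b\<in>B. t b *\<^sub>R b)"
    using x fin by (auto simp: span_finite)
  have "x \<bullet> c = t c" if c: "c \<in> B" for c
  proof -
    have "x \<bullet> c = (\<Sum>b\<in>B. t b * (b \<bullet> c))" by (simp add: t inner_sum_left)
    also have "\<dots> = (\<Sum>b\<in>B. if b = c then t c else 0)"
      using orth unit[OF c] c by (intro sum.cong refl)
        (auto simp: pairwise_def orthogonal_def dot_square_norm)
    finally show ?thesis using fin c by simp
  qed
  then show ?thesis using t by simp
qed

lemma orthonormal_basis_span:
  fixes C :: "'h::real_inner set"
  assumes "finite C"
  obtains B where "finite B" "card B \<le> card C" "span B = span C" "pairwise orthogonal B"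
    "\<And>b. b \<in> B \<Longrightarrow> norm b = 1"
proof -
  obtain D where D: "finite D" "card D \<le> card C" "span D = span C" "pairwise orthogonal D"
    using basis_orthogonal[OF assms] by blast
  define B where "B = (\<lambda>x. x /\<^sub>R norm x) ` (D - {0})"
  have n: "norm b = 1" if "b \<in> B" for b
  proof -
    from that have "\<exists>x\<in>D - {0}. b = x /\<^sub>R norm x" unfolding B_def image_iff .
    then obtain x where x: "x \<noteq> 0" "b = x /\<^sub>R norm x" by auto
    then show ?thesis by (simp add: left_inverse)
  qed
  show thesis
  proof (rule that[of B])
    show "finite B" using D by (simp add: B_def)
    have "card B \<le> card (D - {0})" unfolding B_def using D by (intro card_image_le) auto
    also have "\<dots> \<le> card D" using D by (intro card_mono) auto
    finally show "card B \<le> card C" using D by simp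
    have "span B = span (D - {0})"
    proof
      show "span B \<subseteq> span (D - {0})"
        by (intro span_minimal subspace_span) (auto simp: B_def intro: span_scale span_base)
      show "span (D - {0}) \<subseteq> span B"
      proof (intro span_minimal subspace_span subsetI)
        fix x assume x: "x \<in> D - {0}"
        then have "norm x *\<^sub>R (x /\<^sub>R norm x) \<in> span B"
          by (intro span_scale span_base) (auto simp: B_def)
        then show "x \<in> span B" using x by simp
      qed
    qed
    then show "span B = span C" using D by (simp add: span_delete_0)
    show "pairwise orthogonal B"
      using D(4) by (auto simp: B_def pairwise_def orthogonal_def)
  qed (rule n)
qed

text \<open>The ambient space may have infinite dimension, so compactness is carried over from a
  cube, one coordinate at a time; the unit sphere of a finite span is a closed part of such a
  set.\<close>

lemma compact_orthonormal_box:
  fixes B :: "'h::real_inner set"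
  assumes "finite B"
  shows "compact {\<Sum>b\<in>B. t b *\<^sub>R b |t. \<forall>b\<in>B. \<bar>t b\<bar> \<le> (1::real)}"
  using assms
proof (induction B)
  case (insert a B)
  let ?P = "{\<Sum>b\<in>B. t b *\<^sub>R b |t. \<forall>b\<in>B. \<bar>t b\<bar> \<le> (1::real)}"
  have "{\<Sum>b\<in>insert a B. t b *\<^sub>R b |t. \<forall>b\<in>insert a B. \<bar>t b\<bar> \<le> (1::real)}
      = (\<lambda>(s, y). s *\<^sub>R a + y) ` ({-1..1} \<times> ?P)" (is "?L = ?R")
  proof (intro equalityI subsetI)
    fix x assume "x \<in> ?L"
    then obtain t where t: "x = (\<Sum>b\<in>insert a B. t b *\<^sub>R b)" "\<forall>b\<in>insert a B. \<bar>t b\<bar> \<le> 1" by blast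
    have "x = (\<lambda>(s, y). s *\<^sub>R a + y) (t a, \<Sum>b\<in>B. t b *\<^sub>R b)" using t(1) insert by simp
    moreover have "(t a, \<Sum>b\<in>B. t b *\<^sub>R b) \<in> {-1..1} \<times> ?P" using t(2) by auto
    ultimately show "x \<in> ?R" by blast
  next
    fix x assume "x \<in> ?R"
    then obtain s t where t: "x = s *\<^sub>R a + (\<Sum>b\<in>B. t b *\<^sub>R b)" "\<bar>s\<bar> \<le> 1" "\<forall>b\<in>B. \<bar>t b\<bar> \<le> 1" by auto
    have "(\<Sum>b\<in>insert a B. (t(a := s)) b *\<^sub>R b) = s *\<^sub>R a + (\<Sum>b\<in>B. (t(a := s)) b *\<^sub>R b)"
      using insert by simp
    also have "(\<Sum>b\<in>B. (t(a := s)) b *\<^sub>R b) = (\<Sum>b\<in>B. t b *\<^sub>R b)"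
      using insert by (intro sum.cong) auto
    finally have "x = (\<Sum>b\<in>insert a B. (t(a := s)) b *\<^sub>R b)" using t by simp
    moreover have "\<forall>b\<in>insert a B. \<bar>(t(a := s)) b\<bar> \<le> 1" using t by auto
    ultimately show "x \<in> ?L" by blast
  qed
  moreover have "compact ?R"
    by (intro compact_continuous_image compact_Times insert.IH compact_Icc)
       (auto simp: case_prod_unfold intro!: continuous_intros)
  ultimately show ?case by simp
qed simp

lemma compact_span_sphere:
  fixes C :: "'h::real_inner set"
  assumes "finite C"
  shows "compact {x \<in> span C. norm x = 1}"
proof -
  obtain B where B: "finite B" "span B = span C" "pairwise orthogonal B" "\<And>b. b \<in> B \<Longrightarrow> norm b = 1"
    using orthonormal_basis_span[OF assms] by metis
  let ?P = "{\<Sum>b\<in>B. t b *\<^sub>R b |t. \<forall>b\<in>B. \<bar>t b\<bar> \<le> (1::real)}"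
  have "{x \<in> span C. norm x = 1} = ?P \<inter> sphere 0 1"
  proof (intro equalityI subsetI)
    fix x assume x: "x \<in> {x \<in> span C. norm x = 1}"
    then have "x = (\<Sum>b\<in>B. (x \<bullet> b) *\<^sub>R b)" using B by (intro span_orthonormal_expansion) auto
    moreover have "\<forall>b\<in>B. \<bar>x \<bullet> b\<bar> \<le> 1"
    proof
      fix b assume "b \<in> B"
      then show "\<bar>x \<bullet> b\<bar> \<le> 1" using x B(4)[of b] Cauchy_Schwarz_ineq2[of x b] by simp
    qed
    ultimately show "x \<in> ?P \<inter> sphere 0 1" using x by auto
  next
    fix x assume "x \<in> ?P \<inter> sphere 0 1"
    then show "x \<in> {x \<in> span C. norm x = 1}"
      unfolding B(2)[symmetric] by (auto intro!: span_sum intro: span_scale span_base)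
  qed
  moreover have "compact (?P \<inter> sphere 0 1)"
  proof (rule compact_Int_closed[OF compact_orthonormal_box[OF B(1)]])
    have "closed {x::'h. norm x = 1}" by (intro closed_Collect_eq continuous_intros)
    then show "closed (sphere (0::'h) 1)" by (simp add: sphere_def)
  qed
  ultimately show ?thesis by simp
qed

lemma quadratic_nonpos_imp_linear_zero:
  fixes m k :: real
  assumes "\<And>t. t * m + t\<^sup>2 * k \<le> 0"
  shows "m = 0"
proof (rule ccontr)
  assume m: "m \<noteq> 0"
  \<comment> \<open>At this point the expression equals
    \<open>m^2 (|k| + 1 + k) / (|k| + 1)^2\<close>, which is positive for either sign of
    \<open>k\<close> and for \<open>k = 0\<close>.\<close>
  define t where "t = m / (\<bar>k\<bar> + 1)"
  have pos: "\<bar>k\<bar> + 1 > 0" by simp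
  have "t * m + t\<^sup>2 * k = (m\<^sup>2 / (\<bar>k\<bar> + 1)\<^sup>2) * (\<bar>k\<bar> + 1 + k)"
    using pos by (simp add: t_def power2_eq_square divide_simps) (simp add: algebra_simps)
  also have "\<dots> > 0" using m pos by (intro mult_pos_pos divide_pos_pos) auto
  finally show False using assms[of t] by simp
qed

section \<open>Spectral decomposition of symmetric tensors of finite rank\<close>

context
  fixes tensor :: "'h::{real_inner, polish_space} \<Rightarrow> 'h \<Rightarrow> 't::{real_inner, complete_space}"
  assumes ts: "hilbert_tensor_square tensor"
begin

lemma tensor_bilinear: "bilinear tensor"
  using ts by (simp add: hilbert_tensor_square_def)

lemma tensor_inner: "tensor a b \<bullet> tensor c d = (a \<bullet> c) * (b \<bullet> d)"
  using ts by (simp add: hilbert_tensor_square_def)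

lemmas tensor_simps = bilinear_ladd[OF tensor_bilinear] bilinear_radd[OF tensor_bilinear]
  bilinear_lmul[OF tensor_bilinear] bilinear_rmul[OF tensor_bilinear]
  bilinear_lzero[OF tensor_bilinear] bilinear_rzero[OF tensor_bilinear]

lemma norm_tensor: "norm (tensor a b) = norm a * norm b"
  by (simp add: norm_eq_sqrt_inner tensor_inner real_sqrt_mult)

lemma bounded_bilinear_tensor: "bounded_bilinear tensor"
  by unfold_locales (auto simp: tensor_simps norm_tensor intro!: exI[of _ 1])

text \<open>The generators range over \<open>span C\<close> and not over \<open>C\<close>, so that
  the set depends on the span alone and projected vectors can be inserted directly.\<close>

definition symspan :: "'h set \<Rightarrow> 't set" where
  "symspan C = span {tensor a b + tensor b a |a b. a \<in> span C \<and> b \<in> span C}"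

lemma symspan_induct[consumes 1, case_names gen zero add scale]:
  assumes "f \<in> symspan C"
    and "\<And>a b. a \<in> span C \<Longrightarrow> b \<in> span C \<Longrightarrow> P (tensor a b + tensor b a)"
    and "P 0" "\<And>f g. P f \<Longrightarrow> P g \<Longrightarrow> P (f + g)" "\<And>c f. P f \<Longrightarrow> P (c *\<^sub>R f)"
  shows "P f"
proof -
  have "subspace {f. P f}" using assms by (simp add: subspace_def)
  then have "f \<in> {f. P f}"
    using assms(1) unfolding symspan_def
    by (rule_tac span_induct[where P="\<lambda>f. f \<in> {f. P f}"]) (use assms(2) in auto)
  then show ?thesis by simp
qed

text \<open>The vector \<open>u\<close> maximises the quadratic form of \<open>f\<close> on the unit sphere of \<open>span C\<close>; the first-order
  condition kills the mixed terms of \<open>f\<close>.\<close>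

lemma symspan_diagonal_step:
  assumes C: "finite C" and f: "f \<in> symspan C" and nz: "\<exists>x\<in>span C. x \<noteq> 0"
  obtains u \<mu> C' f' where "u \<in> span C" "norm u = 1" "finite C'" "card C' < card C" "span C' \<subseteq> span C"
    "\<And>x. x \<in> span C' \<Longrightarrow> x \<bullet> u = 0" "f' \<in> symspan C'" "f = \<mu> *\<^sub>R tensor u u + f'"
proof -
  obtain B where B: "finite B" "card B \<le> card C" "span B = span C" "pairwise orthogonal B"
      "\<And>b. b \<in> B \<Longrightarrow> norm b = 1"
    using orthonormal_basis_span[OF C] by metis
  define q where "q x = f \<bullet> tensor x x" for x
  have cont: "continuous_on A q" for A
    unfolding q_def
    by (intro continuous_intros bounded_bilinear.continuous_on[OF bounded_bilinear_tensor])
  obtain x0 where x0: "x0 \<in> span C" "x0 \<noteq> 0" using nz by blast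
  have "x0 /\<^sub>R norm x0 \<in> {x \<in> span C. norm x = 1}" using x0 by (auto intro: span_scale)
  then obtain u where u: "u \<in> span C" "norm u = 1" and max: "\<And>x. x \<in> span C \<Longrightarrow> norm x = 1 \<Longrightarrow> q x \<le> q u"
    using continuous_attains_sup[OF compact_span_sphere[OF C] _ cont] by blast
  have uu: "u \<bullet> u = 1" using u by (simp add: dot_square_norm)
  \<comment> \<open>Homogeneity of degree 2 extends the maximality of \<open>u\<close> from the unit
    sphere to the whole span.\<close>
  have qle: "q x \<le> q u * (x \<bullet> x)" if x: "x \<in> span C" for x
  proof (cases "x = 0")
    case False
    define y where "y = x /\<^sub>R norm x"
    have "q y \<le> q u" using x False by (intro max) (auto simp: y_def intro: span_scale)
    moreover have "x = norm x *\<^sub>R y" using False by (simp add: y_def)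
    then have "q x = (norm x)\<^sup>2 * q y"
      unfolding q_def by (metis (no_types) tensor_simps(3,4) inner_scaleR_right power2_eq_square mult.assoc)
    ultimately show ?thesis
      using mult_left_mono[of "q y" "q u" "(norm x)\<^sup>2"] by (simp add: dot_square_norm mult.commute)
  qed (simp add: q_def tensor_simps)
  \<comment> \<open>Perturbing \<open>u\<close> to \<open>u + t *\<^sub>R w\<close> gives a
    quadratic inequality valid for all \<open>t\<close>; its linear coefficient must vanish.\<close>
  have crit: "f \<bullet> (tensor u w + tensor w u) = 0" if w: "w \<in> span C" "w \<bullet> u = 0" for w
  proof (rule quadratic_nonpos_imp_linear_zero)
    fix t
    have "q (u + t *\<^sub>R w) \<le> q u * ((u + t *\<^sub>R w) \<bullet> (u + t *\<^sub>R w))"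
      using u w by (intro qle span_add span_scale)
    moreover have "q (u + t *\<^sub>R w) = q u + t * (f \<bullet> (tensor u w + tensor w u)) + t\<^sup>2 * q w"
      unfolding q_def by (simp add: tensor_simps inner_add_right power2_eq_square algebra_simps)
    moreover have "(u + t *\<^sub>R w) \<bullet> (u + t *\<^sub>R w) = 1 + t\<^sup>2 * (w \<bullet> w)"
      using w uu by (simp add: inner_add_left inner_add_right inner_commute power2_eq_square)
    ultimately have "q u + t * (f \<bullet> (tensor u w + tensor w u)) + t\<^sup>2 * q w \<le> q u * (1 + t\<^sup>2 * (w \<bullet> w))"
      by simp
    then show "t * (f \<bullet> (tensor u w + tensor w u)) + t\<^sup>2 * (q w - q u * (w \<bullet> w)) \<le> 0"
      by (simp add: algebra_simps)
  qed
  \<comment> \<open>An exchange argument: \<open>b0\<close> has a component along \<open>u\<close>,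
    so \<open>u\<close> can replace it in the spanning set, and projecting the other vectors away
    from \<open>u\<close> leaves fewer generators.\<close>
  obtain b0 where b0: "b0 \<in> B" "u \<bullet> b0 \<noteq> 0"
  proof -
    have "u = (\<Sum>b\<in>B. (u \<bullet> b) *\<^sub>R b)"
      using B u by (intro span_orthonormal_expansion) auto
    then have "\<exists>b\<in>B. u \<bullet> b \<noteq> 0"
      using u(2) by (metis (no_types, lifting) norm_zero scaleR_zero_left sum.neutral zero_neq_one)
    then show ?thesis using that by blast
  qed
  have unot: "u \<notin> span (B - {b0})"
  proof
    assume "u \<in> span (B - {b0})"
    moreover have "orthogonal b0 x" if "x \<in> B - {b0}" for x
      using that B(4) b0 by (auto simp: pairwise_def)
    ultimately have "orthogonal b0 u" by (metis orthogonal_to_span)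
    then show False using b0 by (simp add: orthogonal_def inner_commute)
  qed
  have "u \<in> span (insert b0 (B - {b0}))" using u B(3) b0 by (simp add: insert_absorb)
  from in_span_insert[OF this unot] have b0s: "b0 \<in> span (insert u (B - {b0}))" .
  define p where "p x = x - (x \<bullet> u) *\<^sub>R u" for x
  have lin: "linear p" unfolding p_def
    by (rule linearI) (auto simp: inner_add_left algebra_simps)
  define C' where "C' = p ` (B - {b0})"
  have pC: "p x \<in> span C'" if "x \<in> span C" for x
  proof -
    have "span C \<subseteq> span (insert u (B - {b0}))"
      unfolding B(3)[symmetric]
    proof (intro span_minimal subspace_span subsetI)
      fix b assume "b \<in> B"
      then show "b \<in> span (insert u (B - {b0}))" using b0s by (cases "b = b0") (auto intro: span_base)
    qed
    with that have "p x \<in> p ` span (insert u (B - {b0}))" by blast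
    also have "\<dots> = span (p ` insert u (B - {b0}))" by (rule span_linear_image[OF lin, symmetric])
    also have "p ` insert u (B - {b0}) = insert 0 C'" using uu by (simp add: C'_def p_def)
    finally show ?thesis by (simp add: span_insert_0)
  qed
  have sub: "span C' \<subseteq> span C"
  proof (intro span_minimal subspace_span subsetI)
    fix x assume "x \<in> C'"
    then obtain b where "b \<in> B" "x = p b" by (auto simp: C'_def)
    then show "x \<in> span C"
      unfolding p_def using B(3) u(1) span_base[of b B] by (auto intro: span_diff span_scale)
  qed
  have perp: "x \<bullet> u = 0" if "x \<in> span C'" for x
  proof -
    have "span C' = p ` span (B - {b0})" unfolding C'_def by (rule span_linear_image[OF lin])
    with that obtain y where "x = p y" by blast
    then show ?thesis using uu by (simp add: p_def inner_diff_left)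
  qed
  have card: "card C' < card C"
  proof -
    have "card C' \<le> card (B - {b0})" unfolding C'_def using B by (intro card_image_le) auto
    also have "\<dots> < card B" using B b0 by (intro psubset_card_mono) auto
    finally show ?thesis using B by simp
  qed
  \<comment> \<open>Splitting each vector into its component along \<open>u\<close> and its
    projection produces a multiple of \<open>tensor u u\<close>, a mixed term and a tensor over
    \<open>C'\<close>. This shape is closed under linear combinations, hence the induction.\<close>
  have "\<exists>\<mu> v f'. v \<in> span C' \<and> f' \<in> symspan C' \<and> f = \<mu> *\<^sub>R tensor u u + (tensor u v + tensor v u) + f'"
    using f
  proof (induction rule: symspan_induct)
    case (gen a b)
    define \<alpha> where "\<alpha> = a \<bullet> u"
    define \<beta> where "\<beta> = b \<bullet> u"
    have a: "a = \<alpha> *\<^sub>R u + p a" and b: "b = \<beta> *\<^sub>R u + p b" by (simp_all add: p_def \<alpha>_def \<beta>_def)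
    define v where "v = \<alpha> *\<^sub>R p b + \<beta> *\<^sub>R p a"
    have "tensor a b + tensor b a = (\<alpha> * \<beta> + \<beta> * \<alpha>) *\<^sub>R tensor u u + (tensor u v + tensor v u)
        + (tensor (p a) (p b) + tensor (p b) (p a))"
      by (subst (1 2) a, subst (1 2) b)
         (simp add: tensor_simps v_def scaleR_add_right scaleR_add_left mult.commute add_ac,
           simp flip: scaleR_add_left)
    moreover have "v \<in> span C'" unfolding v_def using gen by (intro span_add span_scale pC)
    moreover have "tensor (p a) (p b) + tensor (p b) (p a) \<in> symspan C'"
      unfolding symspan_def using pC[OF gen(1)] pC[OF gen(2)] by (intro span_base) blast
    ultimately show ?case
      by (intro exI[of _ "\<alpha> * \<beta> + \<beta> * \<alpha>"] exI[of _ "v"] exI[of _ "tensor (p a) (p b) + tensor (p b) (p a)"] conjI)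
  next
    case zero
    have "0 \<in> span C'" "0 \<in> symspan C'" by (auto simp: symspan_def span_zero)
    moreover have "0 = 0 *\<^sub>R tensor u u + (tensor u 0 + tensor 0 u) + 0" by (simp add: tensor_simps)
    ultimately show ?case
      by (intro exI[of _ "0"] exI[of _ "0"] exI[of _ "0"] conjI)
  next
    case (add f g)
    then obtain \<mu> v f' \<mu>2 v2 f2 where *: "v \<in> span C'" "f' \<in> symspan C'" "f = \<mu> *\<^sub>R tensor u u + (tensor u v + tensor v u) + f'"
      "v2 \<in> span C'" "f2 \<in> symspan C'" "g = \<mu>2 *\<^sub>R tensor u u + (tensor u v2 + tensor v2 u) + f2" by blast
    have "v + v2 \<in> span C'" "f' + f2 \<in> symspan C'" using * by (auto simp: symspan_def intro: span_add)
    moreover have "f + g = (\<mu> + \<mu>2) *\<^sub>R tensor u u + (tensor u (v + v2) + tensor (v + v2) u) + (f' + f2)"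
      unfolding *(3,6) by (simp add: tensor_simps algebra_simps)
    ultimately show ?case
      by (intro exI[of _ "\<mu> + \<mu>2"] exI[of _ "v + v2"] exI[of _ "f' + f2"] conjI)
  next
    case (scale c f)
    then obtain \<mu> v f' where *: "v \<in> span C'" "f' \<in> symspan C'" "f = \<mu> *\<^sub>R tensor u u + (tensor u v + tensor v u) + f'"
      by blast
    have "c *\<^sub>R v \<in> span C'" "c *\<^sub>R f' \<in> symspan C'" using * by (auto simp: symspan_def intro: span_scale)
    moreover have "c *\<^sub>R f = (c * \<mu>) *\<^sub>R tensor u u + (tensor u (c *\<^sub>R v) + tensor (c *\<^sub>R v) u) + c *\<^sub>R f'"
      unfolding *(3) by (simp add: tensor_simps algebra_simps)
    ultimately show ?case
      by (intro exI[of _ "c * \<mu>"] exI[of _ "c *\<^sub>R v"] exI[of _ "c *\<^sub>R f'"] conjI)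
  qed
  then obtain \<mu> v f' where v: "v \<in> span C'" and f': "f' \<in> symspan C'"
    and feq: "f = \<mu> *\<^sub>R tensor u u + (tensor u v + tensor v u) + f'" by blast
  have vu: "v \<bullet> u = 0" "u \<bullet> v = 0" using perp[OF v] by (simp_all add: inner_commute)
  have f'perp: "f' \<bullet> (tensor u v + tensor v u) = 0"
    using f'
  proof (induction rule: symspan_induct)
    case (gen a b)
    then show ?case using perp[of a] perp[of b] by (simp add: inner_add_left inner_add_right tensor_inner)
  qed (auto simp: inner_add_left)
  \<comment> \<open>The mixed term is orthogonal to the other two summands and has squared norm
    \<open>2 * (v \<bullet> v)\<close>, so testing \<open>f\<close> against it isolates
    \<open>v\<close>.\<close>
  have "0 = f \<bullet> (tensor u v + tensor v u)" using crit[of v] v sub vu by auto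
  also have "\<dots> = 2 * (v \<bullet> v)"
    unfolding feq using f'perp vu uu by (simp add: inner_add_left inner_add_right tensor_inner)
  finally have "v = 0" by simp
  then have "f = \<mu> *\<^sub>R tensor u u + f'" using feq by (simp add: tensor_simps)
  with u card sub perp f' show thesis
    using B(1) by (intro that[of u C' f' \<mu>]) (auto simp: C'_def)
qed

text \<open>Maximising vectors are split off one after the other. Each later one lies in a span
  orthogonal to the earlier ones, and the number of generators decreases.\<close>

lemma symspan_diagonal:
  assumes "finite C" "f \<in> symspan C"
  shows "\<exists>U l. finite U \<and> U \<subseteq> span C \<and> pairwise orthogonal U \<and> (\<forall>u\<in>U. norm u = 1)
    \<and> f = (\<Sum>u\<in>U. l u *\<^sub>R tensor u u)"
  using assms
proof (induction "card C" arbitrary: C f rule: less_induct)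
  case less
  show ?case
  proof (cases "\<exists>x\<in>span C. x \<noteq> 0")
    case True
    obtain u \<mu> C' f' where s: "u \<in> span C" "norm u = 1" "finite C'" "card C' < card C" "span C' \<subseteq> span C"
      "\<And>x. x \<in> span C' \<Longrightarrow> x \<bullet> u = 0" "f' \<in> symspan C'" "f = \<mu> *\<^sub>R tensor u u + f'"
      by (rule symspan_diagonal_step[OF less.prems True]) blast
    from less.hyps[OF s(4,3,7)] obtain U l where U: "finite U" "U \<subseteq> span C'" "pairwise orthogonal U"
      "\<forall>u\<in>U. norm u = 1" "f' = (\<Sum>u\<in>U. l u *\<^sub>R tensor u u)" by blast
    have "u \<notin> U" using s(2,6) U(2) by (metis dot_square_norm norm_zero power_zero_numeral subsetD inner_eq_zero_iff zero_neq_one)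
    moreover from this have "(\<Sum>x\<in>U. (l(u := \<mu>)) x *\<^sub>R tensor x x) = f'"
      unfolding U(5) by (intro sum.cong) auto
    ultimately have "f = (\<Sum>x\<in>insert u U. (l(u := \<mu>)) x *\<^sub>R tensor x x)"
      using U(1) s(8) by simp
    moreover have "pairwise orthogonal (insert u U)"
      using U(2,3) s(6) by (auto simp: pairwise_insert orthogonal_def inner_commute)
    ultimately show ?thesis using U s by (intro exI[of _ "insert u U"]) blast
  next
    case False
    have "f = 0" using less.prems(2)
    proof (induction rule: symspan_induct)
      case (gen a b)
      then show ?case using False by (auto simp: tensor_simps)
    qed auto
    then show ?thesis by (intro exI[of _ "{}"]) auto
  qed
qed

text \<open>An element of the algebraic span involves only finitely many vectors; they form the set
  \<open>C\<close> to which the finite-dimensional decomposition applies.\<close>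

lemma sym_tensor_diagonal:
  assumes "f \<in> span {tensor a b + tensor b a |a b. True}"
  shows "\<exists>U l. finite U \<and> pairwise orthogonal U \<and> (\<forall>u\<in>U. norm u = 1)
    \<and> f = (\<Sum>u\<in>U. l u *\<^sub>R tensor u u)"
proof -
  obtain t r where t: "finite t" "t \<subseteq> {tensor a b + tensor b a |a b. True}" "f = (\<Sum>a\<in>t. r a *\<^sub>R a)"
    using assms unfolding span_explicit by blast
  have "\<forall>x\<in>t. \<exists>a b. x = tensor a b + tensor b a" using t(2) by blast
  then obtain a b where ab: "\<And>x. x \<in> t \<Longrightarrow> x = tensor (a x) (b x) + tensor (b x) (a x)" by metis
  define C where "C = a ` t \<union> b ` t"
  have "f \<in> symspan C"
    unfolding t(3) symspan_def
  proof (intro span_sum span_scale span_base)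
    fix x assume x: "x \<in> t"
    have "a x \<in> span C" "b x \<in> span C" using x by (auto simp: C_def intro: span_base)
    with ab[OF x] show "x \<in> {tensor a b + tensor b a |a b. a \<in> span C \<and> b \<in> span C}" by blast
  qed
  moreover have "finite C" using t(1) by (simp add: C_def)
  ultimately show ?thesis using symspan_diagonal[of C f] by blast
qed

text \<open>Supplies the bound on the sum of the squared eigenvalues, and thereby the radius of the
  disc, independently of the number of terms.\<close>

lemma norm_diagonal_tensor:
  assumes "finite U" "pairwise orthogonal U" "\<And>u. u \<in> U \<Longrightarrow> norm u = 1"
  shows "(norm (\<Sum>u\<in>U. l u *\<^sub>R tensor u u))\<^sup>2 = (\<Sum>u\<in>U. (l u)\<^sup>2)"
proof -
  have "(norm (\<Sum>u\<in>U. l u *\<^sub>R tensor u u))\<^sup>2 = (\<Sum>u\<in>U. \<Sum>w\<in>U. l u * l w * (u \<bullet> w)\<^sup>2)"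
    unfolding power2_norm_eq_inner
    by (simp add: inner_sum_left inner_sum_right tensor_inner power2_eq_square sum_distrib_left
        inner_commute mult_ac)
  also have "\<dots> = (\<Sum>u\<in>U. \<Sum>w\<in>U. if u = w then (l u)\<^sup>2 else 0)"
    using assms(2,3)
    by (intro sum.cong refl) (auto simp: pairwise_def orthogonal_def dot_square_norm power2_eq_square)
  also have "\<dots> = (\<Sum>u\<in>U. (l u)\<^sup>2)" using assms(1) by simp
  finally show ?thesis .
qed

lemma diagonal_tensor_in_span:
  "(\<Sum>u\<in>U. l u *\<^sub>R tensor u u) \<in> span {tensor a b + tensor b a |a b. True}"
proof (intro span_sum span_scale)
  fix u
  have "(1 / 2) *\<^sub>R (tensor u u + tensor u u) \<in> span {tensor a b + tensor b a |a b. True}"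
    by (intro span_scale span_base) blast
  moreover have "(1 / 2) *\<^sub>R (tensor u u + tensor u u) = tensor u u" by (simp add: scaleR_2[symmetric])
  ultimately show "tensor u u \<in> span {tensor a b + tensor b a |a b. True}" by simp
qed

lemma diagonal_tensor_in_sym_tensors: "(\<Sum>u\<in>U. l u *\<^sub>R tensor u u) \<in> sym_tensors tensor"
  unfolding sym_tensors_def using diagonal_tensor_in_span closure_subset by blast

end

section \<open>Independence of orthogonal Gaussian variables\<close>

context prob_space
begin

text \<open>Levy's uniqueness theorem for the law of \<open>Z\<close> under the probability measure whose density is
  proportional to \<open>Y + 2\<close>.\<close>

lemma gaussian_factorisation_real:
  fixes Y :: "'a \<Rightarrow> real"
  assumes Z[measurable]: "random_variable borel Z"
    and Zcf: "\<And>s. (CLINT w|M. iexp (s * Z w)) = of_real (exp (- s\<^sup>2 / 2))"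
    and Y[measurable]: "random_variable borel Y" and bY: "\<And>w. \<bar>Y w\<bar> \<le> 1"
    and YZ: "\<And>s. (CLINT w|M. of_real (Y w) * iexp (s * Z w)) = of_real (expectation Y * exp (- s\<^sup>2 / 2))"
    and B[measurable]: "B \<in> sets borel"
  shows "expectation (\<lambda>w. Y w * indicator B (Z w)) = expectation Y * expectation (\<lambda>w. indicator B (Z w))"
proof -
  let ?YB = "expectation (\<lambda>w. Y w * indicator B (Z w))" and ?B = "expectation (\<lambda>w. indicator B (Z w) :: real)"
  have iY: "integrable M Y" by (rule integrable_const_bound[of _ 1]) (use bY in auto)
  \<comment> \<open>As \<open>|Y| \<le> 1\<close>, the shift by 2 makes \<open>Y + 2\<close> at
    least 1, so that the density is positive; the constant part contributes twice the original law
    of \<open>Z\<close> and cancels at the end.\<close>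
  define c where "c = expectation Y + 2"
  have "\<bar>expectation Y\<bar> \<le> expectation (\<lambda>w. \<bar>Y w\<bar>)" by (rule integral_abs_bound)
  also have "\<dots> \<le> expectation (\<lambda>w. 1)" using bY iY by (intro integral_mono) auto
  finally have c: "0 < c" by (simp add: c_def prob_space)
  define k where "k w = (Y w + 2) / c" for w
  have [measurable]: "random_variable borel k" unfolding k_def[abs_def] by measurable
  have k0: "0 \<le> k w" for w using bY[of w] c by (auto simp: k_def intro!: divide_nonneg_nonneg)
  have ik: "integrable M k" unfolding k_def using iY by simp
  have Ek: "expectation k = 1" unfolding k_def using iY c by (simp add: c_def prob_space)
  let ?D = "density M k"
  interpret D: prob_space ?D
  proof
    have "emeasure ?D (space ?D) = (\<integral>\<^sup>+w. k w \<partial>M)" by (simp add: emeasure_density)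
    also have "\<dots> = ennreal (expectation k)" using ik k0 by (intro nn_integral_eq_integral) auto
    finally show "emeasure ?D (space ?D) = 1" by (simp add: Ek)
  qed
  have iZ: "integrable M (\<lambda>w. of_real (X w) * iexp (s * Z w))"
    if "random_variable borel X" "\<And>w. \<bar>X w\<bar> \<le> 1" for X :: "'a \<Rightarrow> real" and s
    by (rule integrable_const_bound[of _ 1]) (use that in \<open>auto simp: norm_mult\<close>)
  have "distr ?D borel Z = distr M borel Z"
  proof (rule Levy_uniqueness)
    show "real_distribution (distr ?D borel Z)" by (rule D.real_distribution_distr) simp
    show "real_distribution (distr M borel Z)" by (rule real_distribution_distr) simp
    show "char (distr ?D borel Z) = char (distr M borel Z)"
    proof
      fix s
      have "char (distr ?D borel Z) s = (CLINT w|?D. iexp (s * Z w))"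
        unfolding char_def by (rule integral_distr) simp_all
      also have "\<dots> = (CLINT w|M. k w *\<^sub>R iexp (s * Z w))"
        by (rule integral_density) (use k0 in auto)
      also have "\<dots> = (CLINT w|M. (of_real (Y w) * iexp (s * Z w) + 2 * (of_real 1 * iexp (s * Z w))) / of_real c)"
        by (rule Bochner_Integration.integral_cong)
           (simp_all add: k_def scaleR_conv_of_real add_divide_distrib distrib_right)
      also have "\<dots> = ((CLINT w|M. of_real (Y w) * iexp (s * Z w)) + 2 * (CLINT w|M. of_real 1 * iexp (s * Z w))) / of_real c"
        using iZ[OF Y bY, of s] iZ[of "\<lambda>_. 1" s] by simp
      also have "\<dots> = of_real ((expectation Y + 2) * exp (- s\<^sup>2 / 2) / c)"
        unfolding YZ using Zcf[of s] by (simp add: distrib_right)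
      also have "\<dots> = of_real (exp (- s\<^sup>2 / 2))" using c by (simp add: c_def)
      also have "\<dots> = char (distr M borel Z) s"
        unfolding Zcf[symmetric] char_def by (rule integral_distr[symmetric]) simp_all
      finally show "char (distr ?D borel Z) s = char (distr M borel Z) s" .
    qed
  qed
  then have "(\<integral>x. indicator B x \<partial>distr ?D borel Z) = (\<integral>x. indicator B x \<partial>distr M borel Z :: real)" by simp
  then have 1: "(\<integral>w. indicator B (Z w) \<partial>?D) = ?B"
    by (subst (asm) (1 2) integral_distr) simp_all
  have 2: "(\<integral>w. indicator B (Z w) \<partial>?D) = expectation (\<lambda>w. k w * indicator B (Z w))"
    using k0 by (subst integral_density) auto
  have iB: "integrable M (\<lambda>w. indicator B (Z w) :: real)"
    by (rule integrable_const_bound[of _ 1]) (auto simp: indicator_def)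
  have iYB: "integrable M (\<lambda>w. Y w * indicator B (Z w))"
    by (rule integrable_const_bound[of _ 1]) (use bY in \<open>auto simp: indicator_def abs_mult\<close>)
  have "expectation (\<lambda>w. k w * indicator B (Z w))
      = expectation (\<lambda>w. (Y w * indicator B (Z w) + 2 * indicator B (Z w)) / c)"
    by (simp add: k_def distrib_right)
  also have "\<dots> = (?YB + 2 * ?B) / c"
    using iB iYB by simp
  finally have "(?YB + 2 * ?B) / c
      = ?B"
    using 1 2 by simp
  then have "?YB + 2 * ?B
      = c * ?B"
    using c by (simp add: divide_eq_eq mult.commute)
  then show ?thesis unfolding c_def by (simp add: distrib_right)
qed

text \<open>The real part of \<open>X\<close> is half the sum of \<open>X\<close> and its conjugate;
  conjugation turns the frequency \<open>s\<close> into \<open>- s\<close>, and the Gaussian factor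
  is even in \<open>s\<close>. The imaginary part of \<open>Y\<close> is the real part of
  \<open>- \<i> * Y\<close>.\<close>

lemma gaussian_factorisation:
  fixes Y :: "'a \<Rightarrow> complex"
  assumes Z[measurable]: "random_variable borel Z"
    and Zcf: "\<And>s. (CLINT w|M. iexp (s * Z w)) = of_real (exp (- s\<^sup>2 / 2))"
    and Y[measurable]: "random_variable borel Y" and bY: "\<And>w. norm (Y w) \<le> 1"
    and YZ: "\<And>s. (CLINT w|M. Y w * iexp (s * Z w)) = expectation Y * of_real (exp (- s\<^sup>2 / 2))"
    and B[measurable]: "B \<in> sets borel"
  shows "(CLINT w|M. Y w * of_real (indicator B (Z w))) = expectation Y * of_real (expectation (\<lambda>w. indicator B (Z w)))"
proof -
  have re: "expectation (\<lambda>w. Re (X w) * indicator B (Z w)) = Re (expectation X) * expectation (\<lambda>w. indicator B (Z w))"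
    if X[measurable]: "random_variable borel X" and bX: "\<And>w. norm (X w) \<le> 1"
      and XZ: "\<And>s. (CLINT w|M. X w * iexp (s * Z w)) = expectation X * of_real (exp (- s\<^sup>2 / 2))"
    for X :: "'a \<Rightarrow> complex"
  proof -
    have iX: "integrable M X" by (rule integrable_const_bound[of _ 1]) (use bX in auto)
    have i: "integrable M (\<lambda>w. X w * iexp (s * Z w))" for s
      by (rule integrable_const_bound[of _ 1]) (use bX in \<open>auto simp: norm_mult\<close>)
    have "expectation (\<lambda>w. Re (X w) * indicator B (Z w)) = expectation (\<lambda>w. Re (X w)) * expectation (\<lambda>w. indicator B (Z w))"
    proof (rule gaussian_factorisation_real[OF Z Zcf _ _ _ B])
      show "\<bar>Re (X w)\<bar> \<le> 1" for w using bX[of w] abs_Re_le_cmod[of "X w"] by linarith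
      fix s
      have "(CLINT w|M. of_real (Re (X w)) * iexp (s * Z w))
          = (CLINT w|M. (X w * iexp (s * Z w) + cnj (X w * iexp ((- s) * Z w))) / 2)"
      proof (rule Bochner_Integration.integral_cong)
        fix w
        have r: "of_real (Re (X w)) = (X w + cnj (X w)) / 2" by (simp add: complex_add_cnj)
        have e: "cnj (iexp ((- s) * Z w)) = iexp (s * Z w)" by (simp add: exp_cnj)
        show "of_real (Re (X w)) * iexp (s * Z w)
            = (X w * iexp (s * Z w) + cnj (X w * iexp ((- s) * Z w))) / 2"
          unfolding r complex_cnj_mult e by (simp only: distrib_right times_divide_eq_left)
      qed simp
      also have "\<dots> = ((CLINT w|M. X w * iexp (s * Z w)) + cnj (CLINT w|M. X w * iexp ((- s) * Z w))) / 2"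
        using Bochner_Integration.integral_add[OF i[of s] integrable_cnj[OF i[of "- s"]]]
        unfolding integral_divide_zero Bochner_Integration.integral_cnj by (simp only:)
      also have "\<dots> = (expectation X + cnj (expectation X)) / 2 * of_real (exp (- s\<^sup>2 / 2))"
        unfolding XZ by (simp add: distrib_right)
      also have "(expectation X + cnj (expectation X)) / 2 = of_real (Re (expectation X))"
        by (simp add: complex_add_cnj)
      finally show "(CLINT w|M. of_real (Re (X w)) * iexp (s * Z w))
          = of_real (expectation (\<lambda>w. Re (X w)) * exp (- s\<^sup>2 / 2))"
        using integral_Re[OF iX] by simp
    qed simp
    then show ?thesis using integral_Re[OF iX] by simp
  qed
  have iY: "integrable M Y" by (rule integrable_const_bound[of _ 1]) (use bY in auto)
  have iYB: "integrable M (\<lambda>w. Y w * of_real (indicator B (Z w)))"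
    by (rule integrable_const_bound[of _ 1]) (use bY in \<open>auto simp: norm_mult indicator_def\<close>)
  have im: "expectation (\<lambda>w. Im (Y w) * indicator B (Z w)) = Im (expectation Y) * expectation (\<lambda>w. indicator B (Z w))"
  proof -
    have "(CLINT w|M. (- \<i> * Y w) * iexp (s * Z w)) = expectation (\<lambda>w. - \<i> * Y w) * of_real (exp (- s\<^sup>2 / 2))" for s
      unfolding mult.assoc integral_mult_right_zero using YZ[of s] by simp
    from re[of "\<lambda>w. - \<i> * Y w", OF _ _ this] bY show ?thesis by (simp add: norm_mult)
  qed
  show ?thesis
  proof (rule complex_eqI)
    show "Re (CLINT w|M. Y w * of_real (indicator B (Z w)))
        = Re (expectation Y * of_real (expectation (\<lambda>w. indicator B (Z w))))"
      using integral_Re[OF iYB] re[OF Y bY YZ] by simp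
    show "Im (CLINT w|M. Y w * of_real (indicator B (Z w)))
        = Im (expectation Y * of_real (expectation (\<lambda>w. indicator B (Z w))))"
      using integral_Im[OF iYB] im by simp
  qed
qed

text \<open>In the joint characteristic function the exponentials are exchanged for indicators one
  index at a time, each exchange being an instance of the Gaussian factorisation. Once all indices
  are exchanged, the formula says that probabilities multiply.\<close>

lemma indep_vars_gaussian_cf:
  fixes Z :: "'i \<Rightarrow> 'a \<Rightarrow> real"
  assumes fin: "finite U" and Z[measurable]: "\<And>u. u \<in> U \<Longrightarrow> random_variable borel (Z u)"
    and cf: "\<And>a. (CLINT w|M. iexp (\<Sum>u\<in>U. a u * Z u w)) = of_real (exp (- (\<Sum>u\<in>U. (a u)\<^sup>2) / 2))"
  shows "indep_vars (\<lambda>_. borel) Z U" "\<And>u. u \<in> U \<Longrightarrow> distributed M lborel (Z u) std_normal_density"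
proof -
  have cf1: "(CLINT w|M. iexp (s * Z u w)) = of_real (exp (- s\<^sup>2 / 2))" if "u \<in> U" for u s
  proof -
    have "(\<Sum>v\<in>U. (if v = u then s else 0) * Z v w) = s * Z u w" for w
      using fin that by (subst sum.remove[of _ u]) auto
    moreover have "(\<Sum>v\<in>U. (if v = u then s else 0)\<^sup>2) = s\<^sup>2"
      using fin that by (subst sum.remove[of _ u]) auto
    ultimately show ?thesis using cf[of "\<lambda>v. if v = u then s else 0"] by simp
  qed
  show "distributed M lborel (Z u) std_normal_density" if u: "u \<in> U" for u
  proof -
    have "distr M borel (Z u) = std_normal_distribution"
    proof (rule Levy_uniqueness)
      show "real_distribution (distr M borel (Z u))" using u by (intro real_distribution_distr) simp
      show "real_distribution std_normal_distribution" by (rule real_dist_normal_dist)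
      show "char (distr M borel (Z u)) = char std_normal_distribution"
      proof
        fix s
        have "char (distr M borel (Z u)) s = (CLINT w|M. iexp (s * Z u w))"
          unfolding char_def using u by (intro integral_distr) simp_all
        then show "char (distr M borel (Z u)) s = char std_normal_distribution s"
          using cf1[OF u, of s] by (simp add: char_std_normal_distribution)
      qed
    qed
    then show ?thesis using u by (simp add: distributed_def cong: distr_cong)
  qed
  have main: "J \<subseteq> U \<Longrightarrow> (CLINT w|M. (\<Prod>j\<in>J. of_real (indicator (B j) (Z j w))) * iexp (\<Sum>u\<in>U - J. a u * Z u w))
      = of_real ((\<Prod>j\<in>J. expectation (\<lambda>w. indicator (B j) (Z j w))) * exp (- (\<Sum>u\<in>U - J. (a u)\<^sup>2) / 2))"
    if B[measurable]: "\<And>j. j \<in> U \<Longrightarrow> B j \<in> sets borel" and "finite J" for J a B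
    using \<open>finite J\<close>
  proof (induction J arbitrary: a)
    case empty
    then show ?case using cf by simp
  next
    case (insert j J)
    let ?s = "\<lambda>w. \<Sum>u\<in>U - insert j J. a u * Z u w" and ?q = "\<Sum>u\<in>U - insert j J. (a u)\<^sup>2"
    have j: "j \<in> U" "j \<notin> J" and JU: "J \<subseteq> U" using insert by auto
    have UJ: "U - J = insert j (U - insert j J)" and jn: "j \<notin> U - insert j J" using j by auto
    have finU: "finite (U - insert j J)" using fin by simp
    \<comment> \<open>All factors other than that of \<open>j\<close>: indicators for the indices
      already exchanged, exponentials for those still to come.\<close>
    define Y where "Y w = (\<Prod>j\<in>J. complex_of_real (indicator (B j) (Z j w))) * iexp (?s w)" for w
    have [measurable]: "\<And>u. u \<in> J \<Longrightarrow> random_variable borel (Z u)" "\<And>u. u \<in> J \<Longrightarrow> B u \<in> sets borel"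
      using JU Z B by auto
    have Ym: "random_variable borel Y" unfolding Y_def by measurable
    have bY: "norm (Y w) \<le> 1" for w
    proof -
      have "norm (\<Prod>j\<in>J. complex_of_real (indicator (B j) (Z j w))) \<le> 1"
        unfolding prod_norm[symmetric] by (intro prod_le_1) (auto simp: indicator_def)
      then show ?thesis by (simp add: Y_def norm_mult)
    qed
    let ?P = "\<Prod>j\<in>J. expectation (\<lambda>w. indicator (B j) (Z j w) :: real)"
    let ?E = "exp (- ?q / 2)"
    have YZ: "(CLINT w|M. Y w * iexp (s * Z j w)) = of_real (?P * ?E * exp (- s\<^sup>2 / 2))" for s
    proof -
      have 1: "(\<Sum>u\<in>U - J. (a(j := s)) u * Z u w) = ?s w + s * Z j w" for w
      proof -
        have "(\<Sum>u\<in>U - J. (a(j := s)) u * Z u w) = s * Z j w + (\<Sum>u\<in>U - insert j J. (a(j := s)) u * Z u w)"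
          unfolding UJ using finU jn by simp
        also have "(\<Sum>u\<in>U - insert j J. (a(j := s)) u * Z u w) = ?s w"
          by (intro sum.cong) auto
        finally show ?thesis by simp
      qed
      have 2: "(\<Sum>u\<in>U - J. ((a(j := s)) u)\<^sup>2) = ?q + s\<^sup>2"
      proof -
        have "(\<Sum>u\<in>U - J. ((a(j := s)) u)\<^sup>2) = s\<^sup>2 + (\<Sum>u\<in>U - insert j J. ((a(j := s)) u)\<^sup>2)"
          unfolding UJ using finU jn by simp
        also have "(\<Sum>u\<in>U - insert j J. ((a(j := s)) u)\<^sup>2) = ?q"
          by (intro sum.cong) auto
        finally show ?thesis by simp
      qed
      have "(CLINT w|M. Y w * iexp (s * Z j w))
          = (CLINT w|M. (\<Prod>j\<in>J. of_real (indicator (B j) (Z j w))) * iexp (\<Sum>u\<in>U - J. (a(j := s)) u * Z u w))"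
        unfolding 1 Y_def by (simp add: exp_add[symmetric] distrib_left mult.assoc)
      also have "\<dots> = of_real (?P * exp (- (\<Sum>u\<in>U - J. ((a(j := s)) u)\<^sup>2) / 2))"
        by (rule insert.IH[OF JU])
      also have "exp (- (\<Sum>u\<in>U - J. ((a(j := s)) u)\<^sup>2) / 2) = ?E * exp (- s\<^sup>2 / 2)"
        unfolding 2 by (simp add: exp_add[symmetric] diff_divide_distrib)
      finally show ?thesis by (simp add: mult.assoc)
    qed
    have EY: "expectation Y = of_real (?P * ?E)" using YZ[of 0] by simp
    have A: "(CLINT w|M. Y w * of_real (indicator (B j) (Z j w)))
        = expectation Y * of_real (expectation (\<lambda>w. indicator (B j) (Z j w)))"
    proof (rule gaussian_factorisation[OF Z[OF j(1)] cf1[OF j(1)] Ym bY _ B[OF j(1)]])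
      show "(CLINT w|M. Y w * iexp (s * Z j w)) = expectation Y * of_real (exp (- s\<^sup>2 / 2))" for s
        unfolding EY YZ by simp
    qed
    have eq: "(\<Prod>i\<in>insert j J. of_real (indicator (B i) (Z i w))) * iexp (?s w)
        = Y w * of_real (indicator (B j) (Z j w))" for w
      unfolding Y_def prod.insert[OF insert.hyps] by (simp only: mult_ac)
    show ?case
      unfolding eq unfolding A EY prod.insert[OF insert.hyps] by (simp only: of_real_mult mult_ac)
  qed
  show "indep_vars (\<lambda>_. borel) Z U"
  proof (cases "U = {}")
    case True
    then show ?thesis unfolding indep_vars_def2 indep_sets_def by auto
  next
    case False
    show ?thesis
    proof (subst indep_vars_finite[where E="\<lambda>_. sets borel"])
      show "\<forall>A\<in>U \<rightarrow> sets borel. prob (\<Inter>j\<in>U. Z j -` A j \<inter> space M) = (\<Prod>j\<in>U. prob (Z j -` A j \<inter> space M))"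
      proof
        fix A :: "'i \<Rightarrow> real set" assume A: "A \<in> U \<rightarrow> sets borel"
        then have A'[measurable]: "\<And>j. j \<in> U \<Longrightarrow> A j \<in> sets borel" by auto
        have ev: "Z j -` A j \<inter> space M \<in> events" if "j \<in> U" for j using that by measurable
        have p: "expectation (\<lambda>w. indicator (A j) (Z j w)) = prob (Z j -` A j \<inter> space M)" if "j \<in> U" for j
        proof -
          have "expectation (\<lambda>w. indicator (A j) (Z j w) :: real) = expectation (indicator (Z j -` A j \<inter> space M))"
            by (rule Bochner_Integration.integral_cong) (auto simp: indicator_def)
          then show ?thesis using ev[OF that] by simp
        qed
        have "(\<Inter>j\<in>U. Z j -` A j \<inter> space M) \<in> events"
          using ev by (intro sets.finite_INT fin False)
        then have "complex_of_real (prob (\<Inter>j\<in>U. Z j -` A j \<inter> space M))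
            = of_real (expectation (indicator (\<Inter>j\<in>U. Z j -` A j \<inter> space M)))"
          by simp
        also have "\<dots> = (CLINT w|M. of_real (indicator (\<Inter>j\<in>U. Z j -` A j \<inter> space M) w))"
          by simp
        also have "\<dots> = (CLINT w|M. (\<Prod>j\<in>U. of_real (indicator (A j) (Z j w))) * iexp (\<Sum>u\<in>U - U. 0 * Z u w))"
        proof (rule Bochner_Integration.integral_cong)
          fix w assume "w \<in> space M"
          then show "of_real (indicator (\<Inter>j\<in>U. Z j -` A j \<inter> space M) w)
              = (\<Prod>j\<in>U. complex_of_real (indicator (A j) (Z j w))) * iexp (\<Sum>u\<in>U - U. 0 * Z u w)"
            using fin False by (auto simp: indicator_def prod_zero_iff)
        qed simp
        also have "\<dots> = of_real (\<Prod>j\<in>U. prob (Z j -` A j \<inter> space M))"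
          using main[OF A' fin order_refl] p by simp
        finally show "prob (\<Inter>j\<in>U. Z j -` A j \<inter> space M) = (\<Prod>j\<in>U. prob (Z j -` A j \<inter> space M))"
          by (simp only: of_real_eq_iff)
      qed
    qed (use False fin Z in \<open>auto simp: Int_stable_def sets.sigma_sets_eq[of borel, simplified]\<close>)
  qed
qed

end

text \<open>The variance appears as a second moment and may be 0, so that degenerate linear
  combinations are covered by the same formula.\<close>

lemma centred_gaussian_cf:
  assumes "prob_space M" and Y: "centred_gaussian M Y"
  shows "integrable M (\<lambda>w. (Y w)\<^sup>2)"
    and "(CLINT w|M. iexp (Y w)) = of_real (exp (- (\<integral>w. (Y w)\<^sup>2 \<partial>M) / 2))"
proof -
  interpret prob_space M by fact
  have [measurable]: "random_variable borel Y" using Y by (simp add: centred_gaussian_def)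
  have "integrable M (\<lambda>w. (Y w)\<^sup>2) \<and> (CLINT w|M. iexp (Y w)) = of_real (exp (- (\<integral>w. (Y w)\<^sup>2 \<partial>M) / 2))"
  proof (cases "AE w in M. Y w = 0")
    case True
    have "integrable M (\<lambda>w. (Y w)\<^sup>2) \<longleftrightarrow> integrable M (\<lambda>w. 0::real)"
      using True by (intro integrable_cong_AE) auto
    moreover have "(\<integral>w. (Y w)\<^sup>2 \<partial>M) = (\<integral>w. 0 \<partial>M)"
      using True by (intro integral_cong_AE) auto
    moreover have "(CLINT w|M. iexp (Y w)) = (CLINT w|M. 1)"
      using True by (intro integral_cong_AE) auto
    ultimately show ?thesis by (simp add: prob_space)
  next
    case False
    with Y obtain \<sigma> where \<sigma>: "0 < \<sigma>" "distributed M lborel Y (normal_density 0 \<sigma>)"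
      by (auto simp: centred_gaussian_def)
    then have "distributed M lborel (\<lambda>w. (Y w - 0) / \<sigma>) std_normal_density"
      using normal_standard_normal_convert[of \<sigma> Y 0] by simp
    then have X: "distr M borel (\<lambda>w. Y w / \<sigma>) = std_normal_distribution"
      by (simp add: distributed_def cong: distr_cong)
    have "integrable (distr M borel (\<lambda>w. Y w / \<sigma>)) (\<lambda>x. x\<^sup>2)"
      unfolding X by (rule integrable_std_normal_distribution_moment)
    then have "integrable M (\<lambda>w. (Y w / \<sigma>)\<^sup>2)" by (subst (asm) integrable_distr_eq) auto
    then have "integrable M (\<lambda>w. \<sigma>\<^sup>2 * (Y w / \<sigma>)\<^sup>2)" by simp
    then have i: "integrable M (\<lambda>w. (Y w)\<^sup>2)" using \<sigma> by (simp add: power_divide)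
    have "(\<integral>w. (Y w / \<sigma>)\<^sup>2 \<partial>M) = (\<integral>x. x\<^sup>2 \<partial>distr M borel (\<lambda>w. Y w / \<sigma>))"
      by (subst integral_distr) auto
    also have "\<dots> = 1" unfolding X using std_normal_distribution_even_moments(1)[of 1] by simp
    finally have v: "(\<integral>w. (Y w)\<^sup>2 \<partial>M) = \<sigma>\<^sup>2" using \<sigma> by (simp add: power_divide)
    have "(CLINT w|M. iexp (Y w)) = char (distr M borel (\<lambda>w. Y w / \<sigma>)) \<sigma>"
      unfolding char_def using \<sigma> by (subst integral_distr) auto
    also have "\<dots> = of_real (exp (- \<sigma>\<^sup>2 / 2))"
      unfolding X by (simp add: char_std_normal_distribution)
    finally show ?thesis using i v by simp
  qed
  then show "integrable M (\<lambda>w. (Y w)\<^sup>2)"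
    "(CLINT w|M. iexp (Y w)) = of_real (exp (- (\<integral>w. (Y w)\<^sup>2 \<partial>M) / 2))" by auto
qed

text \<open>By orthonormality, the Gaussian variable with coefficients \<open>a u\<close> has as
  variance the sum of their squares; hence the joint characteristic function is a product.\<close>

lemma isonormal_orthonormal:
  assumes W: "isonormal_gaussian_process M W"
    and U: "finite U" "pairwise orthogonal U" "\<And>u. u \<in> U \<Longrightarrow> norm u = 1"
  shows "prob_space.indep_vars M (\<lambda>_. borel) W U"
    "\<And>u. u \<in> U \<Longrightarrow> distributed M lborel (W u) std_normal_density"
proof -
  have ps: "prob_space M" and gauss: "\<And>A c. finite A \<Longrightarrow> centred_gaussian M (\<lambda>w. \<Sum>h\<in>A. c h * W h w)"
    and cov: "\<And>g h. (\<integral>w. W g w * W h w \<partial>M) = g \<bullet> h"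
    using W by (auto simp: isonormal_gaussian_process_def)
  interpret prob_space M by (rule ps)
  have cW: "centred_gaussian M (W h)" for h using gauss[of "{h}" "\<lambda>_. 1"] by simp
  then have [measurable]: "random_variable borel (W h)" for h by (simp add: centred_gaussian_def)
  have iWW: "integrable M (\<lambda>w. W g w * W h w)" for g h
  proof (rule Bochner_Integration.integrable_bound)
    show "integrable M (\<lambda>w. (W g w)\<^sup>2 + (W h w)\<^sup>2)"
      using centred_gaussian_cf(1)[OF ps cW] by simp
    have "\<bar>x * y\<bar> \<le> x\<^sup>2 + y\<^sup>2" for x y :: real
    proof -
      have "2 * (\<bar>x\<bar> * \<bar>y\<bar>) \<le> x\<^sup>2 + y\<^sup>2"
        using sum_squares_bound[of "\<bar>x\<bar>" "\<bar>y\<bar>"] by (simp add: mult.assoc)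
      moreover have "0 \<le> \<bar>x\<bar> * \<bar>y\<bar>" by simp
      ultimately show ?thesis unfolding abs_mult by linarith
    qed
    then show "AE w in M. norm (W g w * W h w) \<le> norm ((W g w)\<^sup>2 + (W h w)\<^sup>2)"
      by (auto intro!: order_trans[OF _ abs_ge_self])
  qed measurable
  have cf: "(CLINT w|M. iexp (\<Sum>u\<in>U. a u * W u w)) = of_real (exp (- (\<Sum>u\<in>U. (a u)\<^sup>2) / 2))" for a
  proof -
    have "(\<integral>w. (\<Sum>u\<in>U. a u * W u w)\<^sup>2 \<partial>M) = (\<integral>w. (\<Sum>u\<in>U. \<Sum>v\<in>U. (a u * a v) * (W u w * W v w)) \<partial>M)"
      by (simp add: power2_eq_square sum_product mult_ac)
    also have "\<dots> = (\<Sum>u\<in>U. \<Sum>v\<in>U. (a u * a v) * (u \<bullet> v))"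
      using iWW cov by (simp add: Bochner_Integration.integral_sum)
    also have "\<dots> = (\<Sum>u\<in>U. \<Sum>v\<in>U. if u = v then (a u)\<^sup>2 else 0)"
      using U(2,3) by (intro sum.cong refl) (auto simp: pairwise_def orthogonal_def dot_square_norm power2_eq_square)
    also have "\<dots> = (\<Sum>u\<in>U. (a u)\<^sup>2)" using U(1) by simp
    finally show ?thesis using centred_gaussian_cf(2)[OF ps gauss[OF U(1), of a]] by simp
  qed
  show "indep_vars (\<lambda>_. borel) W U" "\<And>u. u \<in> U \<Longrightarrow> distributed M lborel (W u) std_normal_density"
    using indep_vars_gaussian_cf[OF U(1) _ cf] by auto
qed

section \<open>The second Wiener chaos\<close>

text \<open>The right-hand side with 1 in place of \<open>\<alpha>12\<close>, as a function of an
  arbitrary sequence \<kappa>: it is evaluated at the cumulants of the approximations and then at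
  their limits.\<close>

definition cumulant_bound :: "real \<Rightarrow> real \<Rightarrow> real \<Rightarrow> real \<Rightarrow> (nat \<Rightarrow> real) \<Rightarrow> real" where
  "cumulant_bound \<alpha>1 p1 \<alpha>2 p2 \<kappa> = (let \<alpha>13 = 1 / \<alpha>1 - 1 / \<alpha>2 in
     \<bar>p1 / \<alpha>1 - p2 / \<alpha>2\<bar> + \<bar>(p1 + p2) / (\<alpha>1 * \<alpha>2) - \<kappa> 2\<bar> / 2
     + sqrt (1/120 * \<kappa> 6 - 1/12 * \<alpha>13 * \<kappa> 5 + (1/6 * \<alpha>13\<^sup>2 - 1 / (3 * \<alpha>1 * \<alpha>2)) * \<kappa> 4
         + 1 / (\<alpha>1 * \<alpha>2) * \<alpha>13 * \<kappa> 3 + 1/4 * (\<kappa> 3)\<^sup>2 - \<alpha>13 * \<kappa> 2 * \<kappa> 3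
         + 1 / (\<alpha>1\<^sup>2 * \<alpha>2\<^sup>2) * \<kappa> 2 + \<alpha>13\<^sup>2 * (\<kappa> 2)\<^sup>2) / 3)"

lemma tendsto_cumulant_bound:
  assumes "\<And>m. 2 \<le> m \<Longrightarrow> (\<lambda>n. \<kappa> n m) \<longlonglongrightarrow> k m"
  shows "(\<lambda>n. cumulant_bound \<alpha>1 p1 \<alpha>2 p2 (\<kappa> n)) \<longlonglongrightarrow> cumulant_bound \<alpha>1 p1 \<alpha>2 p2 k"
proof -
  have lim: "(\<lambda>n. \<kappa> n 2) \<longlonglongrightarrow> k 2" "(\<lambda>n. \<kappa> n 3) \<longlonglongrightarrow> k 3" "(\<lambda>n. \<kappa> n 4) \<longlonglongrightarrow> k 4"
    "(\<lambda>n. \<kappa> n 5) \<longlonglongrightarrow> k 5" "(\<lambda>n. \<kappa> n 6) \<longlonglongrightarrow> k 6"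
    by (simp_all add: assms)
  show ?thesis
    unfolding cumulant_bound_def Let_def
    by (rule tendsto_const lim tendsto_add tendsto_diff tendsto_mult tendsto_rabs tendsto_power
        tendsto_real_sqrt tendsto_divide | simp)+
qed

text \<open>Stationarity removes the generator integral under the bilateral gamma law, so only the
  Stein functional at \<open>G\<close> remains; its three coefficients receive the weights 1, 1/2
  and 1/3.\<close>

lemma (in gaussian_chaos) chaos_bilateral_gamma_bound:
  assumes pos: "0 < \<alpha>1" "0 < p1" "0 < \<alpha>2" "0 < p2"
    and bg: "prob_space (bilateral_gamma \<alpha>1 p1 \<alpha>2 p2)"
    and h: "smooth3 h h1 h2 1 1 1"
  shows "\<bar>expectation (\<lambda>w. h (G w)) - (\<integral>x. h x \<partial>bilateral_gamma \<alpha>1 p1 \<alpha>2 p2)\<bar>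
    \<le> cumulant_bound \<alpha>1 p1 \<alpha>2 p2 (\<lambda>m. 2 ^ (m - 1) * fact (m - 1) * psum m)"
proof -
  define \<beta> where "\<beta> = 1 / \<alpha>1 - 1 / \<alpha>2"
  define \<gamma> where "\<gamma> = 1 / (\<alpha>1 * \<alpha>2)"
  define \<delta> where "\<delta> = p1 / \<alpha>1 - p2 / \<alpha>2"
  define \<eta> where "\<eta> = (p1 + p2) / (\<alpha>1 * \<alpha>2)"
  define Q where "Q = 2 * (\<Sum>i\<in>S. (- 4 * l i ^ 3 + 2 * \<beta> * l i ^ 2 + \<gamma> * l i)\<^sup>2)
          + (2 * \<beta> * psum 2 - 4 * psum 3)\<^sup>2"
  let ?\<nu> = "bg_jumps \<alpha>1 p1 \<alpha>2 p2" and ?BG = "bilateral_gamma \<alpha>1 p1 \<alpha>2 p2"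
  have nu: "finite_measure ?\<nu>" "sets ?\<nu> = sets borel"
    using finite_measure_bg_jumps[OF pos] sets_jumps(3)[OF pos] by auto
  have G2: "integrable (distr M borel G) (\<lambda>x. x\<^sup>2)"
    using G_integrable(2) by (subst integrable_distr_eq) auto
  have sBG: "sets ?BG = sets borel" by (simp add: bilateral_gamma_def)
  have "\<bar>(\<integral>x. h x \<partial>distr M borel G) - (\<integral>x. h x \<partial>?BG)\<bar> \<le> \<bar>\<delta>\<bar> + \<bar>\<eta> - 2 * psum 2\<bar> / 2 + sqrt Q / 3"
  proof (rule ornstein_uhlenbeck_comparison[OF nu prob_space_distr _ G2 bg sBG integrable_bilateral_gamma_square[OF pos] _ h])
    fix h h1 h2 a b c assume h: "smooth3 h h1 h2 a b c"
    obtain f f1 f2 where f: "\<And>x. (f has_real_derivative f1 x) (at x)"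
      "\<And>x. (f1 has_real_derivative f2 x) (at x)" "continuous_on UNIV f2"
      "\<And>x. \<bar>f x\<bar> \<le> a" "\<And>x. \<bar>f1 x\<bar> \<le> b" "\<And>x. \<bar>f2 x\<bar> \<le> c"
      and gen: "\<And>x. jump_gen ?\<nu> h h1 x = - x * f x + (1 / \<alpha>1 - 1 / \<alpha>2) * x * f1 x
        + x * f2 x / (\<alpha>1 * \<alpha>2) + (p1 / \<alpha>1 - p2 / \<alpha>2) * f x + (p1 + p2) / (\<alpha>1 * \<alpha>2) * f1 x"
      using jump_gen_stein[OF pos h] by metis
    have cont: "continuous_on UNIV f" "continuous_on UNIV f1"
      using f(1,2) by (auto intro!: continuous_at_imp_continuous_on intro: DERIV_isCont)
    have [measurable]: "f \<in> borel_measurable borel" "f1 \<in> borel_measurable borel" "f2 \<in> borel_measurable borel"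
      using cont f(3) by (auto intro: borel_measurable_continuous_onI)
    have "(\<integral>x. jump_gen ?\<nu> h h1 x \<partial>distr M borel G) = expectation (\<lambda>w. jump_gen ?\<nu> h h1 (G w))"
      unfolding gen by (rule integral_distr) measurable
    also have "\<dots> = expectation (\<lambda>w. - G w * f (G w) + \<beta> * G w * f1 (G w) + \<gamma> * G w * f2 (G w)
        + \<delta> * f (G w) + \<eta> * f1 (G w))"
      unfolding gen \<beta>_def \<gamma>_def \<delta>_def \<eta>_def by simp
    finally have eq: "(\<integral>x. jump_gen ?\<nu> h h1 x \<partial>distr M borel G)
      = expectation (\<lambda>w. - G w * f (G w) + \<beta> * G w * f1 (G w) + \<gamma> * G w * f2 (G w)
        + \<delta> * f (G w) + \<eta> * f1 (G w))" .
    show "\<bar>(\<integral>x. jump_gen ?\<nu> h h1 x \<partial>distr M borel G) - (\<integral>x. jump_gen ?\<nu> h h1 x \<partial>?BG)\<bar>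
        \<le> \<bar>\<delta>\<bar> * a + \<bar>\<eta> - 2 * psum 2\<bar> * b + sqrt Q * c"
      unfolding eq bilateral_gamma_stationary[OF pos h] diff_0_right Q_def
      by (rule stein_functional[OF f(1,2,4,5,6,3)])
  qed simp_all
  moreover have "(\<integral>x. h x \<partial>distr M borel G) = expectation (\<lambda>w. h (G w))"
    using smooth3D(9)[OF h] by (intro integral_distr) (auto intro: borel_measurable_continuous_onI)
  moreover have "\<bar>\<delta>\<bar> + \<bar>\<eta> - 2 * psum 2\<bar> / 2 + sqrt Q / 3
      = cumulant_bound \<alpha>1 p1 \<alpha>2 p2 (\<lambda>m. 2 ^ (m - 1) * fact (m - 1) * psum m)"
  proof -
    \<comment> \<open>The squares contribute power sums of orders 2 to 6. The ratio of cumulant to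
      power sum is 3840, 384, 48, 8, 2 for the orders 6, 5, 4, 3, 2; dividing by it yields 1/120,
      1/12, 1/6 and 1/3. The square of the mean of \<open>R\<close>, which is
      \<open>\<beta> \<kappa>2 - \<kappa>3 / 2\<close>, yields the quadratic terms in the
      cumulants.\<close>
    have "(\<Sum>i\<in>S. (- 4 * l i ^ 3 + 2 * \<beta> * l i ^ 2 + \<gamma> * l i)\<^sup>2)
        = (\<Sum>i\<in>S. 16 * l i ^ 6 - 16 * \<beta> * l i ^ 5 + (4 * \<beta>\<^sup>2 - 8 * \<gamma>) * l i ^ 4 + 4 * \<beta> * \<gamma> * l i ^ 3 + \<gamma>\<^sup>2 * l i ^ 2)"
      by (intro sum.cong refl) (simp add: power2_eq_square algebra_simps eval_nat_numeral)
    also have "\<dots> = 16 * psum 6 - 16 * \<beta> * psum 5 + (4 * \<beta>\<^sup>2 - 8 * \<gamma>) * psum 4 + 4 * \<beta> * \<gamma> * psum 3 + \<gamma>\<^sup>2 * psum 2"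
      by (simp add: sum.distrib sum_subtractf psum_def sum_distrib_left)
    finally have Q: "Q = 2 * (16 * psum 6 - 16 * \<beta> * psum 5 + (4 * \<beta>\<^sup>2 - 8 * \<gamma>) * psum 4 + 4 * \<beta> * \<gamma> * psum 3 + \<gamma>\<^sup>2 * psum 2)
        + (2 * \<beta> * psum 2 - 4 * psum 3)\<^sup>2" by (simp add: Q_def)
    have f: "fact 5 = (120::real)" "fact 4 = (24::real)" "fact 3 = (6::real)" "fact 2 = (2::real)"
      by (simp_all add: fact_numeral)
    have g: "1 / (3 * \<alpha>1 * \<alpha>2) = \<gamma> / 3" "1 / (\<alpha>1\<^sup>2 * \<alpha>2\<^sup>2) = \<gamma>\<^sup>2"
      by (simp_all add: \<gamma>_def power_mult_distrib power_divide)
    show ?thesis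
      unfolding cumulant_bound_def Let_def \<beta>_def[symmetric] \<delta>_def[symmetric] \<eta>_def[symmetric] g \<gamma>_def[symmetric] Q
      by (simp add: f power2_eq_square algebra_simps)
  qed
  ultimately show ?thesis by simp
qed

lemma (in gaussian_chaos) chaos_log_cumulant:
  assumes "2 \<le> m"
  shows "Re ((- \<i>) ^ m * (deriv ^^ m) (chaos_log S l) 0) = 2 ^ (m - 1) * fact (m - 1) * psum m"
proof -
  obtain n where m: "m = Suc (Suc n)" using assms by (metis Suc_le_D numeral_2_eq_2 Suc_le_mono)
  define c where "c = 2 ^ (m - 1) * fact (m - 1) * psum m"
  have "(- \<i>) ^ m * \<i> ^ m = 1" unfolding power_mult_distrib[symmetric] by simp
  moreover have "(deriv ^^ m) (chaos_log S l) 0 = \<i> ^ m * of_real c"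
    unfolding c_def m psum_def diff_Suc_1 by (rule chaos_log_higher_deriv[OF finite_S])
  ultimately have "(- \<i>) ^ m * (deriv ^^ m) (chaos_log S l) 0 = of_real c"
    by (simp only: mult.assoc[symmetric] mult_1_left)
  then show ?thesis unfolding c_def by (simp only: Re_complex_of_real)
qed

text \<open>The codomain is general because this serves both the real test function and the complex
  exponential: a Lipschitz function turns convergence in mean into convergence of
  expectations.\<close>

lemma (in prob_space) lipschitz_expectation_tendsto:
  fixes g :: "real \<Rightarrow> 'c::{banach, second_countable_topology}"
  assumes [measurable]: "\<And>k. random_variable borel (V k)" "random_variable borel Y"
    and i1: "\<And>k. integrable M (\<lambda>w. V k w - Y w)"
    and e: "(\<lambda>k. expectation (\<lambda>w. \<bar>V k w - Y w\<bar>)) \<longlonglongrightarrow> 0"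
    and g[measurable]: "g \<in> borel_measurable borel"
    and bounded: "\<And>x. norm (g x) \<le> 1" and lip: "\<And>x y. norm (g x - g y) \<le> K * \<bar>x - y\<bar>"
  shows "(\<lambda>k. expectation (\<lambda>w. g (V k w))) \<longlonglongrightarrow> expectation (\<lambda>w. g (Y w))"
proof (rule LIM_zero_cancel, rule Lim_null_comparison)
  let ?d = "\<lambda>k. norm (expectation (\<lambda>w. g (V k w)) - expectation (\<lambda>w. g (Y w)))" and ?e = "\<lambda>k. K * expectation (\<lambda>w. \<bar>V k w - Y w\<bar>)"
  have ig: "integrable M (\<lambda>w. g (V k w))" "integrable M (\<lambda>w. g (Y w))" for k
    by (rule integrable_const_bound[of _ 1]; use bounded in simp)+
  have "?d k
      \<le> ?e k" for k
  proof -
    have "?d k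
        = norm (expectation (\<lambda>w. g (V k w) - g (Y w)))"
      using ig by simp
    also have "\<dots> \<le> expectation (\<lambda>w. norm (g (V k w) - g (Y w)))" by (rule integral_norm_bound)
    also have "\<dots> \<le> expectation (\<lambda>w. K * \<bar>V k w - Y w\<bar>)"
      using ig i1 lip by (intro integral_mono) auto
    finally show ?thesis by simp
  qed
  then show "\<forall>\<^sub>F k in sequentially. ?d k
      \<le> ?e k" by simp
  show "?e \<longlonglongrightarrow> 0"
    using e by (rule tendsto_mult_right_zero)
qed

context
  fixes M :: "'a measure"
    and W :: "'h::{real_inner, polish_space} \<Rightarrow> 'a \<Rightarrow> real"
    and tensor :: "'h \<Rightarrow> 'h \<Rightarrow> 't::{real_inner, complete_space}"
    and I2 :: "'t \<Rightarrow> 'a \<Rightarrow> real"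
  assumes W: "isonormal_gaussian_process M W"
    and ts: "hilbert_tensor_square tensor"
    and I2: "double_wiener_integral M W tensor I2"
begin

interpretation prob_space M using W by (simp add: isonormal_gaussian_process_def)

lemma I2_measurable: "f \<in> sym_tensors tensor \<Longrightarrow> I2 f \<in> borel_measurable M"
  and I2_square_integrable: "f \<in> sym_tensors tensor \<Longrightarrow> integrable M (\<lambda>w. (I2 f w)\<^sup>2)"
  and I2_linear: "f \<in> sym_tensors tensor \<Longrightarrow> g \<in> sym_tensors tensor \<Longrightarrow>
    AE w in M. I2 (a *\<^sub>R f + b *\<^sub>R g) w = a * I2 f w + b * I2 g w"
  and I2_continuous: "f \<in> sym_tensors tensor \<Longrightarrow>
    ((\<lambda>g. \<integral>w. (I2 g w - I2 f w)\<^sup>2 \<partial>M) \<longlongrightarrow> 0) (at f within sym_tensors tensor)"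
  and I2_square: "norm u = 1 \<Longrightarrow> AE w in M. I2 (tensor u u) w = (W u w)\<^sup>2 - 1"
  using I2 by (auto simp: double_wiener_integral_def)

lemma I2_diagonal:
  assumes "finite U" "\<And>u. u \<in> U \<Longrightarrow> norm u = 1"
  shows "AE w in M. I2 (\<Sum>u\<in>U. l u *\<^sub>R tensor u u) w = (\<Sum>u\<in>U. l u * ((W u w)\<^sup>2 - 1))"
  using assms
proof (induction U)
  case empty
  have "0 \<in> sym_tensors tensor" using diagonal_tensor_in_sym_tensors[OF ts, of "\<lambda>_. 0" "{}"] by simp
  from I2_linear[OF this this, of 0 0] show ?case by simp
next
  case (insert v U)
  have v: "tensor v v \<in> sym_tensors tensor"
    using diagonal_tensor_in_sym_tensors[OF ts, of "\<lambda>_. 1" "{v}"] by simp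
  have "AE w in M. I2 (l v *\<^sub>R tensor v v + 1 *\<^sub>R (\<Sum>u\<in>U. l u *\<^sub>R tensor u u)) w
      = l v * I2 (tensor v v) w + 1 * I2 (\<Sum>u\<in>U. l u *\<^sub>R tensor u u) w"
    by (rule I2_linear[OF v diagonal_tensor_in_sym_tensors[OF ts]])
  moreover have "AE w in M. I2 (tensor v v) w = (W v w)\<^sup>2 - 1"
    using insert.prems by (intro I2_square) simp
  moreover have "AE w in M. I2 (\<Sum>u\<in>U. l u *\<^sub>R tensor u u) w = (\<Sum>u\<in>U. l u * ((W u w)\<^sup>2 - 1))"
    using insert by simp
  ultimately show ?case
  proof eventually_elim
    case (elim w)
    then show ?case using insert.hyps by simp
  qed
qed

text \<open>The approximation is close in two senses at once: in tensor norm, which bounds the sum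
  of the squared eigenvalues, and in mean square, which controls the law.\<close>

lemma I2_diagonal_approximation:
  assumes f: "f \<in> sym_tensors tensor" and e: "0 < e"
  shows "\<exists>U l. finite U \<and> pairwise orthogonal U \<and> (\<forall>u\<in>U. norm u = 1)
    \<and> (\<Sum>u\<in>U. (l u)\<^sup>2) \<le> (norm f + e)\<^sup>2
    \<and> integrable M (\<lambda>w. ((\<Sum>u\<in>U. l u * ((W u w)\<^sup>2 - 1)) - I2 f w)\<^sup>2)
    \<and> (\<integral>w. ((\<Sum>u\<in>U. l u * ((W u w)\<^sup>2 - 1)) - I2 f w)\<^sup>2 \<partial>M) < e"
proof -
  have "\<forall>\<^sub>F g in at f within sym_tensors tensor. (\<integral>w. (I2 g w - I2 f w)\<^sup>2 \<partial>M) < e"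
    using I2_continuous[OF f] e by (rule order_tendstoD)
  then obtain d where d: "0 < d" "\<And>g. g \<in> sym_tensors tensor \<Longrightarrow> g \<noteq> f \<Longrightarrow> dist g f < d \<Longrightarrow>
      (\<integral>w. (I2 g w - I2 f w)\<^sup>2 \<partial>M) < e"
    unfolding eventually_at by blast
  have "f \<in> closure (span {tensor a b + tensor b a |a b. True})" using f by (simp add: sym_tensors_def)
  moreover have "0 < min d e" using d(1) e by simp
  ultimately obtain g where g: "g \<in> span {tensor a b + tensor b a |a b. True}" "dist g f < min d e"
    unfolding closure_approachable by blast
  obtain U l where U: "finite U" "pairwise orthogonal U" "\<And>u. u \<in> U \<Longrightarrow> norm u = 1"
      and gU: "g = (\<Sum>u\<in>U. l u *\<^sub>R tensor u u)"
    using sym_tensor_diagonal[OF ts g(1)] by blast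
  let ?V = "\<lambda>w. \<Sum>u\<in>U. l u * ((W u w)\<^sup>2 - 1)"
  have gs: "g \<in> sym_tensors tensor" unfolding gU by (rule diagonal_tensor_in_sym_tensors[OF ts])
  \<comment> \<open>The punctured limit at \<open>f\<close> leaves out \<open>g = f\<close>, where
    the integral is 0.\<close>
  have small: "(\<integral>w. (I2 g w - I2 f w)\<^sup>2 \<partial>M) < e"
    using d(2)[OF gs] g(2) e by (cases "g = f") auto
  have [measurable]: "I2 g \<in> borel_measurable M" "I2 f \<in> borel_measurable M"
    using I2_measurable gs f by auto
  have [measurable]: "W u \<in> borel_measurable M" for u
  proof -
    have "centred_gaussian M (\<lambda>w. \<Sum>h\<in>A. c h * W h w)" if "finite A" for A c
      using W that by (auto simp: isonormal_gaussian_process_def)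
    from this[of "{u}" "\<lambda>_. 1"] show ?thesis by (simp add: centred_gaussian_def)
  qed
  have AE: "AE w in M. I2 g w = ?V w"
    unfolding gU by (rule I2_diagonal[OF U(1,3)])
  have int: "integrable M (\<lambda>w. (I2 g w - I2 f w)\<^sup>2)"
  proof (rule Bochner_Integration.integrable_bound)
    show "integrable M (\<lambda>w. 2 * (I2 g w)\<^sup>2 + 2 * (I2 f w)\<^sup>2)"
      using I2_square_integrable gs f by simp
    have "(x - y)\<^sup>2 \<le> 2 * x\<^sup>2 + 2 * y\<^sup>2" for x y :: real
      using zero_le_power2[of "x + y"] by (simp add: power2_eq_square algebra_simps)
    then show "AE w in M. norm ((I2 g w - I2 f w)\<^sup>2) \<le> norm (2 * (I2 g w)\<^sup>2 + 2 * (I2 f w)\<^sup>2)"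
      by simp
  qed measurable
  show ?thesis
  proof (intro exI[of _ U] exI[of _ l] conjI ballI U)
    have "norm g \<le> norm f + e"
      using norm_triangle_ineq2[of g f] g(2) by (simp add: dist_norm)
    then have "(norm g)\<^sup>2 \<le> (norm f + e)\<^sup>2" by (intro power_mono) auto
    moreover have "(norm g)\<^sup>2 = (\<Sum>u\<in>U. (l u)\<^sup>2)"
      unfolding gU by (rule norm_diagonal_tensor[OF ts U]) simp
    ultimately show "(\<Sum>u\<in>U. (l u)\<^sup>2) \<le> (norm f + e)\<^sup>2" by simp
    show "integrable M (\<lambda>w. (?V w - I2 f w)\<^sup>2)"
      using int AE by (subst integrable_cong_AE[where g="\<lambda>w. (I2 g w - I2 f w)\<^sup>2"]) auto
    have "(\<integral>w. (?V w - I2 f w)\<^sup>2 \<partial>M) = (\<integral>w. (I2 g w - I2 f w)\<^sup>2 \<partial>M)"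
      using AE by (intro integral_cong_AE) auto
    with small show "(\<integral>w. (?V w - I2 f w)\<^sup>2 \<partial>M) < e" by simp
  qed
qed

text \<open>The inequality for finite chaos passes to the limit on both sides: on the left by
  convergence in mean, on the right along the subsequence on which the cumulants converge.\<close>

lemma second_chaos_bilateral_gamma_bound:
  assumes f: "f \<in> sym_tensors tensor"
    and pos: "0 < \<alpha>1" "0 < p1" "0 < \<alpha>2" "0 < p2"
    and bg: "prob_space (bilateral_gamma \<alpha>1 p1 \<alpha>2 p2)"
    and h: "smooth3 h h1 h2 1 1 1"
  shows "\<bar>(\<integral>w. h (I2 f w) \<partial>M) - (\<integral>x. h x \<partial>bilateral_gamma \<alpha>1 p1 \<alpha>2 p2)\<bar>
    \<le> cumulant_bound \<alpha>1 p1 \<alpha>2 p2 (cumulant M (I2 f))"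
proof -
  let ?h = "\<integral>x. h x \<partial>bilateral_gamma \<alpha>1 p1 \<alpha>2 p2" and ?b = "cumulant_bound \<alpha>1 p1 \<alpha>2 p2"
  define P where "P k U l \<longleftrightarrow> finite U \<and> pairwise orthogonal U \<and> (\<forall>u\<in>U. norm u = 1)
      \<and> (\<Sum>u\<in>U. (l u)\<^sup>2) \<le> (norm f + 1 / real (Suc k))\<^sup>2
      \<and> integrable M (\<lambda>w. ((\<Sum>u\<in>U. l u * ((W u w)\<^sup>2 - 1)) - I2 f w)\<^sup>2)
      \<and> (\<integral>w. ((\<Sum>u\<in>U. l u * ((W u w)\<^sup>2 - 1)) - I2 f w)\<^sup>2 \<partial>M) < 1 / real (Suc k)" for k U l
  have "\<forall>k. \<exists>U l. P k U l"
    unfolding P_def by (intro allI I2_diagonal_approximation[OF f]) simp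
  then obtain U l where "\<And>k. P k (U k) (l k)" by metis
  then have U: "\<And>k. finite (U k)" "\<And>k. pairwise orthogonal (U k)" "\<And>k u. u \<in> U k \<Longrightarrow> norm u = 1"
    and bound: "\<And>k. (\<Sum>u\<in>U k. (l k u)\<^sup>2) \<le> (norm f + 1 / real (Suc k))\<^sup>2"
    and int: "\<And>k. integrable M (\<lambda>w. ((\<Sum>u\<in>U k. l k u * ((W u w)\<^sup>2 - 1)) - I2 f w)\<^sup>2)"
    and small: "\<And>k. (\<integral>w. ((\<Sum>u\<in>U k. l k u * ((W u w)\<^sup>2 - 1)) - I2 f w)\<^sup>2 \<partial>M) < 1 / real (Suc k)"
    unfolding P_def by blast+
  have chaos: "gaussian_chaos M (U k) W" for k
    using U(1)[of k] isonormal_orthonormal[OF W U(1) U(2) U(3), of k]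
    by unfold_locales auto
  define V where "V k = gaussian_chaos.G (U k) W (l k)" for k
  have V: "V k w = (\<Sum>u\<in>U k. l k u * ((W u w)\<^sup>2 - 1))" for k w
    unfolding V_def gaussian_chaos.G_def[OF chaos] gaussian_chaos.C_def[OF chaos] ..
  have [measurable]: "V k \<in> borel_measurable M" for k
    unfolding V_def by (rule gaussian_chaos.G_measurable[OF chaos])
  have [measurable]: "I2 f \<in> borel_measurable M" by (rule I2_measurable[OF f])
  define e where "e k = (\<integral>w. \<bar>V k w - I2 f w\<bar> \<partial>M)" for k
  have i1: "integrable M (\<lambda>w. V k w - I2 f w)" for k
  proof (rule square_integrable_imp_integrable)
    show "integrable M (\<lambda>w. (V k w - I2 f w)\<^sup>2)" using int[of k] by (simp add: V)
  qed measurable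
  have e: "e \<longlonglongrightarrow> 0"
  proof (rule Lim_null_comparison)
    have "\<bar>e k\<bar> \<le> sqrt (1 / real (Suc k))" for k
    proof -
      have "0 \<le> e k" unfolding e_def by (rule Bochner_Integration.integral_nonneg) simp
      moreover have "e k \<le> sqrt (\<integral>w. (V k w - I2 f w)\<^sup>2 \<partial>M)"
        unfolding e_def by (rule expectation_abs_le_sqrt) (measurable, simp only: V int)
      moreover have "\<dots> \<le> sqrt (1 / real (Suc k))"
        using small[of k] by (intro real_sqrt_le_mono) (simp only: V less_imp_le)
      ultimately show ?thesis by linarith
    qed
    then show "\<forall>\<^sub>F k in sequentially. norm (e k) \<le> sqrt (1 / real (Suc k))" by simp
    have "(\<lambda>k. sqrt (1 / real (Suc k))) \<longlonglongrightarrow> sqrt 0"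
      by (intro tendsto_real_sqrt LIMSEQ_Suc lim_1_over_n)
    then show "(\<lambda>k. sqrt (1 / real (Suc k))) \<longlonglongrightarrow> 0" by simp
  qed
  note lip = lipschitz_expectation_tendsto[OF _ _ i1 e[unfolded e_def]]
  \<comment> \<open>All approximating tensors have norm at most \<open>norm f + 1\<close>, and
    \<open>r\<close> is chosen so that \<open>4 * r\<^sup>2 * K\<close> is exactly 1/4; one disc
    serves the whole sequence.\<close>
  define K where "K = (norm f + 1)\<^sup>2"
  define r where "r = 1 / (4 * (norm f + 1))"
  have nf: "0 < norm f + 1" by (simp add: add_nonneg_pos)
  have r: "0 < r" using nf by (simp add: r_def)
  have rK: "4 * r\<^sup>2 * K \<le> 1 / 4"
  proof -
    have "4 * (1 / (4 * x))\<^sup>2 * x\<^sup>2 = 1 / 4" if "0 < x" for x :: real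
      using that by (simp add: power2_eq_square)
    from this[OF nf] show ?thesis by (simp only: r_def K_def)
  qed
  have lK: "(\<Sum>u\<in>U k. (l k u)\<^sup>2) \<le> K" for k
  proof -
    have "(norm f + 1 / real (Suc k))\<^sup>2 \<le> K"
      unfolding K_def by (intro power_mono) auto
    then show ?thesis using bound[of k] by linarith
  qed
  have cf: "(\<lambda>k. exp (chaos_log (U k) (l k) (of_real t))) \<longlonglongrightarrow> char (distr M borel (I2 f)) t" for t
  proof -
    have "exp (chaos_log (U k) (l k) (of_real t)) = (CLINT w|M. iexp (t * V k w))" for k
      using gaussian_chaos.cf_eq_exp[OF chaos, of k "l k" t] gaussian_chaos.cf_def[OF chaos, of k "l k" t] by (simp add: V_def)
    moreover have "char (distr M borel (I2 f)) t = (CLINT w|M. iexp (t * I2 f w))"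
      unfolding char_def by (rule integral_distr) simp_all
    moreover have "(\<lambda>k. CLINT w|M. iexp (t * V k w)) \<longlonglongrightarrow> (CLINT w|M. iexp (t * I2 f w))"
    proof (rule lip[of "\<lambda>x. iexp (t * x)" "\<bar>t\<bar>"])
      fix x y
      \<comment> \<open>With a factor of modulus 1 split off, the Lipschitz bound is the Taylor
        estimate of order 0.\<close>
      have "iexp (t * x) - iexp (t * y) = iexp (t * y) * (iexp (t * (x - y)) - (\<Sum>k\<le>0. (\<i> * (t * (x - y))) ^ k / fact k))"
      proof -
        have "\<i> * complex_of_real (t * x) = \<i> * of_real (t * y) + \<i> * of_real (t * (x - y))"
          by (simp add: algebra_simps)
        then have "iexp (t * x) = iexp (t * y) * iexp (t * (x - y))" by (simp only: exp_add)
        then show ?thesis by (simp add: right_diff_distrib)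
      qed
      then have "norm (iexp (t * x) - iexp (t * y)) = norm (iexp (t * (x - y)) - (\<Sum>k\<le>0. (\<i> * (t * (x - y))) ^ k / fact k))"
        by (simp only: norm_mult norm_exp_i_times)
      also have "\<dots> \<le> \<bar>t * (x - y)\<bar> ^ Suc 0 / fact (Suc 0)"
        by (rule iexp_approx1)
      finally show "norm (iexp (t * x) - iexp (t * y)) \<le> \<bar>t\<bar> * \<bar>x - y\<bar>" by (simp add: abs_mult)
    qed simp_all
    ultimately show ?thesis by simp
  qed
  obtain s :: "nat \<Rightarrow> nat" where s: "strict_mono s"
    and cum: "\<And>m. (\<lambda>n. Re ((- \<i>) ^ m * (deriv ^^ m) (chaos_log (U (s n)) (l (s n))) 0)) \<longlonglongrightarrow> cumulant M (I2 f) m"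
  proof (rule cumulant_limit[OF r, of "\<lambda>k. chaos_log (U k) (l k)" M "I2 f"])
    show "chaos_log (U k) (l k) holomorphic_on ball 0 r" for k
      by (rule chaos_log_holomorphic) (rule chaos_log_bounded(1)[OF lK rK U(1)])
    show "norm (chaos_log (U k) (l k) z) \<le> 1" if "z \<in> ball 0 r" for k z
      by (rule chaos_log_bounded(2)[OF lK rK U(1) that])
  qed (use cf in auto)
  show ?thesis
  proof (rule LIMSEQ_le)
    have "(\<lambda>k. \<integral>w. h (V k w) \<partial>M) \<longlonglongrightarrow> (\<integral>w. h (I2 f w) \<partial>M)"
      using smooth3D[OF h] by (intro lip[of h 1]) (auto intro: borel_measurable_continuous_onI)
    then have "(\<lambda>n. \<integral>w. h (V (s n) w) \<partial>M) \<longlonglongrightarrow> (\<integral>w. h (I2 f w) \<partial>M)"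
      using LIMSEQ_subseq_LIMSEQ[OF _ s] by (fastforce simp: o_def)
    then show "(\<lambda>n. \<bar>(\<integral>w. h (V (s n) w) \<partial>M) - ?h\<bar>)
        \<longlonglongrightarrow> \<bar>(\<integral>w. h (I2 f w) \<partial>M) - ?h\<bar>"
      by (intro tendsto_intros)
    show "(\<lambda>n. ?b
          (\<lambda>m. 2 ^ (m - 1) * fact (m - 1) * gaussian_chaos.psum (U (s n)) (l (s n)) m))
        \<longlonglongrightarrow> ?b (cumulant M (I2 f))"
    proof (rule tendsto_cumulant_bound)
      fix m :: nat assume "2 \<le> m"
      then show "(\<lambda>n. 2 ^ (m - 1) * fact (m - 1) * gaussian_chaos.psum (U (s n)) (l (s n)) m)
          \<longlonglongrightarrow> cumulant M (I2 f) m"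
        using cum[of m] by (simp only: gaussian_chaos.chaos_log_cumulant[OF chaos])
    qed
    show "\<exists>N. \<forall>n\<ge>N. \<bar>(\<integral>w. h (V (s n) w) \<partial>M) - ?h\<bar>
        \<le> ?b
          (\<lambda>m. 2 ^ (m - 1) * fact (m - 1) * gaussian_chaos.psum (U (s n)) (l (s n)) m)"
      unfolding V_def by (intro exI allI impI gaussian_chaos.chaos_bilateral_gamma_bound[OF chaos pos bg h])
  qed
qed

end

section \<open>Passage to the metric\<close>

lemma W3_smooth3:
  assumes h: "h \<in> W3"
  shows "smooth3 h (deriv h) (deriv (deriv h)) 1 1 1"
proof -
  have d: "(deriv ^^ k) h differentiable (at x)" if "k < 3" for k x using h that by (auto simp: W3_def)
  have b: "\<bar>(deriv ^^ k) h x\<bar> \<le> 1" if "k \<le> 3" for k x using h that by (auto simp: W3_def)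
  have D: "((deriv ^^ k) h has_real_derivative (deriv ^^ Suc k) h x) (at x)" if "k < 3" for k x
    using d[OF that, of x] by (simp add: DERIV_deriv_iff_real_differentiable)
  have 3: "\<bar>deriv (deriv h) x - deriv (deriv h) y\<bar> \<le> 1 * \<bar>x - y\<bar>" for x y
    by (rule real_derivative_lipschitz_bound[where ?w1.0="(deriv ^^ 3) h"])
       (use D[of 2] b[of 3] in \<open>auto simp: numeral_2_eq_2 numeral_3_eq_3\<close>)
  show ?thesis
    unfolding smooth3_def
    using D[of 0] D[of 1] b[of 0] b[of 1] b[of 2] 3 by (auto simp: numeral_2_eq_2)
qed

text \<open>Serves twice: it makes the supremum run over a nonempty set, and as a test function it
  shows that the bound is nonnegative.\<close>

lemma zero_in_W3: "(\<lambda>_. 0) \<in> W3"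
proof -
  have "(deriv ^^ k) (\<lambda>_. 0 :: real) = (\<lambda>_. 0)" for k by (induction k) auto
  then show ?thesis by (simp add: W3_def)
qed

theorem theorem4p9:
  fixes \<alpha>1 p1 \<alpha>2 p2 \<alpha>12 \<alpha>13 :: real
    and M :: "'a measure" and N :: "'b measure"
    and W :: "'h::{real_inner, polish_space} \<Rightarrow> 'a \<Rightarrow> real"
    and tensor :: "'h \<Rightarrow> 'h \<Rightarrow> 't::{real_inner, complete_space}"
    and I2 :: "'t \<Rightarrow> 'a \<Rightarrow> real"
    and f :: "nat \<Rightarrow> 't" and G :: "nat \<Rightarrow> 'a \<Rightarrow> real" and X :: "'b \<Rightarrow> real"
  assumes "\<alpha>1 > 0" "p1 > 0" "\<alpha>2 > 0" "p2 > 0"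
    and "\<alpha>1 * \<alpha>2 > 1 + \<bar>\<alpha>1 - \<alpha>2\<bar>"
    and "prob_space N" "X \<in> borel_measurable N"
    and "distr N borel X = bilateral_gamma \<alpha>1 p1 \<alpha>2 p2"
    and "isonormal_gaussian_process M W"
    and "hilbert_tensor_square tensor"
    and "double_wiener_integral M W tensor I2"
    and "\<And>n. n \<ge> 1 \<Longrightarrow> f n \<in> sym_tensors tensor"
    and "\<And>n. n \<ge> 1 \<Longrightarrow> G n = I2 (f n)"
    and "\<alpha>12 = \<alpha>1 * \<alpha>2 / (\<alpha>1 * \<alpha>2 - (1 + \<bar>\<alpha>1 - \<alpha>2\<bar>))"
    and "\<alpha>13 = 1 / \<alpha>1 - 1 / \<alpha>2"
  shows "\<forall>n\<ge>1. d3 M (G n) N X \<le>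
      1/3 * \<alpha>12 * sqrt (
          1/120 * cumulant M (G n) 6
        - 1/12 * \<alpha>13 * cumulant M (G n) 5
        + (1/6 * \<alpha>13\<^sup>2 - 1 / (3 * \<alpha>1 * \<alpha>2)) * cumulant M (G n) 4
        + 1 / (\<alpha>1 * \<alpha>2) * \<alpha>13 * cumulant M (G n) 3
        + 1/4 * (cumulant M (G n) 3)\<^sup>2
        - \<alpha>13 * cumulant M (G n) 2 * cumulant M (G n) 3
        + 1 / (\<alpha>1\<^sup>2 * \<alpha>2\<^sup>2) * cumulant M (G n) 2
        + \<alpha>13\<^sup>2 * (cumulant M (G n) 2)\<^sup>2)
      + 1/2 * \<alpha>12 * \<bar>(p1 + p2) / (\<alpha>1 * \<alpha>2) - cumulant M (G n) 2\<bar>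
      + \<alpha>12 * \<bar>p1 / \<alpha>1 - p2 / \<alpha>2\<bar>"
proof (intro allI impI, goal_cases)
  case n: (1 n)
  note pos = assms(1-4) and cond = assms(5) and N = assms(6) and X[measurable] = assms(7)
    and law = assms(8) and W = assms(9) and ts = assms(10) and I2 = assms(11)
    and a12 = assms(14) and a13 = assms(15)
  let ?BG = "bilateral_gamma \<alpha>1 p1 \<alpha>2 p2"
  define \<kappa> where "\<kappa> = cumulant M (G n)"
  have bg: "prob_space ?BG"
    unfolding law[symmetric] by (rule prob_space.prob_space_distr[OF N X])
  have f: "f n \<in> sym_tensors tensor" and G: "G n = I2 (f n)" using assms(12,13) n by auto
  have bound: "\<bar>(\<integral>w. h (G n w) \<partial>M) - (\<integral>w. h (X w) \<partial>N)\<bar> \<le> cumulant_bound \<alpha>1 p1 \<alpha>2 p2 \<kappa>"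
    if "h \<in> W3" for h
  proof -
    have h: "smooth3 h (deriv h) (deriv (deriv h)) 1 1 1" using that by (rule W3_smooth3)
    have [measurable]: "h \<in> borel_measurable borel"
      using smooth3D(9)[OF h] by (rule borel_measurable_continuous_onI)
    have "(\<integral>w. h (X w) \<partial>N) = (\<integral>x. h x \<partial>?BG)"
      unfolding law[symmetric] by (rule integral_distr[symmetric]) simp_all
    then show ?thesis
      using second_chaos_bilateral_gamma_bound[OF W ts I2 f pos bg h] by (simp only: G \<kappa>_def)
  qed
  define Q where "Q = 1/120 * \<kappa> 6 - 1/12 * \<alpha>13 * \<kappa> 5
        + (1/6 * \<alpha>13\<^sup>2 - 1 / (3 * \<alpha>1 * \<alpha>2)) * \<kappa> 4 + 1 / (\<alpha>1 * \<alpha>2) * \<alpha>13 * \<kappa> 3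
        + 1/4 * (\<kappa> 3)\<^sup>2 - \<alpha>13 * \<kappa> 2 * \<kappa> 3 + 1 / (\<alpha>1\<^sup>2 * \<alpha>2\<^sup>2) * \<kappa> 2 + \<alpha>13\<^sup>2 * (\<kappa> 2)\<^sup>2"
  define B where "B = \<bar>p1 / \<alpha>1 - p2 / \<alpha>2\<bar> + \<bar>(p1 + p2) / (\<alpha>1 * \<alpha>2) - \<kappa> 2\<bar> / 2 + sqrt Q / 3"
  have B: "cumulant_bound \<alpha>1 p1 \<alpha>2 p2 \<kappa> = B"
    by (simp only: cumulant_bound_def Let_def B_def Q_def a13)
  \<comment> \<open>Not evident from the definition, as \<open>sqrt\<close> of a negative number is
    negative; the inequality itself, tested on the zero function, gives the sign.\<close>
  have "0 \<le> B" using bound[OF zero_in_W3] by (simp add: B)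
  \<comment> \<open>By \<open>cond\<close> the denominator is positive, and it falls short of the
    numerator by \<open>1 + \<bar>\<alpha>1 - \<alpha>2\<bar>\<close>.\<close>
  have "1 \<le> \<alpha>12" unfolding a12 using cond by (simp add: le_divide_eq)
  have "d3 M (G n) N X \<le> B"
    unfolding d3_def
  proof (rule cSUP_least)
    show "W3 \<noteq> {}" using zero_in_W3 by blast
  qed (use bound B in simp)
  also have "\<dots> \<le> \<alpha>12 * B" using mult_right_mono[OF \<open>1 \<le> \<alpha>12\<close> \<open>0 \<le> B\<close>] by simp
  also have "\<dots> = 1/3 * \<alpha>12 * sqrt Q + 1/2 * \<alpha>12 * \<bar>(p1 + p2) / (\<alpha>1 * \<alpha>2) - \<kappa> 2\<bar>
      + \<alpha>12 * \<bar>p1 / \<alpha>1 - p2 / \<alpha>2\<bar>"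
    by (simp add: B_def algebra_simps)
  finally show ?case
    unfolding Q_def \<kappa>_def .
qed

end
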